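(* Let $d\ge 1$, $H\in(0,1)$, let $k=(k_1,\dots,k_d)\in\mathbb{N}^d$ (with $0\in\mathbb{N}$) and $|k|=k_1+\cdots+k_d$. Suppose that $$2|k|H+Hd<2\quad\text{and}\quad 0\le\beta<\frac{1}{|k|+|k|H+dH}.$$ Let $\alpha^{(k)}$ be the $k$-th derivative of the intersection local time on $[0,1]^2$ of two independent $d$-dimensional fractional Brownian motions $B^H,\hat B^H$ with the same Hurst parameter $H$. Then there exists a constant $M>0$ such that $$\mathbb{E}\left[e^{M|\alpha^{(k)}|^{\beta}}\right]<\infty .$$
   Context: A $d$-dimensional fractional Brownian motion $B^H=(B^{H,1},\dots,B^{H,d})$ with Hurst parameter $H\in(0,1)$ is an a.s. continuous centered Gaussian process whose components are independent copies of a one-dimensional fractional Brownian motion with covariance $\mathbb{E}[B^{H,j}_tB^{H,j}_s]=\tfrac12(t^{2H}+s^{2H}-|t-s|^{2H})$. For $\epsilon>0$ and $x\in\mathbb{R}^d$, $\delta_\epsilon(x)=(2\pi\epsilon)^{-d/2}e^{-|x|^2/(2\epsilon)}$, and $\delta_\epsilon^{(k)}=\partial_{x_1}^{k_1}\cdots\partial_{x_d}^{k_d}\delta_\epsilon$. Put $\alpha_\epsilon^{(k)}=\int_0^1\int_0^1\delta_\epsilon^{(k)}(B^H_s-\hat B^H_r)\,dr\,ds$. Under the condition $2|k|H+Hd<2$, $\alpha^{(k)}_\epsilon$ converges in $L^n(\Omega)$ for every $n\ge1$ as $\epsilon\to0$; $\alpha^{(k)}$ denotes its limit (formally $\alpha^{(k)}=\int_0^1\int_0^1\delta^{(k)}(B^H_s-\hat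 B^H_r)\,dr\,ds$). *)

theory Defs
  imports "HOL-Probability.Probability"
begin

section \<open>Gaussian processes and fractional Brownian motion\<close>

text \<open>Constants count as (degenerate) Gaussian random variables; e.g. the value at time 0 of a
  fractional Brownian motion is of this kind.\<close>

definition gaussian_rv :: "'w measure \<Rightarrow> ('w \<Rightarrow> real) \<Rightarrow> bool" where
  "gaussian_rv M X \<longleftrightarrow> X \<in> borel_measurable M \<and>
     ((\<exists>\<mu> \<sigma>. \<sigma> > 0 \<and> distributed M lborel X (normal_density \<mu> \<sigma>)) \<or> (\<exists>c. AE \<omega> in M. X \<omega> = c))"

text \<open>Every finite linear combination of coordinates at finitely many times is Gaussian.
  For real-valued processes the inner product is multiplication.\<close>

definition gaussian_process ::
    "'w measure \<Rightarrow> 't set \<Rightarrow> ('t \<Rightarrow> 'w \<Rightarrow> 'a::euclidean_space) \<Rightarrow> bool" where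
  "gaussian_process M T X \<longleftrightarrow>
     (\<forall>F c. finite F \<and> F \<subseteq> T \<longrightarrow> gaussian_rv M (\<lambda>\<omega>. \<Sum>t\<in>F. c t \<bullet> X t \<omega>))"

definition centered_gaussian_process ::
    "'w measure \<Rightarrow> 't set \<Rightarrow> ('t \<Rightarrow> 'w \<Rightarrow> 'a::euclidean_space) \<Rightarrow> bool" where
  "centered_gaussian_process M T X \<longleftrightarrow>
     gaussian_process M T X \<and> (\<forall>t\<in>T. (\<integral>\<omega>. X t \<omega> \<partial>M) = 0)"

text \<open>A process, regarded as a single random element of the product space \<open>\<real>\<^sup>T\<close> (with its product
  Borel sigma-algebra). Independence of processes is independence of these random elements.\<close>

definition path_on :: "'t set \<Rightarrow> ('t \<Rightarrow> 'w \<Rightarrow> 'a) \<Rightarrow> 'w \<Rightarrow> ('t \<Rightarrow> 'a)" where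
  "path_on T X \<omega> = (\<lambda>t\<in>T. X t \<omega>)"

abbreviation path_space :: "real set \<Rightarrow> (real \<Rightarrow> 'a::topological_space) measure" where
  "path_space T \<equiv> PiM T (\<lambda>_. borel)"

definition fbm_1d :: "'w measure \<Rightarrow> real \<Rightarrow> (real \<Rightarrow> 'w \<Rightarrow> real) \<Rightarrow> bool" where
  "fbm_1d M H W \<longleftrightarrow>
     (AE \<omega> in M. continuous_on {0..} (\<lambda>t. W t \<omega>)) \<and>
     centered_gaussian_process M {0..} W \<and>
     (\<forall>s\<ge>0. \<forall>t\<ge>0. (\<integral>\<omega>. W t \<omega> * W s \<omega> \<partial>M) =
        1 / 2 * (t powr (2 * H) + s powr (2 * H) - \<bar>t - s\<bar> powr (2 * H)))"

definition fbm :: "'w measure \<Rightarrow> real \<Rightarrow> (real \<Rightarrow> 'w \<Rightarrow> real ^ 'd) \<Rightarrow> bool" where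
  "fbm M H B \<longleftrightarrow>
     (AE \<omega> in M. continuous_on {0..} (\<lambda>t. B t \<omega>)) \<and>
     centered_gaussian_process M {0..} B \<and>
     (\<forall>j. fbm_1d M H (\<lambda>t \<omega>. B t \<omega> $ j)) \<and>
     prob_space.indep_vars M (\<lambda>_. path_space {0..})
       (\<lambda>j. path_on {0..} (\<lambda>t \<omega>. B t \<omega> $ j)) UNIV"


section \<open>Derivatives of the approximate delta function\<close>

definition gauss_kernel :: "real \<Rightarrow> real ^ 'd \<Rightarrow> real" where
  "gauss_kernel \<epsilon> x =
     (2 * pi * \<epsilon>) powr (- real CARD('d) / 2) * exp (- (norm x)\<^sup>2 / (2 * \<epsilon>))"

definition partial_deriv :: "'d \<Rightarrow> (real ^ 'd \<Rightarrow> real) \<Rightarrow> real ^ 'd \<Rightarrow> real" where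
  "partial_deriv i f x = deriv (\<lambda>h. f (x + h *\<^sub>R axis i 1)) 0"

text \<open>The linear order on the finite index type plays the role of the enumeration of the
  coordinates \<open>1, \<dots>, d\<close>; the derivative in the last coordinate is applied first.\<close>

definition multi_deriv ::
    "nat ^ 'd::{finite,linorder} \<Rightarrow> (real ^ 'd::{finite,linorder} \<Rightarrow> real) \<Rightarrow> real ^ 'd::{finite,linorder} \<Rightarrow> real" where
  "multi_deriv k f = foldr (\<lambda>i. partial_deriv i ^^ (k $ i)) (sorted_list_of_set UNIV) f"

definition multi_order :: "nat ^ 'd \<Rightarrow> nat" where
  "multi_order k = (\<Sum>i\<in>UNIV. k $ i)"


section \<open>Derivatives of the intersection local time\<close>

definition approx_ilt_deriv ::
    "nat ^ 'd::{finite,linorder} \<Rightarrow> (real \<Rightarrow> 'w \<Rightarrow> real ^ 'd::{finite,linorder}) \<Rightarrow> (real \<Rightarrow> 'w \<Rightarrow> real ^ 'd::{finite,linorder}) \<Rightarrow>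
     real \<Rightarrow> 'w \<Rightarrow> real" where
  "approx_ilt_deriv k B B' \<epsilon> \<omega> =
     (LINT s:{0..1}|lborel. (LINT r:{0..1}|lborel.
        multi_deriv k (gauss_kernel \<epsilon>) (B s \<omega> - B' r \<omega>)))"

text \<open>The random variable \<open>\<alpha>\<close> is the limit in \<open>L\<^sup>n\<close>, for every \<open>n \<ge> 1\<close>, of the approximations
  as \<open>\<epsilon>\<close> decreases to \<open>0\<close>. As the paths are continuous only almost surely and the probability
  space need not be complete, the approximations are only almost surely equal to measurable
  functions; the nonnegative integral is insensitive to this, the Bochner integral is not.\<close>

definition is_ilt_deriv ::
    "'w measure \<Rightarrow> nat ^ 'd::{finite,linorder} \<Rightarrow> (real \<Rightarrow> 'w \<Rightarrow> real ^ 'd::{finite,linorder}) \<Rightarrow>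
     (real \<Rightarrow> 'w \<Rightarrow> real ^ 'd::{finite,linorder}) \<Rightarrow> ('w \<Rightarrow> real) \<Rightarrow> bool" where
  "is_ilt_deriv M k B B' \<alpha> \<longleftrightarrow> \<alpha> \<in> borel_measurable M \<and>
     (\<forall>n::nat. n \<ge> 1 \<longrightarrow>
        ((\<lambda>\<epsilon>. \<integral>\<^sup>+\<omega>. ennreal (\<bar>approx_ilt_deriv k B B' \<epsilon> \<omega> - \<alpha> \<omega>\<bar> ^ n) \<partial>M) \<longlongrightarrow> 0) (at_right 0))"

end

theory Submission
  imports Defs
begin

text \<open>
  For even \<open>N\<close> the \<open>N\<close>-th moment of the approximation is an integral over times \<open>s, r\<close> in the unit cube
  of an expectation of a product of derivatives of heat kernels. In Fourier variables, and up to
  \<open>\<epsilon>\<close>-independent constants, this expectation is at most the product over the coordinates \<open>i\<close> of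
  \<open>\<integral> (\<Prod>j. \<bar>p\<^sub>j\<bar> ^ k\<^sub>i) exp (- Q\<^sub>s(p)/2 - Q\<^sub>r(p)/2) dp\<close>, where \<open>Q\<^sub>s\<close> is the covariance form of the
  fractional Brownian motion at the times \<open>s\<close>. By the Cauchy-Schwarz inequality the variables \<open>s\<close> and \<open>r\<close>
  separate. Local nondeterminism bounds \<open>Q\<^sub>s(p)\<close> below by \<open>c p\<^sub>j\<^sup>2 \<rho>\<^sub>j powr (2 H)\<close>, with \<open>\<rho>\<^sub>j\<close> the
  distance from \<open>s\<^sub>j\<close> to \<open>0\<close> and the other times. It serves twice: a fraction \<open>1/(2 N)\<close> of \<open>Q\<^sub>s\<close> absorbs
  each monomial, and successive Schur complements bound the remaining Gaussian integral by the
  distances \<open>d\<^sub>j\<close> from \<open>s\<^sub>j\<close> to \<open>0\<close> and the preceding times only. After rescaling distances by \<open>N\<close>, the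
  \<open>\<rho>\<^sub>j\<close> can be traded for the \<open>d\<^sub>j\<close>, and the times can be integrated one after the other, each
  contributing a constant. This yields the moment bound \<open>(D N powr \<gamma>) ^ N\<close> with
  \<open>\<gamma> = \<bar>k\<bar>/2 + \<bar>k\<bar> H + d H\<close>, which is at most \<open>\<bar>k\<bar> + \<bar>k\<bar> H + d H\<close>, and the exponential series converges.
\<close>

section \<open>Local nondeterminism of fractional Brownian motion\<close>

text \<open>Even powers carry no absolute value and can be expanded by Fubini; the other exponents
  are recovered at the end by domination. The difficulty is to integrate over the times without
  sorting them. Bounds in the distances to all other times cannot be integrated one time after the
  other, since each time enters many factors; bounds in the distances to the preceding times can.
  Trading the former for the latter charges a new point twice: for itself and for the neighbour that
  it approaches. With \<open>b = H |k| / 2\<close> and \<open>a' = d H / 2\<close>, both halved by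
  Cauchy-Schwarz, each time thus meets singularities of exponent
  \<open>2 b + a' = H |k| + d H / 2\<close>, and \<open>2 |k| H + H d < 2\<close> says that this is
  less than \<open>1\<close>. After the rescaling, each of the at most \<open>N\<close>
  singularities has an integral of order \<open>1 / N\<close>, whence the constant per time. The
  power of \<open>N\<close> per time and per process is \<open>|k| / 4\<close> from absorbing the
  monomials plus \<open>b + a'\<close> from the rescaling; the two processes together give \<gamma>.
  In the exponential series this is weighed against \<open>n!\<close>, which requires
  \<open>\<beta> * \<gamma> < 1\<close>.\<close>

lemma integrable_powr_split:
  fixes q1 q2 :: real
  assumes "q1 > -1" "q2 < -1"
  shows "integrable lborel (\<lambda>u::real. if \<bar>u\<bar> \<le> 1 then \<bar>u\<bar> powr q1 else \<bar>u\<bar> powr q2)"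
proof -
  have 1: "set_integrable lborel {0..1} (\<lambda>u::real. u powr q1)"
  proof -
    have "(\<lambda>u. u powr q1) absolutely_integrable_on {0..1::real}"
      using integrable_on_powr_from_0[OF assms(1), of 1]
      by (intro nonnegative_absolutely_integrable_1) auto
    then show ?thesis
      unfolding set_integrable_def by (simp add: integrable_completion)
  qed
  have 2: "set_integrable lborel {1..} (\<lambda>u::real. u powr q2)"
  proof -
    have "(\<lambda>u. u powr q2) absolutely_integrable_on {1::real..}"
      using has_integral_powr_to_inf[OF assms(2), of 1]
      by (intro nonnegative_absolutely_integrable_1) auto
    then show ?thesis
      unfolding set_integrable_def by (simp add: integrable_completion)
  qed
  define f where "f = (\<lambda>u::real. indicator {0..1} u *\<^sub>R u powr q1 + indicator {1..} u *\<^sub>R u powr q2)"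
  have f: "integrable lborel f"
    using Bochner_Integration.integrable_add[OF 1[unfolded set_integrable_def] 2[unfolded set_integrable_def]]
    by (simp add: f_def)
  have f': "integrable lborel (\<lambda>u. f (- u))"
    using lborel_integrable_real_affine[OF f, of "-1" 0] by simp
  show ?thesis
    by (rule Bochner_Integration.integrable_bound[OF Bochner_Integration.integrable_add[OF f f']])
       (auto simp: f_def indicator_def)
qed

lemma one_minus_cos_le: "1 - cos x \<le> x\<^sup>2 / (2::real)"
proof -
  have "1 - cos x = 2 * (sin (x / 2))\<^sup>2"
    using cos_double_sin[of "x / 2"] by simp
  also have "\<dots> \<le> 2 * (x / 2)\<^sup>2"
    using abs_sin_x_le_abs_x[of "x / 2"] by (simp only: abs_le_square_iff mult_left_mono)
  finally show ?thesis by (simp add: power2_eq_square)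
qed

lemma one_minus_cos_bound:
  fixes p :: real
  shows "\<bar>(1 - cos u) * \<bar>u\<bar> powr (-1 - p)\<bar> \<le> 2 * (if \<bar>u\<bar> \<le> 1 then \<bar>u\<bar> powr (1 - p) else \<bar>u\<bar> powr (-1-p))"
proof (cases "\<bar>u\<bar> \<le> 1")
  case True
  have "\<bar>(1 - cos u) * \<bar>u\<bar> powr (-1 - p)\<bar> \<le> (2 * \<bar>u\<bar> powr 2) * \<bar>u\<bar> powr (-1 - p)"
    unfolding abs_mult by (intro mult_mono) (use one_minus_cos_le[of u] in \<open>auto intro: order_trans[of _ "u\<^sup>2 / 2"]\<close>)
  also have "\<dots> = 2 * \<bar>u\<bar> powr (1 - p)"
    by (cases "u = 0") (simp_all add: powr_add[symmetric] flip: powr_numeral)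
  finally show ?thesis using True by simp
next
  case False
  have "\<bar>1 - cos u\<bar> \<le> 2" by (smt (verit) cos_ge_minus_one cos_le_one)
  then show ?thesis using False by (auto simp: abs_mult intro!: mult_right_mono)
qed

text \<open>The normalising constant of the spectral representation of \<open>|x| powr p\<close>. It
  enters the bounds only through its positivity for \<open>0 < p < 2\<close>.\<close>

definition cosint :: "real \<Rightarrow> real" where
  "cosint p = (\<integral>u. (1 - cos u) * \<bar>u\<bar> powr (-1 - p) \<partial>lborel)"

context
  fixes p :: real
  assumes p: "0 < p" "p < 2"
begin

lemma integrable_one_minus_cos1:
  "integrable lborel (\<lambda>u::real. (1 - cos u) * \<bar>u\<bar> powr (-1 - p))"
proof -
  have "integrable lborel (\<lambda>u::real. 2 * (if \<bar>u\<bar> \<le> 1 then \<bar>u\<bar> powr (1 - p) else \<bar>u\<bar> powr (-1-p)))"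
    using p by (intro integrable_mult_right integrable_powr_split) auto
  then show ?thesis
    by (rule Bochner_Integration.integrable_bound) (use one_minus_cos_bound[of _ p] in \<open>auto simp del: if_split simp: abs_mult\<close>)
qed

text \<open>The substitution \<open>u -> x * u\<close> scales \<open>x\<close> out. Read backwards,
  \<open>|x| powr p\<close> becomes a mixture of the functions \<open>1 - cos (u * x)\<close>, which
  turns the covariance form into an integral of squares.\<close>

lemma integrable_one_minus_cos:
  "integrable lborel (\<lambda>u::real. (1 - cos (u * x)) * \<bar>u\<bar> powr (-1 - p))" (is ?A)
  and integral_one_minus_cos:
  "(\<integral>u. (1 - cos (u * x)) * \<bar>u\<bar> powr (-1 - p) \<partial>lborel) = cosint p * \<bar>x\<bar> powr p" (is ?B)
proof -
  have "?A \<and> ?B"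
  proof (cases "x = 0")
    case False
    have eq: "(1 - cos (u * x)) * \<bar>u\<bar> powr (-1 - p) =
       \<bar>x\<bar> powr (1 + p) * ((1 - cos (0 + x * u)) * \<bar>0 + x * u\<bar> powr (-1 - p))" for u
    proof -
      have "\<bar>x\<bar> powr (1 + p) * \<bar>x\<bar> powr (-1 - p) = 1"
        using False by (simp add: powr_add[symmetric])
      then show ?thesis by (simp add: abs_mult powr_mult mult.commute)
    qed
    have A: ?A
      unfolding eq
      by (intro integrable_mult_right lborel_integrable_real_affine integrable_one_minus_cos1 False)
    have "cosint p = \<bar>x\<bar> * (\<integral>u. (1 - cos (0 + x * u)) * \<bar>0 + x * u\<bar> powr (-1 - p) \<partial>lborel)"
      unfolding cosint_def by (subst lborel_integral_real_affine[OF False, of _ 0]) simp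
    moreover have "\<bar>x\<bar> powr (1 + p) = \<bar>x\<bar> * \<bar>x\<bar> powr p" using False by (simp add: powr_add)
    ultimately have ?B
      unfolding eq by simp
    with A show ?thesis by simp
  qed simp
  then show ?A ?B by auto
qed

text \<open>The integrand is nonnegative, and positive on \<open>{1<..<2}\<close>, because
  \<open>cos\<close> decreases strictly from \<open>0\<close> to \<open>pi\<close>.\<close>

lemma cosint_pos: "cosint p > 0"
proof -
  have "cosint p \<ge> 0" unfolding cosint_def by (intro Bochner_Integration.integral_nonneg) auto
  moreover have "cosint p \<noteq> 0"
  proof
    assume "cosint p = 0"
    then have "AE u in lborel. (1 - cos u) * \<bar>u\<bar> powr (-1 - p) = 0"
      unfolding cosint_def
      by (subst (asm) integral_nonneg_eq_0_iff_AE[OF integrable_one_minus_cos1]) auto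
    then have "AE u in lborel. u \<notin> {1<..<2::real}"
    proof (eventually_elim, safe)
      fix u :: real assume u: "u \<in> {1<..<2}" "(1 - cos u) * \<bar>u\<bar> powr (-1 - p) = 0"
      have "cos u < cos 0" using u pi_gt3 by (intro cos_monotone_0_pi) auto
      with u show False by auto
    qed
    then have "emeasure lborel {1<..<2::real} = 0"
      by (subst (asm) AE_iff_measurable[where N="{1<..<2}"]) auto
    then show False by simp
  qed
  ultimately show ?thesis by simp
qed

end


text \<open>The product formula for cosines produces a second difference of \<open>1 - cos\<close>.
  For \<open>r > 0\<close> the value is \<open>cosint 1 * max 0 (r - |a|)\<close>, the triangle
  function.\<close>

lemma
  fixes a r :: real
  shows integrable_cos_mult_one_minus_cos:
      "integrable lborel (\<lambda>u. cos (u * a) * ((1 - cos (u * r)) * \<bar>u\<bar> powr (-2)))" (is ?A)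
    and integral_cos_mult_one_minus_cos:
      "(\<integral>u. cos (u * a) * ((1 - cos (u * r)) * \<bar>u\<bar> powr (-2)) \<partial>lborel) =
         cosint 1 / 2 * (\<bar>a + r\<bar> + \<bar>a - r\<bar> - 2 * \<bar>a\<bar>)" (is ?B)
proof -
  have eq: "cos (u * a) * ((1 - cos (u * r)) * \<bar>u\<bar> powr (-2)) =
     1 / 2 * ((1 - cos (u * (a + r))) * \<bar>u\<bar> powr (-1 - 1) +
              (1 - cos (u * (a - r))) * \<bar>u\<bar> powr (-1 - 1) -
              2 * ((1 - cos (u * a)) * \<bar>u\<bar> powr (-1 - 1)))" for u
    by (simp add: algebra_simps cos_add cos_diff)
  note i = integrable_one_minus_cos[of 1, simplified]
  show ?A unfolding eq by (simp add: i)
  show ?B unfolding eq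
    by (simp add: i integral_one_minus_cos[of 1, simplified]) (simp add: algebra_simps)
qed

section \<open>Spectral representation of the covariance form\<close>

definition fbm_cov :: "real \<Rightarrow> real \<Rightarrow> real \<Rightarrow> real" where
  "fbm_cov H s t = 1 / 2 * (s powr (2 * H) + t powr (2 * H) - \<bar>s - t\<bar> powr (2 * H))"

context
  fixes H :: real
  assumes H: "0 < H" "H < 1"
begin

text \<open>The bracket is the real part of \<open>1 - exp (\<i> * u * s)\<close> times the
  conjugate of \<open>1 - exp (\<i> * u * t)\<close>. Expanding \<open>cos (u * (s - t))\<close>
  reduces it to three integrals of the basic type.\<close>

lemma
  assumes "s \<ge> 0" "t \<ge> 0"
  shows integrable_fbm_cov:
      "integrable lborel (\<lambda>u. ((1 - cos (u * s)) * (1 - cos (u * t)) + sin (u * s) * sin (u * t))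
         * \<bar>u\<bar> powr (-1 - 2 * H))" (is ?A)
    and integral_fbm_cov:
      "(\<integral>u. ((1 - cos (u * s)) * (1 - cos (u * t)) + sin (u * s) * sin (u * t))
         * \<bar>u\<bar> powr (-1 - 2 * H) \<partial>lborel) = 2 * cosint (2 * H) * fbm_cov H s t" (is ?B)
proof -
  have eq: "((1 - cos (u * s)) * (1 - cos (u * t)) + sin (u * s) * sin (u * t)) * \<bar>u\<bar> powr (-1 - 2 * H) =
      (1 - cos (u * s)) * \<bar>u\<bar> powr (-1 - 2 * H) + (1 - cos (u * t)) * \<bar>u\<bar> powr (-1 - 2 * H) -
      (1 - cos (u * (s - t))) * \<bar>u\<bar> powr (-1 - 2 * H)" for u
    by (simp add: algebra_simps cos_diff)
  have p: "0 < 2 * H" "2 * H < 2" using H by auto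
  note i = integrable_one_minus_cos[OF p]
  show ?A unfolding eq by (simp add: i)
  show ?B unfolding eq using assms
    by (simp add: i integral_one_minus_cos[OF p] fbm_cov_def) (simp add: algebra_simps)
qed

lemma fbm_cov_sym: "fbm_cov H s t = fbm_cov H t s"
  by (simp add: fbm_cov_def abs_minus_commute)

text \<open>The integrand is a weight times the squared modulus of the sum of
  \<open>p i * (1 - exp (\<i> * u * s i))\<close>. The covariance form is thus a weighted square
  norm, to which Cauchy-Schwarz applies.\<close>

lemma
  assumes s: "\<And>i. i \<in> I \<Longrightarrow> s i \<ge> 0"
  shows integrable_fbm_form:
      "integrable lborel (\<lambda>u. ((\<Sum>i\<in>I. p i * (1 - cos (u * s i)))\<^sup>2 + (\<Sum>i\<in>I. p i * sin (u * s i))\<^sup>2)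
         * \<bar>u\<bar> powr (-1 - 2 * H))" (is ?A)
    and integral_fbm_form:
      "(\<integral>u. ((\<Sum>i\<in>I. p i * (1 - cos (u * s i)))\<^sup>2 + (\<Sum>i\<in>I. p i * sin (u * s i))\<^sup>2)
         * \<bar>u\<bar> powr (-1 - 2 * H) \<partial>lborel) =
       2 * cosint (2 * H) * (\<Sum>i\<in>I. \<Sum>l\<in>I. p i * p l * fbm_cov H (s i) (s l))" (is ?B)
proof -
  have eq: "((\<Sum>i\<in>I. p i * (1 - cos (u * s i)))\<^sup>2 + (\<Sum>i\<in>I. p i * sin (u * s i))\<^sup>2)
         * \<bar>u\<bar> powr (-1 - 2 * H) =
     (\<Sum>i\<in>I. \<Sum>l\<in>I. p i * p l * (((1 - cos (u * s i)) * (1 - cos (u * s l)) + sin (u * s i) * sin (u * s l))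
         * \<bar>u\<bar> powr (-1 - 2 * H)))" for u
    unfolding power2_eq_square sum_product unfolding sum.distrib[symmetric] sum_distrib_right
    by (intro sum.cong refl) (simp add: algebra_simps)
  show ?A unfolding eq
    by (intro Bochner_Integration.integrable_sum integrable_mult_right integrable_fbm_cov s)
  show ?B unfolding eq using s
    by (simp add: integrable_fbm_cov integral_fbm_cov sum_distrib_left) (simp add: mult_ac)
qed

text \<open>The triangle function of width \<open>r\<close> around \<open>s j\<close> vanishes at \<open>0\<close> and at all other points.
  Testing the spectral representation of the covariance form against its Fourier transform
  \<open>(1 - cos (u r)) / u\<^sup>2\<close> isolates \<open>p j\<close>, and the Cauchy-Schwarz inequality gives the bound.\<close>

lemma fbm_cov_local_nondeterminism:
  assumes I: "finite I" "j \<in> I" and s: "\<And>i. i \<in> I \<Longrightarrow> s i \<ge> 0"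
    and r: "r > 0" "r \<le> s j" "\<And>i. i \<in> I \<Longrightarrow> i \<noteq> j \<Longrightarrow> r \<le> \<bar>s i - s j\<bar>"
  shows "(cosint 1)\<^sup>2 / (4 * cosint (2 - 2 * H) * cosint (2 * H)) * (p j)\<^sup>2 * r powr (2 * H)
           \<le> (\<Sum>i\<in>I. \<Sum>l\<in>I. p i * p l * fbm_cov H (s i) (s l))"
proof -
  define A where "A u = (\<Sum>i\<in>I. p i * (1 - cos (u * s i)))" for u
  define S where "S u = (\<Sum>i\<in>I. p i * sin (u * s i))" for u
  define w where "w u = \<bar>u\<bar> powr (-1 - 2 * H)" for u :: real
  define g where "g u = (1 - cos (u * r)) * \<bar>u\<bar> powr (-2)" for u :: real
  \<comment> \<open>The real part of \<open>exp (- \<i> * u * s j)\<close> times the sum of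
    \<open>p i * (exp (\<i> * u * s i) - 1)\<close>. The phase moves the centre of the triangle
    function to \<open>s j\<close>.\<close>
  define f where "f u = (\<Sum>i\<in>I. p i * (cos (u * (s i - s j)) - cos (u * s j)))" for u
  define Q where "Q = (\<Sum>i\<in>I. \<Sum>l\<in>I. p i * p l * fbm_cov H (s i) (s l))"
  define V where "V = (\<integral>u. ((A u)\<^sup>2 + (S u)\<^sup>2) * w u \<partial>lborel)"
  define X where "X = p j * cosint 1 * r"
  define G where "G = 2 * (cosint (2 - 2 * H) * r powr (2 - 2 * H))"
  have V: "V = 2 * cosint (2 * H) * Q" 
    unfolding V_def A_def S_def w_def Q_def by (rule integral_fbm_form[OF s])
  have Vi: "integrable lborel (\<lambda>u. ((A u)\<^sup>2 + (S u)\<^sup>2) * w u)"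
    unfolding A_def S_def w_def by (rule integrable_fbm_form[OF s])
  have V0: "V \<ge> 0"
    unfolding V_def by (intro Bochner_Integration.integral_nonneg) (auto simp: w_def)
  have pos: "cosint 1 > 0" "cosint (2 - 2 * H) > 0" "cosint (2 * H) > 0"
    using H by (auto intro!: cosint_pos)
  have G0: "G > 0" using pos r by (simp add: G_def)
  have fg_eq: "f u * g u = (\<Sum>i\<in>I. p i * (cos (u * (s i - s j)) * g u - cos (u * s j) * g u))" for u
    unfolding f_def sum_distrib_right by (intro sum.cong refl) (simp add: algebra_simps)
  have fgi: "integrable lborel (\<lambda>u. f u * g u)"
    unfolding fg_eq unfolding g_def
    by (intro Bochner_Integration.integrable_sum integrable_mult_right Bochner_Integration.integrable_diff
        integrable_cos_mult_one_minus_cos)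
  have "(\<integral>u. f u * g u \<partial>lborel) = (\<Sum>i\<in>I. p i * ((\<integral>u. cos (u * (s i - s j)) * g u \<partial>lborel)
      - (\<integral>u. cos (u * s j) * g u \<partial>lborel)))"
    unfolding fg_eq unfolding g_def using integrable_cos_mult_one_minus_cos
    by (subst Bochner_Integration.integral_sum) auto
  also have "\<dots> = (\<Sum>i\<in>I. if i = j then X else 0)"
  proof (intro sum.cong refl)
    fix i assume i: "i \<in> I"
    have "(\<integral>u. cos (u * s j) * g u \<partial>lborel) = 0"
      unfolding g_def integral_cos_mult_one_minus_cos using r by auto
    moreover have "(\<integral>u. cos (u * (s i - s j)) * g u \<partial>lborel) = (if i = j then cosint 1 * r else 0)"
      unfolding g_def integral_cos_mult_one_minus_cos using r(1) r(3)[OF i] by (auto simp: abs_if)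
    ultimately show "p i * ((\<integral>u. cos (u * (s i - s j)) * g u \<partial>lborel)
      - (\<integral>u. cos (u * s j) * g u \<partial>lborel)) = (if i = j then X else 0)"
      by (simp add: X_def)
  qed
  also have "\<dots> = X" using I by simp
  finally have fg: "(\<integral>u. f u * g u \<partial>lborel) = X" .
  have f2: "(f u)\<^sup>2 \<le> (A u)\<^sup>2 + (S u)\<^sup>2" for u
  proof -
    have f: "f u = S u * sin (u * s j) - A u * cos (u * s j)"
      unfolding f_def A_def S_def sum_distrib_right sum_subtractf[symmetric]
      by (intro sum.cong refl) (simp add: algebra_simps cos_diff)
    \<comment> \<open>The second square is that of the imaginary part; multiplication by a phase
      preserves the modulus.\<close>
    have "(f u)\<^sup>2 + (S u * cos (u * s j) + A u * sin (u * s j))\<^sup>2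
        = ((A u)\<^sup>2 + (S u)\<^sup>2) * ((sin (u * s j))\<^sup>2 + (cos (u * s j))\<^sup>2)"
      unfolding f by algebra
    also have "\<dots> = (A u)\<^sup>2 + (S u)\<^sup>2" by simp
    finally show ?thesis
      using zero_le_power2[of "S u * cos (u * s j) + A u * sin (u * s j)"] by linarith
  qed
  have p2: "0 < 2 - 2 * H" "2 - 2 * H < 2" using H by auto
  \<comment> \<open>Cauchy-Schwarz requires \<open>g^2 / w\<close> to be integrable. By
    \<open>(1 - cos)^2 <= 2 * (1 - cos)\<close> it is at most twice the integrand that belongs to
    \<open>cosint (2 - 2 * H)\<close>.\<close>
  define h where "h u = 2 * ((1 - cos (u * r)) * \<bar>u\<bar> powr (-1 - (2 - 2 * H)))" for u
  have hi: "integrable lborel h" and h: "(\<integral>u. h u \<partial>lborel) = G"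
    unfolding h_def G_def using integrable_one_minus_cos[OF p2, of r] integral_one_minus_cos[OF p2, of r] r
    by auto
  have g2: "(g u)\<^sup>2 \<le> h u * w u" for u
  proof -
    have "(1 - cos (u * r))\<^sup>2 \<le> 2 * (1 - cos (u * r))"
      unfolding power2_eq_square by (intro mult_right_mono) (use cos_ge_minus_one[of "u*r"] in auto)
    then have "(1 - cos (u * r))\<^sup>2 * \<bar>u\<bar> powr (-4) \<le> (2 * (1 - cos (u * r))) * \<bar>u\<bar> powr (-4)"
      by (intro mult_right_mono) auto
    then show ?thesis unfolding g_def h_def w_def
      by (simp add: power_mult_distrib power2_eq_square powr_add[symmetric] algebra_simps)
  qed
  have bound: "X\<^sup>2 \<le> G * V"
  proof (cases "X = 0")
    case False
    define c where "c = G / \<bar>X\<bar>" \<comment> \<open>optimal weight in the pointwise AM-GM bound\<close>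
    have l: "c > 0" using False G0 by (simp add: c_def)
    have pt: "\<bar>f u * g u\<bar> \<le> c / 2 * (((A u)\<^sup>2 + (S u)\<^sup>2) * w u) + 1 / (2 * c) * h u" for u
    proof (cases "u = 0")
      case False
      then have w: "w u > 0" by (simp add: w_def)
      have "2 * (c * w u * \<bar>f u\<bar>) * \<bar>g u\<bar> \<le> (c * w u * \<bar>f u\<bar>)\<^sup>2 + \<bar>g u\<bar>\<^sup>2"
        by (rule sum_squares_bound)
      also have "\<dots> \<le> (c * w u)\<^sup>2 * ((A u)\<^sup>2 + (S u)\<^sup>2) + h u * w u"
        unfolding power_mult_distrib using f2[of u] g2[of u] by (intro add_mono mult_left_mono) auto
      finally have "(2 * c * \<bar>f u\<bar> * \<bar>g u\<bar>) * w u \<le> (c\<^sup>2 * (((A u)\<^sup>2 + (S u)\<^sup>2) * w u) + h u) * w u"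
        by (simp add: power_mult_distrib power2_eq_square algebra_simps)
      then have "2 * c * \<bar>f u\<bar> * \<bar>g u\<bar> \<le> c\<^sup>2 * (((A u)\<^sup>2 + (S u)\<^sup>2) * w u) + h u"
        using w by simp
      then show ?thesis using l by (simp add: abs_mult power2_eq_square field_simps)
    qed (simp add: g_def h_def w_def)
    have "\<bar>X\<bar> \<le> (\<integral>u. \<bar>f u * g u\<bar> \<partial>lborel)"
      unfolding fg[symmetric] by (rule integral_abs_bound)
    also have "\<dots> \<le> (\<integral>u. c / 2 * (((A u)\<^sup>2 + (S u)\<^sup>2) * w u) + 1 / (2 * c) * h u \<partial>lborel)"
      using fgi Vi hi pt by (intro integral_mono) auto
    also have "\<dots> = c / 2 * V + 1 / (2 * c) * G"
      using Vi hi by (simp add: V_def h)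
    finally have "\<bar>X\<bar> \<le> G * V / (2 * \<bar>X\<bar>) + \<bar>X\<bar> / 2"
      using False G0 by (simp add: c_def field_simps)
    then have "\<bar>X\<bar> * \<bar>X\<bar> \<le> G * V" using False by (simp add: field_simps)
    then show ?thesis by (simp add: power2_eq_square)
  qed (use V0 G0 in auto)
  have "r\<^sup>2 = r powr (2 - 2 * H) * r powr (2 * H)"
    using r by (simp add: powr_add[symmetric])
  then have "r powr (2 - 2 * H) * ((p j)\<^sup>2 * (cosint 1)\<^sup>2 * r powr (2 * H)) \<le> 
     r powr (2 - 2 * H) * (4 * cosint (2 - 2 * H) * cosint (2 * H) * Q)"
    using bound by (simp add: X_def G_def V power_mult_distrib mult_ac)
  then have "(p j)\<^sup>2 * (cosint 1)\<^sup>2 * r powr (2 * H) \<le> 4 * cosint (2 - 2 * H) * cosint (2 * H) * Q"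
    using r by (subst (asm) mult_le_cancel_left_pos) auto
  then show ?thesis unfolding Q_def[symmetric] using pos
    by (simp add: field_simps)
qed

end

section \<open>Gaussian integrals of quadratic forms\<close>

lemma nn_integral_gaussian:
  assumes "k > 0"
  shows "(\<integral>\<^sup>+y. ennreal (exp (- (k * (y + b)\<^sup>2) / 2)) \<partial>lborel) = ennreal (sqrt (2 * pi / k))"
proof -
  have eq: "exp (- (k * (y + b)\<^sup>2) / 2) = sqrt (2 * pi / k) * normal_density (- b) (1 / sqrt k) y" for y
    using assms by (simp add: normal_density_def power_divide real_sqrt_divide field_simps)
  have "(\<integral>\<^sup>+y. ennreal (normal_density (- b) (1 / sqrt k) y) \<partial>lborel) = 1"
    using assms by (subst nn_integral_eq_integral) (auto intro: integrable_normal_density integral_normal_density)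
  then show ?thesis
    unfolding eq using assms
    by (subst ennreal_mult) (auto simp: nn_integral_cmult)
qed

text \<open>The lower bound on the form concerns vectors supported on initial segments. It passes to the
  Schur complement of the first variable, because that complement is the minimum of the form over
  the first variable.\<close>

lemma nn_integral_gaussian_form_le:
  fixes K :: "nat \<Rightarrow> nat \<Rightarrow> real"
  assumes "m \<le> n" and "\<And>i l. K i l = K l i"
    and "\<And>j. j \<in> {m..<n} \<Longrightarrow> \<tau> j > 0"
    and "\<And>j p. j \<in> {m..<n} \<Longrightarrow> (\<And>l. j < l \<Longrightarrow> p l = 0) \<Longrightarrow>
           \<tau> j * (p j)\<^sup>2 \<le> (\<Sum>i\<in>{m..<n}. \<Sum>l\<in>{m..<n}. p i * p l * K i l)"
  shows "(\<integral>\<^sup>+p. ennreal (exp (- (\<Sum>i\<in>{m..<n}. \<Sum>l\<in>{m..<n}. p i * p l * K i l) / 2)) \<partial>PiM {m..<n} (\<lambda>_. lborel))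
         \<le> (\<Prod>j\<in>{m..<n}. ennreal (sqrt (2 * pi / \<tau> j)))"
  using assms
proof (induction arbitrary: K rule: inc_induct)
  case base
  then show ?case by (simp add: PiM_empty)
next
  case (step m)
  interpret product_sigma_finite "\<lambda>_::nat. lborel :: real measure" by standard
  define J where "J = {Suc m..<n}"
  have I: "{m..<n} = insert m J" and J: "finite J" "m \<notin> J"
    using step.hyps by (auto simp: J_def)
  define k where "k = K m m"
  \<comment> \<open>The first unit vector is supported on an initial segment, so the hypothesis
    bounds the pivot \<open>K m m\<close> below by \<open>\<tau> m\<close>.\<close>
  define e where "e i = (if i = m then 1 else 0 :: real)" for i
  have e: "e i * e l * K i l = (if l = m then if i = m then k else 0 else 0)" for i l
    by (simp add: e_def k_def)
  have "\<tau> m * (e m)\<^sup>2 \<le> (\<Sum>i\<in>{m..<n}. \<Sum>l\<in>{m..<n}. e i * e l * K i l)"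
    using step.hyps by (intro step.prems(3)) (auto simp: e_def)
  also have "\<dots> = k" unfolding e I using J by simp
  finally have k: "\<tau> m \<le> k" by (simp add: e_def)
  moreover have tm: "\<tau> m > 0" using step.hyps by (intro step.prems) auto
  ultimately have k0: "k > 0" by simp
  define L where "L p = (\<Sum>l\<in>J. p l * K m l)" for p :: "nat \<Rightarrow> real"
  define K' where "K' i l = K i l - K m i * K m l / k" for i l
  define Q' where "Q' p = (\<Sum>i\<in>J. \<Sum>l\<in>J. p i * p l * K' i l)" for p :: "nat \<Rightarrow> real"
  have Q: "(\<Sum>i\<in>{m..<n}. \<Sum>l\<in>{m..<n}. (p(m := y)) i * (p(m := y)) l * K i l) = k * (y + L p / k)\<^sup>2 + Q' p"
    (is "?l = _") for p y
  proof -
    have upd: "(p(m := y)) l = p l" if "l \<in> J" for l using that J by auto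
    have "?l = (\<Sum>i\<in>insert m J. \<Sum>l\<in>insert m J. (p(m := y)) i * (p(m := y)) l * K i l)"
      by (simp only: I)
    also have "\<dots> = k * y\<^sup>2 + (\<Sum>l\<in>J. y * p l * K m l) + ((\<Sum>i\<in>J. p i * y * K i m) + (\<Sum>i\<in>J. \<Sum>l\<in>J. p i * p l * K i l))"
      using J by (simp add: upd sum.distrib k_def power2_eq_square del: fun_upd_apply cong: sum.cong) (simp add: upd)
    also have "\<dots> = k * y\<^sup>2 + 2 * y * L p + (\<Sum>i\<in>J. \<Sum>l\<in>J. p i * p l * K i l)"
    proof -
      have "(\<Sum>l\<in>J. y * p l * K m l) = y * L p" "(\<Sum>i\<in>J. p i * y * K i m) = y * L p"
        unfolding L_def sum_distrib_left using step.prems(1)[of _ m] by (auto intro!: sum.cong)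
      then show ?thesis by simp
    qed
    also have "(\<Sum>i\<in>J. \<Sum>l\<in>J. p i * p l * K i l) = Q' p + (L p)\<^sup>2 / k"
      unfolding Q'_def L_def power2_eq_square sum_product sum_divide_distrib sum.distrib[symmetric] K'_def
      by (intro sum.cong refl) (simp add: algebra_simps)
    also have "k * y\<^sup>2 + 2 * y * L p + (Q' p + (L p)\<^sup>2 / k) = k * (y + L p / k)\<^sup>2 + Q' p"
      using k0 by (simp add: power2_eq_square field_simps)
    finally show ?thesis .
  qed
  have IH: "(\<integral>\<^sup>+p. ennreal (exp (- Q' p / 2)) \<partial>PiM J (\<lambda>_. lborel)) \<le> (\<Prod>j\<in>J. ennreal (sqrt (2 * pi / \<tau> j)))"
    unfolding Q'_def J_def
  proof (rule step.IH)
    fix j and p :: "nat \<Rightarrow> real" assume j: "j \<in> {Suc m..<n}" and p: "\<And>l. j < l \<Longrightarrow> p l = 0"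
    \<comment> \<open>\<open>- L p / k\<close> is the minimiser in the first variable: the square in
      \<open>Q\<close> vanishes and \<open>Q' p\<close> is left. As \<open>m < j\<close>, neither
      the value at \<open>j\<close> nor the zeros beyond \<open>j\<close> change.\<close>
    have "\<tau> j * ((p(m := - L p / k)) j)\<^sup>2 \<le>
     (\<Sum>i\<in>{m..<n}. \<Sum>l\<in>{m..<n}. (p(m := - L p / k)) i * (p(m := - L p / k)) l * K i l)"
      using j p by (intro step.prems(3)) auto
    then show "\<tau> j * (p j)\<^sup>2 \<le> (\<Sum>i\<in>{Suc m..<n}. \<Sum>l\<in>{Suc m..<n}. p i * p l * K' i l)"
      unfolding Q using j k0 by (simp add: Q'_def J_def)
  qed (use step.prems(1,2) in \<open>auto simp: K'_def mult.commute\<close>)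
  have meas: "(\<lambda>p. ennreal (exp (- (\<Sum>i\<in>{m..<n}. \<Sum>l\<in>{m..<n}. p i * p l * K i l) / 2)))
     \<in> borel_measurable (PiM (insert m J) (\<lambda>_. lborel))"
    unfolding I by measurable
  have "(\<integral>\<^sup>+p. ennreal (exp (- (\<Sum>i\<in>{m..<n}. \<Sum>l\<in>{m..<n}. p i * p l * K i l) / 2)) \<partial>PiM {m..<n} (\<lambda>_. lborel))
     = (\<integral>\<^sup>+p. \<integral>\<^sup>+y. ennreal (exp (- (k * (y + L p / k)\<^sup>2 + Q' p) / 2)) \<partial>lborel \<partial>PiM J (\<lambda>_. lborel))"
    unfolding I by (subst product_nn_integral_insert[OF J]) (use meas in \<open>simp_all add: I[symmetric] Q del: fun_upd_apply\<close>)
  also have "\<dots> = (\<integral>\<^sup>+p. ennreal (sqrt (2 * pi / k)) * ennreal (exp (- Q' p / 2)) \<partial>PiM J (\<lambda>_. lborel))"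
  proof (rule nn_integral_cong)
    fix p
    have "(\<integral>\<^sup>+y. ennreal (exp (- (k * (y + L p / k)\<^sup>2 + Q' p) / 2)) \<partial>lborel) =
       (\<integral>\<^sup>+y. ennreal (exp (- (k * (y + L p / k)\<^sup>2) / 2)) * ennreal (exp (- Q' p / 2)) \<partial>lborel)"
      by (simp add: ennreal_mult[symmetric] exp_add[symmetric] field_simps)
    then show "(\<integral>\<^sup>+y. ennreal (exp (- (k * (y + L p / k)\<^sup>2 + Q' p) / 2)) \<partial>lborel) =
       ennreal (sqrt (2 * pi / k)) * ennreal (exp (- Q' p / 2))"
      using nn_integral_gaussian[OF k0, of "L p / k"] by (simp add: nn_integral_multc)
  qed
  also have "\<dots> = ennreal (sqrt (2 * pi / k)) * (\<integral>\<^sup>+p. ennreal (exp (- Q' p / 2)) \<partial>PiM J (\<lambda>_. lborel))"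
    unfolding Q'_def by (intro nn_integral_cmult) measurable
  also have "\<dots> \<le> ennreal (sqrt (2 * pi / \<tau> m)) * (\<Prod>j\<in>J. ennreal (sqrt (2 * pi / \<tau> j)))"
    using k tm by (intro mult_mono IH ennreal_leI) (auto intro!: divide_left_mono)
  finally show ?case unfolding I using J by simp
qed

section \<open>Products of nearest-neighbour distances\<close>

text \<open>The time \<open>0\<close> counts as a further point, because the process vanishes there.\<close>

definition pdist :: "(nat \<Rightarrow> real) \<Rightarrow> nat set \<Rightarrow> nat \<Rightarrow> real" where
  "pdist s I j = Min (insert \<bar>s j\<bar> ((\<lambda>l. \<bar>s l - s j\<bar>) ` (I - {j})))"

context
  fixes I :: "nat set"
  assumes I: "finite I"
begin

lemma pdist_le_abs: "pdist s I j \<le> \<bar>s j\<bar>"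
  unfolding pdist_def using I by (intro Min_le) auto

lemma pdist_le_abs_diff: "l \<in> I \<Longrightarrow> l \<noteq> j \<Longrightarrow> pdist s I j \<le> \<bar>s l - s j\<bar>"
  unfolding pdist_def using I by (intro Min_le) auto

lemma pdist_cases:
  obtains "pdist s I j = \<bar>s j\<bar>" | l where "l \<in> I" "l \<noteq> j" "pdist s I j = \<bar>s l - s j\<bar>"
proof -
  have "pdist s I j \<in> insert \<bar>s j\<bar> ((\<lambda>l. \<bar>s l - s j\<bar>) ` (I - {j}))"
    unfolding pdist_def using I by (intro Min_in) auto
  then show ?thesis using that by auto
qed

lemma pdist_insert:
  assumes "i \<noteq> j"
  shows "pdist s (insert i I) j = min (pdist s I j) \<bar>s i - s j\<bar>"
proof -
  have "insert \<bar>s j\<bar> ((\<lambda>l. \<bar>s l - s j\<bar>) ` (insert i I - {j})) =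
      insert \<bar>s i - s j\<bar> (insert \<bar>s j\<bar> ((\<lambda>l. \<bar>s l - s j\<bar>) ` (I - {j})))"
    using assms by auto
  then show ?thesis
    unfolding pdist_def using I by (simp only: Min_insert finite_insert finite_imageI finite_Diff) 
      (simp add: min.commute)
qed

lemma pdist_pos:
  assumes "inj_on s (insert j I)" "s j \<noteq> 0"
  shows "pdist s I j > 0"
  using assms by (cases rule: pdist_cases[of s j]) (auto simp: inj_on_def)

end

lemma pdist_insert_same: "pdist s (insert j I) j = pdist s I j"
  by (simp add: pdist_def)

lemma prod_le_power_card:
  fixes f :: "'a \<Rightarrow> real"
  assumes "finite A" "card {x \<in> A. f x \<noteq> 1} \<le> n" "\<And>x. x \<in> A \<Longrightarrow> 0 \<le> f x \<and> f x \<le> c" "c \<ge> 1"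
  shows "(\<Prod>x\<in>A. f x) \<le> c ^ n"
proof -
  have "(\<Prod>x\<in>A. f x) = (\<Prod>x\<in>{x \<in> A. f x \<noteq> 1}. f x)"
    using assms(1) by (intro prod.mono_neutral_right) auto
  also have "\<dots> \<le> (\<Prod>x\<in>{x \<in> A. f x \<noteq> 1}. c)"
    using assms by (intro prod_mono) auto
  also have "\<dots> = c ^ card {x \<in> A. f x \<noteq> 1}" by simp
  also have "\<dots> \<le> c ^ n" using assms by (intro power_increasing) auto
  finally show ?thesis .
qed

text \<open>Inserting a point changes the nearest-neighbour distance of at most one point on each side of it,
  and of these two, all but the one nearest to the new point lose at most a factor \<open>2\<close>.\<close>

lemma prod_pdist_le:
  fixes y :: "real \<Rightarrow> real"
  assumes y1: "\<And>x. x > 0 \<Longrightarrow> y x \<ge> 1"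
    and anti: "\<And>x x'. 0 < x \<Longrightarrow> x \<le> x' \<Longrightarrow> y x' \<le> y x"
    and doubling: "\<And>x. x > 0 \<Longrightarrow> y (x / 2) \<le> \<kappa> * y x" and \<kappa>: "\<kappa> \<ge> 1"
    and inj: "inj_on s {..<N}" and pos: "\<And>j. j < N \<Longrightarrow> s j > 0"
  shows "(\<Prod>j<N. y (pdist s {..<N} j)) \<le> (\<Prod>m<N. \<kappa>\<^sup>2 * (y (pdist s {..<m} m))\<^sup>2)"
  using inj pos
proof (induction N)
  case (Suc N)
  define x where "x j = \<bar>s N - s j\<bar>" for j
  define \<rho> where "\<rho> j = pdist s {..<N} j" for j
  define D where "D = pdist s {..<N} N"
  have inj: "inj_on s {..<N}" using Suc.prems(1) by (auto simp: inj_on_def)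
  have sN: "s N > 0" using Suc.prems by auto
  have ins: "insert j {..<N} = {..<N}" if "j < N" for j using that by auto
  have \<rho>: "\<rho> j > 0" if "j < N" for j
    unfolding \<rho>_def using Suc.prems(2)[of j] that inj by (intro pdist_pos) (auto simp: ins)
  have D: "D > 0"
    unfolding D_def using Suc.prems(1) sN by (intro pdist_pos) (auto simp: lessThan_Suc)
  have x: "x j > 0" if "j < N" for j
    using inj_onD[OF Suc.prems(1), of N j] that by (auto simp: x_def)
  have new: "pdist s {..<Suc N} j = min (\<rho> j) (x j)" if "j < N" for j
    unfolding lessThan_Suc \<rho>_def x_def using that by (subst pdist_insert) auto
  \<comment> \<open>The points whose nearest-neighbour distance shrinks, so that \<open>s N\<close>
    is closer to them than any other old point. Of two such points on the same side of
    \<open>s N\<close>, the farther one would be closer to the other one than to \<open>s N\<close>;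
    hence at most one lies on each side.\<close>
  define C where "C = {j \<in> {..<N}. x j < \<rho> j}"
  have Cdiff: "x j < \<bar>s l - s j\<bar>" if "j \<in> C" "l < N" "l \<noteq> j" for j l
    using pdist_le_abs_diff[of "{..<N}" l j s] that by (auto simp: C_def \<rho>_def)
  have "C \<subseteq> {j \<in> C. s j < s N} \<union> {j \<in> C. s N < s j}"
    using x by (force simp: C_def x_def)
  moreover have "card {j \<in> C. s j < s N} \<le> 1"
  proof (intro card_le_Suc0_iff_eq[THEN iffD2, unfolded One_nat_def[symmetric]] ballI)
    fix i j assume ij: "i \<in> {j \<in> C. s j < s N}" "j \<in> {j \<in> C. s j < s N}"
    show "i = j"
    proof (rule ccontr)
      assume "i \<noteq> j"
      then show False using Cdiff[of i j] Cdiff[of j i] ij by (auto simp: x_def C_def)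
    qed
  qed (auto simp: C_def)
  moreover have "card {j \<in> C. s N < s j} \<le> 1"
  proof (intro card_le_Suc0_iff_eq[THEN iffD2, unfolded One_nat_def[symmetric]] ballI)
    fix i j assume ij: "i \<in> {j \<in> C. s N < s j}" "j \<in> {j \<in> C. s N < s j}"
    show "i = j"
    proof (rule ccontr)
      assume "i \<noteq> j"
      then show False using Cdiff[of i j] Cdiff[of j i] ij by (auto simp: x_def C_def)
    qed
  qed (auto simp: C_def)
  moreover have "finite C" by (simp add: C_def)
  ultimately have cardC: "card C \<le> 2"
    using card_mono[of "{j \<in> C. s j < s N} \<union> {j \<in> C. s N < s j}" C]
      card_Un_le[of "{j \<in> C. s j < s N}" "{j \<in> C. s N < s j}"] by auto
  \<comment> \<open>The index of the nearest neighbour of \<open>s N\<close>. If that neighbour is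
    the time \<open>0\<close>, the dummy value \<open>N\<close> is taken and no old index is
    exceptional.\<close>
  obtain j0 where j0: "j0 < N \<Longrightarrow> D = x j0" "\<And>j. j < N \<Longrightarrow> j \<noteq> j0 \<Longrightarrow> \<rho> j \<le> x j + D"
  proof (cases rule: pdist_cases[OF finite_lessThan, of s N N])
    case 1
    have "\<rho> j \<le> x j + D" if "j < N" for j
      using pdist_le_abs[of "{..<N}" s j] 1 Suc.prems(2)[of j] that sN by (auto simp: \<rho>_def x_def D_def)
    then show ?thesis by (intro that[of N]) auto
  next
    case (2 l)
    have "\<rho> j \<le> x j + D" if "j < N" "j \<noteq> l" for j
      using pdist_le_abs_diff[of "{..<N}" l j s] 2 that by (auto simp: \<rho>_def x_def D_def)
    with 2 show ?thesis by (intro that[of l]) (auto simp: D_def x_def abs_minus_commute)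
  qed
  have Dx: "D \<le> x j" if "j < N" for j
    using pdist_le_abs_diff[of "{..<N}" j N s] that by (auto simp: D_def x_def abs_minus_commute)
  \<comment> \<open>The charges: \<open>j0\<close> may drop to distance \<open>D\<close> and pays
    \<open>y D\<close>; any other point of \<open>C\<close> pays only \<kappa>, since
    \<open>\<rho> j <= x j + D <= 2 * x j\<close>.\<close>
  define f1 where "f1 j = (if j = j0 then y D else 1)" for j
  define f2 where "f2 j = (if j \<in> C then \<kappa> else 1)" for j
  have yD: "y D \<ge> 1" using y1[OF D] .
  have le: "y (min (\<rho> j) (x j)) \<le> f1 j * f2 j * y (\<rho> j)" if j: "j < N" for j
  proof (cases "j \<in> C")
    case False
    then have "min (\<rho> j) (x j) = \<rho> j" using j by (auto simp: C_def)
    moreover have "1 * y (\<rho> j) \<le> f1 j * y (\<rho> j)"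
      using yD y1[OF \<rho>[OF j]] by (intro mult_right_mono) (auto simp: f1_def)
    ultimately show ?thesis using False by (simp add: f2_def)
  next
    case True
    then have m: "min (\<rho> j) (x j) = x j" by (auto simp: C_def)
    show ?thesis
    proof (cases "j = j0")
      case eq: True
      have "y D * (1 * 1) \<le> y D * (\<kappa> * y (\<rho> j))"
        using yD y1[OF \<rho>[OF j]] \<kappa> by (intro mult_left_mono mult_mono) auto
      then show ?thesis using eq j0(1) j True m by (simp add: f1_def f2_def mult.assoc)
    next
      case False
      have "y (x j) \<le> y (\<rho> j / 2)"
        using j0(2)[OF j False] Dx[OF j] \<rho>[OF j] by (intro anti) auto
      also have "\<dots> \<le> \<kappa> * y (\<rho> j)" using doubling \<rho>[OF j] by auto
      finally show ?thesis using False True m by (simp add: f1_def f2_def)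
    qed
  qed
  have "(\<Prod>j<N. f1 j) \<le> y D"
  proof -
    have "(\<Prod>j<N. f1 j) = (if j0 < N then y D else 1)" unfolding f1_def by (simp add: prod.delta)
    then show ?thesis using yD by auto
  qed
  moreover have "(\<Prod>j<N. f2 j) \<le> \<kappa> ^ 2"
  proof (rule prod_le_power_card)
    have "card {j \<in> {..<N}. f2 j \<noteq> 1} \<le> card C"
      by (intro card_mono) (auto simp: f2_def C_def)
    then show "card {j \<in> {..<N}. f2 j \<noteq> 1} \<le> 2" using cardC by simp
  qed (use \<kappa> in \<open>auto simp: f2_def\<close>)
  moreover have IH: "(\<Prod>j<N. y (\<rho> j)) \<le> (\<Prod>m<N. \<kappa>\<^sup>2 * (y (pdist s {..<m} m))\<^sup>2)"
    unfolding \<rho>_def using inj Suc.prems by (intro Suc.IH) auto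
  moreover have y0: "0 \<le> y (\<rho> j)" if "j < N" for j using y1[OF \<rho>[OF that]] by simp
  moreover have f0: "0 \<le> f1 j" "0 \<le> f2 j" for j using \<kappa> yD by (auto simp: f1_def f2_def)
  ultimately have "(\<Prod>j<N. f1 j) * (\<Prod>j<N. f2 j) * (\<Prod>j<N. y (\<rho> j))
      \<le> y D * \<kappa>\<^sup>2 * (\<Prod>m<N. \<kappa>\<^sup>2 * (y (pdist s {..<m} m))\<^sup>2)"
    using yD \<kappa> by (intro mult_mono) (auto intro!: prod_nonneg mult_nonneg_nonneg)
  moreover have "(\<Prod>j<N. y (min (\<rho> j) (x j))) \<le> (\<Prod>j<N. f1 j * f2 j * y (\<rho> j))"
    using le x \<rho> y1 by (intro prod_mono) (auto intro: order_trans[OF zero_le_one])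
  ultimately have "(\<Prod>j<N. y (min (\<rho> j) (x j))) \<le> y D * \<kappa>\<^sup>2 * (\<Prod>m<N. \<kappa>\<^sup>2 * (y (pdist s {..<m} m))\<^sup>2)"
    by (simp add: prod.distrib)
  \<comment> \<open>This \<open>y D\<close> belongs to the new point itself; with the one paid by
    \<open>j0\<close> it forms the square.\<close>
  then have "(\<Prod>j<N. y (min (\<rho> j) (x j))) * y D \<le> y D * \<kappa>\<^sup>2 * (\<Prod>m<N. \<kappa>\<^sup>2 * (y (pdist s {..<m} m))\<^sup>2) * y D"
    using yD by (intro mult_right_mono) auto
  moreover have "(\<Prod>j<N. y (min (\<rho> j) (x j))) = (\<Prod>j<N. y (pdist s {..<Suc N} j))"
    by (intro prod.cong) (auto simp: new)
  moreover have "pdist s {..<Suc N} N = D" unfolding lessThan_Suc pdist_insert_same D_def ..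
  ultimately show ?case by (simp add: D_def[symmetric] power2_eq_square mult_ac)
qed simp

section \<open>Integrating singular factors over the unit cube\<close>

text \<open>The value at \<open>0\<close> is infinite, unlike \<open>0 powr (- a) = 0\<close>, so that the bounds below also hold
  for coinciding points.\<close>

definition sing :: "real \<Rightarrow> real \<Rightarrow> ennreal" where
  "sing a x = (if x = 0 then \<infinity> else if \<bar>x\<bar> < 1 then ennreal (\<bar>x\<bar> powr (- a)) else 0)"

lemma sing_measurable [measurable]: "sing a \<in> borel_measurable borel"
  unfolding sing_def[abs_def] by measurable

text \<open>The singularity is integrable as \<open>a < 1\<close>. The factor \<open>1 / n\<close>
  produced by scaling lets up to \<open>N\<close> such terms be added at bounded cost.\<close>

lemma nn_integral_sing:
  assumes "0 \<le> a" "a < 1" "n > 0"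
  shows "(\<integral>\<^sup>+x. sing a (n * (x - c)) \<partial>lborel) = ennreal (2 / (n * (1 - a)))"
proof -
  have half: "(\<integral>\<^sup>+x. ennreal (x powr (- a)) * indicator {0..1} x \<partial>lborel) = ennreal (1 / (1 - a))"
    using has_integral_powr_from_0[of "- a" 1] assms
    by (intro nn_integral_has_integral_lebesgue') auto
  have "(\<integral>\<^sup>+x. sing a x \<partial>lborel) = (\<integral>\<^sup>+x. ennreal (x powr (- a)) * indicator {0..1} x +
      ennreal ((0 + (-1) * x) powr (- a)) * indicator {0..1} (0 + (-1) * x :: real) \<partial>lborel)"
  proof (rule nn_integral_cong_AE)
    have "AE x in lborel. x \<noteq> (0::real)" "AE x in lborel. x \<noteq> (1::real)" "AE x in lborel. x \<noteq> (-1::real)"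
      by (auto intro: AE_lborel_singleton)
    then show "AE x in lborel. sing a x = ennreal (x powr (- a)) * indicator {0..1} x +
      ennreal ((0 + (-1) * x) powr (- a)) * indicator {0..1} (0 + (-1) * x :: real)"
      by eventually_elim (auto simp: sing_def indicator_def)
  qed
  also have "\<dots> = (\<integral>\<^sup>+x. ennreal (x powr (- a)) * indicator {0..1} x \<partial>lborel) +
      (\<integral>\<^sup>+x. ennreal ((0 + (-1) * x) powr (- a)) * indicator {0..1} (0 + (-1) * x :: real) \<partial>lborel)"
    by (intro nn_integral_add) auto
  also have "(\<integral>\<^sup>+x. ennreal ((0 + (-1) * x) powr (- a)) * indicator {0..1} (0 + (-1) * x :: real) \<partial>lborel)
     = (\<integral>\<^sup>+x. ennreal (x powr (- a)) * indicator {0..1} x \<partial>lborel)"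
    by (subst (2) nn_integral_real_affine[of _ "-1" 0]) auto
  finally have 1: "(\<integral>\<^sup>+x. sing a x \<partial>lborel) = ennreal (2 / (1 - a))"
    unfolding half using assms by (simp add: ennreal_plus[symmetric] del: ennreal_plus)
  have "ennreal (2 / (1 - a)) = ennreal n * (\<integral>\<^sup>+x. sing a (- n * c + n * x) \<partial>lborel)"
    using assms unfolding 1[symmetric] by (subst nn_integral_real_affine[of _ n "- n * c"]) auto
  then have "ennreal (1 / n) * ennreal (2 / (1 - a)) =
      (ennreal (1 / n) * ennreal n) * (\<integral>\<^sup>+x. sing a (n * (x - c)) \<partial>lborel)"
    by (simp add: algebra_simps)
  then show ?thesis
    using assms by (simp add: ennreal_mult[symmetric] del: ennreal_mult)
qed

text \<open>An additive majorant for a negative power of \<open>N\<close> times the distance of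
  \<open>s m\<close> to \<open>0\<close> and the preceding times: one summand for each candidate for
  the nearest neighbour, and the \<open>1\<close> for the case that this distance is at least
  \<open>1 / N\<close>, where \<open>sing\<close> may vanish.\<close>

definition sing_sum :: "real \<Rightarrow> nat \<Rightarrow> (nat \<Rightarrow> real) \<Rightarrow> nat \<Rightarrow> ennreal" where
  "sing_sum a N s m = 1 + sing a (real N * s m) + (\<Sum>l<m. sing a (real N * (s m - s l)))"

abbreviation unit_meas :: "real measure" where
  "unit_meas \<equiv> restrict_space lborel {0..1}"

lemma prob_space_unit_meas: "prob_space unit_meas"
  by (rule prob_spaceI) (simp add: emeasure_restrict_space space_restrict_space)

lemma unit_meas_measurable_id: "(\<lambda>x. x) \<in> borel_measurable unit_meas"
  by (intro measurable_restrict_space1) auto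

lemma PiM_unit_meas_component:
  "j \<in> I \<Longrightarrow> (\<lambda>s. s j) \<in> borel_measurable (PiM I (\<lambda>_. unit_meas))"
  by (rule measurable_compose[OF measurable_component_singleton[of j I "\<lambda>_. unit_meas"] unit_meas_measurable_id])

lemma sing_sum_measurable:
  assumes "m \<in> I" "{..<m} \<subseteq> I"
  shows "(\<lambda>s. sing_sum a N s m) \<in> borel_measurable (PiM I (\<lambda>_. unit_meas))"
proof -
  note [measurable] = PiM_unit_meas_component[OF assms(1)]
  have [measurable]: "(\<lambda>s. s l) \<in> borel_measurable (PiM I (\<lambda>_. unit_meas))" if "l \<in> {..<m}" for l
    using assms(2) that by (intro PiM_unit_meas_component) auto
  show ?thesis unfolding sing_sum_def by measurable
qed

lemma nn_integral_sing_unit_le: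
  assumes "0 \<le> a" "a < 1" "n > 0"
  shows "(\<integral>\<^sup>+x. sing a (n * (x - c)) \<partial>unit_meas) \<le> ennreal (2 / (n * (1 - a)))"
  unfolding nn_integral_sing[OF assms, of c, symmetric]
  by (subst nn_integral_restrict_space) (auto intro!: nn_integral_mono simp: indicator_def)

text \<open>Factor \<open>j\<close> involves the times up to \<open>j\<close> only, so the last time
  can be integrated with the others frozen. It meets at most \<open>N\<close> singularities, each of
  integral at most \<open>2 / (N * (1 - a))\<close>. The scale \<open>N\<close> stays fixed in the
  induction on \<open>m\<close>.\<close>

lemma nn_integral_prod_sing_sum_le:
  assumes a: "0 \<le> a" "a < 1" and "m \<le> N"
  shows "(\<integral>\<^sup>+s. (\<Prod>j<m. sing_sum a N s j) \<partial>PiM {..<m} (\<lambda>_. unit_meas)) \<le> ennreal ((1 + 2 / (1 - a)) ^ m)"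
  using assms(3)
proof (induction m)
  case 0
  then show ?case by (simp add: PiM_empty)
next
  case (Suc m)
  interpret prob_space unit_meas by (rule prob_space_unit_meas)
  interpret product_sigma_finite "\<lambda>_::nat. unit_meas" by standard
  have one: "(\<integral>\<^sup>+y. sing_sum a N (s(m := y)) m \<partial>unit_meas) \<le> ennreal (1 + 2 / (1 - a))" for s
  proof -
    have "N > 0" using Suc.prems by simp
    have em: "emeasure unit_meas {0..1} = 1" by (simp add: emeasure_restrict_space)
    note [measurable] = unit_meas_measurable_id
    have "(\<integral>\<^sup>+y. sing_sum a N (s(m := y)) m \<partial>unit_meas) =
      (\<integral>\<^sup>+y. 1 + sing a (real N * (y - 0)) + (\<Sum>l<m. sing a (real N * (y - s l))) \<partial>unit_meas)"
      unfolding sing_sum_def by simp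
    also have "\<dots> = 1 + (\<integral>\<^sup>+y. sing a (real N * (y - 0)) \<partial>unit_meas) + (\<Sum>l<m. (\<integral>\<^sup>+y. sing a (real N * (y - s l)) \<partial>unit_meas))"
      by (subst nn_integral_add, measurable, subst nn_integral_add) (auto simp: nn_integral_sum em)
    also have "\<dots> \<le> 1 + ennreal (2 / (N * (1 - a))) + (\<Sum>l<m. ennreal (2 / (N * (1 - a))))"
      using a \<open>N > 0\<close> by (intro add_mono sum_mono nn_integral_sing_unit_le order_refl) auto
    also have "\<dots> = ennreal (1 + (real m + 1) * (2 / (N * (1 - a))))"
    proof -
      define q where "q = 2 / (real N * (1 - a))"
      have "q \<ge> 0" using a by (simp add: q_def)
      then have "1 + ennreal q + (\<Sum>l<m. ennreal q) = ennreal (1 + (real m + 1) * q)"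
        by (subst sum_ennreal) (auto simp: ennreal_1[symmetric] ennreal_plus[symmetric] algebra_simps
            simp del: ennreal_1 ennreal_plus)
      then show ?thesis by (simp add: q_def)
    qed
    \<comment> \<open>The \<open>m + 1\<close> singularities are those at \<open>0\<close> and at
      the \<open>m\<close> earlier times, and \<open>m + 1 <= N\<close>.\<close>
    also have "\<dots> \<le> ennreal (1 + N * (2 / (N * (1 - a))))"
      using a \<open>N > 0\<close> Suc.prems by (intro ennreal_leI add_left_mono mult_right_mono) auto
    also have "N * (2 / (N * (1 - a))) = 2 / (1 - a)" using \<open>N > 0\<close> by simp
    finally show ?thesis .
  qed
  have upd: "(\<Prod>j<m. sing_sum a N (s(m := y)) j) = (\<Prod>j<m. sing_sum a N s j)" for s y
    by (intro prod.cong) (auto simp: sing_sum_def)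
  have "(\<integral>\<^sup>+s. (\<Prod>j<Suc m. sing_sum a N s j) \<partial>PiM {..<Suc m} (\<lambda>_. unit_meas)) =
     (\<integral>\<^sup>+s. \<integral>\<^sup>+y. (\<Prod>j<Suc m. sing_sum a N (s(m := y)) j) \<partial>unit_meas \<partial>PiM {..<m} (\<lambda>_. unit_meas))"
    unfolding lessThan_Suc
    by (intro product_nn_integral_insert borel_measurable_prod_ennreal sing_sum_measurable) auto
  also have "\<dots> = (\<integral>\<^sup>+s. \<integral>\<^sup>+y. (\<Prod>j<m. sing_sum a N s j) * sing_sum a N (s(m := y)) m \<partial>unit_meas \<partial>PiM {..<m} (\<lambda>_. unit_meas))"
    by (simp add: upd mult.commute del: fun_upd_apply)
  also have "\<dots> \<le> (\<integral>\<^sup>+s. (\<Prod>j<m. sing_sum a N s j) * ennreal (1 + 2 / (1 - a)) \<partial>PiM {..<m} (\<lambda>_. unit_meas))"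
  proof (rule nn_integral_mono)
    fix s assume s: "s \<in> space (PiM {..<m} (\<lambda>_. unit_meas))"
    have m: "(\<lambda>y. sing_sum a N (s(m := y)) m) \<in> borel_measurable unit_meas"
      using measurable_compose[OF measurable_component_update[OF s, of m] sing_sum_measurable[of m "insert m {..<m}"]] by auto
    show "(\<integral>\<^sup>+y. (\<Prod>j<m. sing_sum a N s j) * sing_sum a N (s(m := y)) m \<partial>unit_meas) \<le>
      (\<Prod>j<m. sing_sum a N s j) * ennreal (1 + 2 / (1 - a))"
      using m one[of s] by (subst nn_integral_cmult) (auto intro: mult_left_mono)
  qed
  also have "\<dots> = (\<integral>\<^sup>+s. (\<Prod>j<m. sing_sum a N s j) \<partial>PiM {..<m} (\<lambda>_. unit_meas)) * ennreal (1 + 2 / (1 - a))"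
    by (intro nn_integral_multc borel_measurable_prod_ennreal sing_sum_measurable) auto
  also have "\<dots> \<le> ennreal ((1 + 2 / (1 - a)) ^ m) * ennreal (1 + 2 / (1 - a))"
    using Suc by (intro mult_right_mono) auto
  also have "\<dots> = ennreal ((1 + 2 / (1 - a)) ^ Suc m)"
    using a by (subst ennreal_mult[symmetric]) (auto simp: mult.commute)
  finally show ?case .
qed

text \<open>Since \<open>max 1 ((N x) powr (- b))\<close> exceeds \<open>1\<close> only for \<open>x\<close> below the typical spacing \<open>1/N\<close>, the
  factors lost in \<open>prod_pdist_le\<close> do not affect the power of \<open>N\<close>.\<close>

lemma prod_pdist_powr_le:
  fixes b a' :: real
  assumes b: "b \<ge> 0" and a': "a' \<ge> 0" and N: "N > 0"
    and inj: "inj_on s {..<N}" and pos: "\<And>j. j < N \<Longrightarrow> s j > 0"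
  shows "ennreal (\<Prod>j<N. pdist s {..<N} j powr (- b) * pdist s {..<j} j powr (- a'))
    \<le> ennreal ((4 powr b * N powr (b + a')) ^ N) * (\<Prod>m<N. sing_sum (2 * b + a') N s m)"
proof -
  define y where "y x = max 1 ((N * x) powr (- b))" for x :: real
  have y1: "y x \<ge> 1" for x by (simp add: y_def)
  have ypow: "x powr (- b) \<le> N powr b * y x" if "x > 0" for x
  proof -
    have "x powr (- b) = N powr b * (N * x) powr (- b)"
      using that N by (simp add: powr_mult powr_minus field_simps)
    also have "\<dots> \<le> N powr b * y x" by (intro mult_left_mono) (auto simp: y_def)
    finally show ?thesis .
  qed
  have anti: "y x' \<le> y x" if "0 < x" "x \<le> x'" for x x'
    unfolding y_def using that b N by (intro max.mono powr_mono2') auto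
  have doub: "y (x / 2) \<le> 2 powr b * y x" if "x > 0" for x
  proof -
    have "(N * (x / 2)) powr (- b) = 2 powr b * (N * x) powr (- b)"
      using that N by (simp add: powr_divide powr_minus field_simps)
    also have "\<dots> \<le> 2 powr b * y x" by (intro mult_left_mono) (auto simp: y_def)
    finally have "(N * (x / 2)) powr (- b) \<le> 2 powr b * y x" .
    moreover have "1 * 1 \<le> 2 powr b * y x"
      using b by (intro mult_mono y1 ge_one_powr_ge_zero) auto
    ultimately show ?thesis by (simp add: y_def)
  qed
  have \<rho>: "pdist s {..<N} j > 0" if "j < N" for j
    using pos[OF that] inj that by (intro pdist_pos) (auto simp: insert_absorb)
  have d: "pdist s {..<j} j > 0" if "j < N" for j
    using pos[OF that] inj that by (intro pdist_pos) (auto simp: inj_on_def)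
  \<comment> \<open>Above the spacing \<open>1 / N\<close> all factors are at most \<open>1\<close>,
    and the leading \<open>1\<close> of \<open>sing_sum\<close> suffices. Below it the powers
    combine to the exponent \<open>2 * b + a'\<close>, and the summand of the nearest neighbour has
    exactly this value.\<close>
  have fin: "ennreal ((y (pdist s {..<m} m))\<^sup>2 * (N * pdist s {..<m} m) powr (- a')) \<le> sing_sum (2 * b + a') N s m"
    if m: "m < N" for m
  proof -
    let ?d = "pdist s {..<m} m"
    have d0: "?d > 0" using d[OF m] .
    show ?thesis
    proof (cases "N * ?d < 1")
      case False
      then have "(N * ?d) powr (- b) \<le> 1" "(N * ?d) powr (- a') \<le> 1"
        using powr_mono[of "-b" 0 "N * ?d"] powr_mono[of "-a'" 0 "N * ?d"] a' b by (auto split: if_splits)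
      then have "(y ?d)\<^sup>2 * (N * ?d) powr (- a') \<le> 1" by (simp add: y_def max_absorb1)
      then have "ennreal ((y ?d)\<^sup>2 * (N * ?d) powr (- a')) \<le> 1"
        by (metis ennreal_1 ennreal_leI)
      then show ?thesis unfolding sing_sum_def by (simp add: add.assoc add_increasing2)
    next
      case True
      have "1 \<le> (N * ?d) powr (- b)"
        using powr_mono'[of "- b" 0 "N * ?d"] True b d0 N by auto
      then have "y ?d = (N * ?d) powr (- b)" by (simp add: y_def)
      then have eq: "(y ?d)\<^sup>2 * (N * ?d) powr (- a') = (N * ?d) powr (- (2 * b + a'))"
        by (simp add: power2_eq_square powr_add[symmetric])
      show ?thesis
      proof (cases rule: pdist_cases[OF finite_lessThan, of s m m])
        case 1
        then have "sing (2 * b + a') (N * s m) = ennreal ((N * ?d) powr (- (2 * b + a')))"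
          using True d0 N by (auto simp: sing_def abs_mult)
        then show ?thesis unfolding sing_sum_def eq by (simp add: add.assoc add_increasing add_increasing2)
      next
        case (2 l)
        then have "sing (2 * b + a') (N * (s m - s l)) = ennreal ((N * ?d) powr (- (2 * b + a')))"
          using True d0 N by (auto simp: sing_def abs_mult abs_minus_commute)
        moreover have "sing (2 * b + a') (N * (s m - s l)) \<le> (\<Sum>l<m. sing (2 * b + a') (N * (s m - s l)))"
          using 2 by (intro member_le_sum) auto
        ultimately show ?thesis unfolding sing_sum_def eq by (simp add: add_increasing)
      qed
    qed
  qed
  have "(\<Prod>j<N. pdist s {..<N} j powr (- b) * pdist s {..<j} j powr (- a'))
    \<le> (\<Prod>j<N. N powr b * y (pdist s {..<N} j)) * (\<Prod>j<N. pdist s {..<j} j powr (- a'))"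
  proof -
    have "(\<Prod>j<N. pdist s {..<N} j powr (- b)) \<le> (\<Prod>j<N. N powr b * y (pdist s {..<N} j))"
      using \<rho> ypow by (intro prod_mono) auto
    then show ?thesis
      unfolding prod.distrib[of "\<lambda>j. pdist s {..<N} j powr (- b)"] by (intro mult_right_mono prod_nonneg) auto
  qed
  also have "\<dots> = (N powr b) ^ N * (\<Prod>j<N. y (pdist s {..<N} j)) * (\<Prod>j<N. pdist s {..<j} j powr (- a'))"
    by (simp add: prod.distrib)
  also have "\<dots> \<le> (N powr b) ^ N * (\<Prod>m<N. (2 powr b)\<^sup>2 * (y (pdist s {..<m} m))\<^sup>2) * (\<Prod>j<N. pdist s {..<j} j powr (- a'))"
    using b by (intro mult_right_mono mult_left_mono prod_pdist_le y1 anti doub inj pos prod_nonneg)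
      (auto intro: ge_one_powr_ge_zero)
  also have "\<dots> = (\<Prod>m<N. (4 powr b * N powr (b + a')) * ((y (pdist s {..<m} m))\<^sup>2 * (N * pdist s {..<m} m) powr (- a')))"
  proof -
    have "(2 powr b)\<^sup>2 = (4::real) powr b"
      using powr_mult[of 2 2 b] by (simp add: power2_eq_square)
    moreover have "pdist s {..<m} m powr (- a') = N powr a' * (N * pdist s {..<m} m) powr (- a')" if "m < N" for m
      using N d[OF that] by (simp add: powr_mult powr_minus field_simps)
    then have "(\<Prod>j<N. pdist s {..<j} j powr (- a')) = (N powr a') ^ N * (\<Prod>m<N. (N * pdist s {..<m} m) powr (- a'))"
      by (simp add: prod.distrib)
    ultimately show ?thesis
      by (simp add: prod.distrib powr_add power_mult_distrib mult_ac)
  qed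
  finally have "(\<Prod>j<N. pdist s {..<N} j powr (- b) * pdist s {..<j} j powr (- a')) \<le>
     (4 powr b * N powr (b + a')) ^ N * (\<Prod>m<N. (y (pdist s {..<m} m))\<^sup>2 * (N * pdist s {..<m} m) powr (- a'))"
    by (simp add: prod.distrib)
  then have "ennreal (\<Prod>j<N. pdist s {..<N} j powr (- b) * pdist s {..<j} j powr (- a')) \<le>
     ennreal ((4 powr b * N powr (b + a')) ^ N) * (\<Prod>m<N. ennreal ((y (pdist s {..<m} m))\<^sup>2 * (N * pdist s {..<m} m) powr (- a')))"
    by (subst prod_ennreal) (auto simp: ennreal_mult[symmetric] prod_nonneg intro!: ennreal_leI)
  also have "\<dots> \<le> ennreal ((4 powr b * N powr (b + a')) ^ N) * (\<Prod>m<N. sing_sum (2 * b + a') N s m)"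
    using fin by (intro mult_left_mono prod_mono_ennreal) auto
  finally show ?thesis .
qed

text \<open>At coinciding or vanishing times the majorant is infinite. Bounds by it therefore hold
  at every point of the cube, and no exceptional set of times has to be removed.\<close>

lemma prod_sing_sum_eq_top:
  assumes N: "N > 0" and nneg: "\<And>j. j < N \<Longrightarrow> s j \<ge> 0"
    and "\<not> (inj_on s {..<N} \<and> (\<forall>j<N. s j > 0))"
  shows "(\<Prod>m<N. sing_sum a N s m) = \<infinity>"
proof -
  have "\<exists>m<N. sing_sum a N s m = \<infinity>"
  proof (cases "\<exists>j<N. s j = 0")
    case True
    then show ?thesis by (auto simp: sing_sum_def sing_def)
  next
    case False
    then have "\<not> inj_on s {..<N}" using assms(2,3) by (force simp: less_le)
    then obtain i j where ij: "i < N" "j < N" "i \<noteq> j" "s i = s j" by (auto simp: inj_on_def)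
    have *: "sing_sum a N s m = \<infinity>" if "l < m" "s l = s m" for l m
    proof -
      have "sing a (N * (s m - s l)) \<le> (\<Sum>l<m. sing a (N * (s m - s l)))"
        using that by (intro member_le_sum) auto
      then have "(\<Sum>l<m. sing a (N * (s m - s l))) = \<infinity>"
        using that by (simp add: sing_def top.extremum_unique)
      then show ?thesis by (simp add: sing_sum_def)
    qed
    show ?thesis
      using *[of i j] *[of j i] ij by (metis linorder_neqE_nat)
  qed
  \<comment> \<open>An infinite factor makes the product infinite only if no factor is
    \<open>0\<close>, because \<open>\<infinity> * 0 = 0\<close> in \<open>ennreal\<close>.\<close>
  moreover have "sing_sum a N s m \<noteq> 0" for m
    by (simp add: sing_sum_def add_eq_0_iff_both_eq_0)
  ultimately show ?thesis by (auto simp: ennreal_prod_eq_top)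
qed

section \<open>Moments of the covariance form\<close>

text \<open>Scaling by \<open>y = |x| * sqrt a\<close> dictates the power of \<open>a\<close>. The
  constant comes from \<open>y ^ m <= 1 + y ^ (2 * m)\<close> and a single term of the series of
  \<open>exp (y^2)\<close>.\<close>

lemma abs_power_mult_gaussian_le:
  fixes a x :: real
  assumes "a > 0"
  shows "\<bar>x\<bar> ^ m * exp (- (a * x\<^sup>2)) \<le> (1 + fact m) * a powr (- real m / 2)"
proof -
  define y where "y = \<bar>x\<bar> * sqrt a"
  have y0: "y \<ge> 0" using assms by (simp add: y_def)
  have y2: "y\<^sup>2 = a * x\<^sup>2" using assms by (simp add: y_def power_mult_distrib)
  have "y ^ m \<le> 1 + (y\<^sup>2) ^ m"
  proof (cases "y \<le> 1")
    case True
    then have "y ^ m \<le> 1" using y0 by (simp add: power_le_one)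
    then show ?thesis by (simp add: add_increasing2)
  next
    case False
    then have "y ^ m \<le> y ^ (2 * m)" by (intro power_increasing) auto
    then show ?thesis by (simp add: power_mult)
  qed
  also have "(y\<^sup>2) ^ m \<le> fact m * exp (y\<^sup>2)"
  proof -
    have "inverse (fact m) * (y\<^sup>2) ^ m \<le> (\<Sum>n. inverse (fact n) * (y\<^sup>2) ^ n)"
      using sum_le_suminf[OF summable_exp[of "y\<^sup>2"], of "{m}"] by auto
    then show ?thesis by (simp add: exp_def field_simps)
  qed
  also have "1 + fact m * exp (y\<^sup>2) \<le> (1 + fact m) * exp (y\<^sup>2)"
    by (simp add: algebra_simps)
  finally have "y ^ m * exp (- (y\<^sup>2)) \<le> (1 + fact m)"
    by (simp add: exp_minus field_simps)
  moreover have "\<bar>x\<bar> ^ m = a powr (- real m / 2) * y ^ m"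
  proof -
    have "sqrt a ^ m = a powr (real m / 2)"
      using assms by (simp add: powr_half_sqrt[symmetric] powr_powr flip: powr_realpow)
    then show ?thesis using assms by (simp add: y_def power_mult_distrib powr_minus field_simps)
  qed
  ultimately show ?thesis
    using mult_left_mono[of "y ^ m * exp (- (y\<^sup>2))" "1 + fact m" "a powr (- real m / 2)"]
    by (simp add: y2 mult_ac)
qed

text \<open>The variance of the sum of \<open>p j * W (s j)\<close> for a fractional Brownian motion
  \<open>W\<close>.\<close>

definition fbm_form :: "real \<Rightarrow> nat \<Rightarrow> (nat \<Rightarrow> real) \<Rightarrow> (nat \<Rightarrow> real) \<Rightarrow> real" where
  "fbm_form H N s p = (\<Sum>i<N. \<Sum>l<N. p i * p l * fbm_cov H (s i) (s l))"

lemma fbm_form_measurable [measurable]: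
  "fbm_form H N s \<in> borel_measurable (PiM {..<N} (\<lambda>_. lborel))"
  unfolding fbm_form_def[abs_def] by measurable

text \<open>The exponent is the full form instead of one half of it, since Cauchy-Schwarz squares
  the integrand. One half absorbs the monomials, the other is integrated. The bound is displayed as
  a square so that its root can be read off, and \<open>C\<close> is fixed before \<open>N\<close>
  and \<open>s\<close>.\<close>

lemma nn_integral_moment_fbm_form_le:
  assumes H: "0 < H" "H < 1"
  obtains C where "C > 0" "\<And>N s. N > 0 \<Longrightarrow> inj_on s {..<N} \<Longrightarrow> (\<And>j. j < N \<Longrightarrow> s j > 0) \<Longrightarrow>
    (\<integral>\<^sup>+p. (\<Prod>j<N. ennreal (\<bar>p j\<bar> ^ m)) * ennreal (exp (- fbm_form H N s p)) \<partial>PiM {..<N} (\<lambda>_. lborel))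
     \<le> ennreal ((\<Prod>j<N. C * N powr (m / 4) * pdist s {..<N} j powr (- (H * m / 2)) * pdist s {..<j} j powr (- (H / 2)))\<^sup>2)"
proof -
  define c where "c = (cosint 1)\<^sup>2 / (4 * cosint (2 - 2 * H) * cosint (2 * H))"
  have c: "c > 0" unfolding c_def using H cosint_pos[of 1]
    by (auto intro!: divide_pos_pos mult_pos_pos cosint_pos)
  define K where "K = (1 + fact m) * (2 / c) powr (m / 2) * sqrt (2 * pi / c)"
  have K: "K > 0" using c by (auto simp: K_def intro!: mult_pos_pos add_pos_pos)
  show ?thesis
  proof (rule that[of "sqrt K"])
    fix N :: nat and s :: "nat \<Rightarrow> real"
    assume N: "N > 0" and inj: "inj_on s {..<N}" and pos: "\<And>j. j < N \<Longrightarrow> s j > 0"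
    define \<rho> where "\<rho> j = pdist s {..<N} j" for j
    define d where "d j = pdist s {..<j} j" for j
    have \<rho>: "\<rho> j > 0" if "j < N" for j
      unfolding \<rho>_def using pos[OF that] inj that by (intro pdist_pos) (auto simp: insert_absorb)
    have d: "d j > 0" if "j < N" for j
      unfolding d_def using pos[OF that] inj that by (intro pdist_pos) (auto simp: inj_on_def)
    have lnd1: "c * (p j)\<^sup>2 * \<rho> j powr (2 * H) \<le> fbm_form H N s p" if j: "j < N" for j p
      unfolding fbm_form_def c_def
    proof (rule fbm_cov_local_nondeterminism[OF H])
      show "\<rho> j \<le> s j" using pdist_le_abs[of "{..<N}" s j] pos[OF j] by (simp add: \<rho>_def)
      show "\<rho> j \<le> \<bar>s i - s j\<bar>" if "i \<in> {..<N}" "i \<noteq> j" for i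
        using pdist_le_abs_diff[of "{..<N}" i j s] that by (simp add: \<rho>_def)
    qed (use j \<rho> pos in \<open>auto simp: less_imp_le\<close>)
    \<comment> \<open>The bound of \<open>abs_power_mult_gaussian_le\<close> for the share
      \<open>1 / (2 * N)\<close> of the form that each of the \<open>N\<close> monomials receives.
      The sharing is the origin of \<open>N powr (m / 2)\<close>.\<close>
    define M where "M j = (1 + fact m) * (c * \<rho> j powr (2 * H) / (2 * N)) powr (- real m / 2)" for j
    have M0: "M j \<ge> 0" for j by (simp add: M_def)
    have M: "M j = (1 + fact m) * (2 / c) powr (m / 2) * N powr (m / 2) * \<rho> j powr (- (H * m))"
      if "j < N" for j
      using \<rho>[OF that] c N
      by (simp add: M_def powr_mult powr_divide powr_powr powr_minus field_simps)
    have pt: "(\<Prod>j<N. \<bar>p j\<bar> ^ m) * exp (- fbm_form H N s p) \<le> (\<Prod>j<N. M j) * exp (- fbm_form H N s p / 2)" for p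
    proof -
      have "(\<Prod>j<N. \<bar>p j\<bar> ^ m) * exp (- fbm_form H N s p / 2) = (\<Prod>j<N. \<bar>p j\<bar> ^ m * exp (- fbm_form H N s p / (2 * N)))"
        using N by (simp add: prod.distrib exp_of_nat_mult[symmetric])
      also have "\<dots> \<le> (\<Prod>j<N. M j)"
      proof (intro prod_mono conjI)
        fix j assume "j \<in> {..<N}"
        then have j: "j < N" by simp
        have "\<bar>p j\<bar> ^ m * exp (- fbm_form H N s p / (2 * N))
          \<le> \<bar>p j\<bar> ^ m * exp (- (c * \<rho> j powr (2 * H) / (2 * N) * (p j)\<^sup>2))"
          using lnd1[OF j, of p] N by (intro mult_left_mono) (auto simp: field_simps)
        also have "\<dots> \<le> M j"
          unfolding M_def using c \<rho>[OF j] N by (intro abs_power_mult_gaussian_le) auto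
        finally show "\<bar>p j\<bar> ^ m * exp (- fbm_form H N s p / (2 * N)) \<le> M j" .
      qed auto
      finally have "(\<Prod>j<N. \<bar>p j\<bar> ^ m) * exp (- fbm_form H N s p / 2) * exp (- fbm_form H N s p / 2)
          \<le> (\<Prod>j<N. M j) * exp (- fbm_form H N s p / 2)"
        by (intro mult_right_mono) auto
      then show ?thesis by (simp add: mult.assoc exp_add[symmetric])
    qed
    have "(\<integral>\<^sup>+p. (\<Prod>j<N. ennreal (\<bar>p j\<bar> ^ m)) * ennreal (exp (- fbm_form H N s p)) \<partial>PiM {..<N} (\<lambda>_. lborel))
      \<le> (\<integral>\<^sup>+p. ennreal (\<Prod>j<N. M j) * ennreal (exp (- fbm_form H N s p / 2)) \<partial>PiM {..<N} (\<lambda>_. lborel))"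
      using pt by (intro nn_integral_mono) (auto simp: prod_ennreal ennreal_mult[symmetric] prod_nonneg M0 intro!: ennreal_leI)
    also have "\<dots> = ennreal (\<Prod>j<N. M j) * (\<integral>\<^sup>+p. ennreal (exp (- fbm_form H N s p / 2)) \<partial>PiM {..<N} (\<lambda>_. lborel))"
      by (intro nn_integral_cmult) measurable
    also have "(\<integral>\<^sup>+p. ennreal (exp (- fbm_form H N s p / 2)) \<partial>PiM {..<N} (\<lambda>_. lborel))
        \<le> (\<Prod>j<N. ennreal (sqrt (2 * pi / (c * d j powr (2 * H)))))"
      unfolding fbm_form_def lessThan_atLeast0
    proof (rule nn_integral_gaussian_form_le)
      fix j and p :: "nat \<Rightarrow> real" assume j: "j \<in> {0..<N}" and p: "\<And>l. j < l \<Longrightarrow> p l = 0"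
      \<comment> \<open>As \<open>p\<close> vanishes beyond \<open>j\<close>, local nondeterminism
        may be applied to the times up to \<open>j\<close> alone, for which the larger distance
        \<open>d j\<close> is admissible.\<close>
      have "c * (p j)\<^sup>2 * d j powr (2 * H) \<le> (\<Sum>i\<in>{..j}. \<Sum>l\<in>{..j}. p i * p l * fbm_cov H (s i) (s l))"
        unfolding c_def
      proof (rule fbm_cov_local_nondeterminism[OF H])
        show "d j \<le> s j" using pdist_le_abs[of "{..<j}" s j] pos[of j] j by (simp add: d_def)
        show "d j \<le> \<bar>s i - s j\<bar>" if "i \<in> {..j}" "i \<noteq> j" for i
          using pdist_le_abs_diff[of "{..<j}" i j s] that by (simp add: d_def)
      qed (use j d pos in \<open>auto simp: less_imp_le\<close>)
      also have "\<dots> = (\<Sum>i\<in>{0..<N}. \<Sum>l\<in>{..j}. p i * p l * fbm_cov H (s i) (s l))"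
        using j p by (intro sum.mono_neutral_left) auto
      also have "\<dots> = (\<Sum>i\<in>{0..<N}. \<Sum>l\<in>{0..<N}. p i * p l * fbm_cov H (s i) (s l))"
        using j p by (intro sum.cong refl sum.mono_neutral_left) auto
      finally show "c * d j powr (2 * H) * (p j)\<^sup>2 \<le> (\<Sum>i\<in>{0..<N}. \<Sum>l\<in>{0..<N}. p i * p l * fbm_cov H (s i) (s l))"
        by (simp add: mult_ac)
    next
      fix j assume "j \<in> {0..<N}"
      then show "0 < c * d j powr (2 * H)" using c d[of j] by simp
    qed (auto simp: fbm_cov_sym[OF H])
    also have "ennreal (\<Prod>j<N. M j) * (\<Prod>j<N. ennreal (sqrt (2 * pi / (c * d j powr (2 * H)))))
       = ennreal (\<Prod>j<N. M j * sqrt (2 * pi / (c * d j powr (2 * H))))"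
      using c by (subst prod_ennreal) (auto simp: prod.distrib ennreal_mult[symmetric] prod_nonneg M0)
    also have "(\<Prod>j<N. M j * sqrt (2 * pi / (c * d j powr (2 * H))))
      = (\<Prod>j<N. (sqrt K * N powr (m / 4) * \<rho> j powr (- (H * m / 2)) * d j powr (- (H / 2)))\<^sup>2)"
    proof (intro prod.cong refl)
      fix j assume "j \<in> {..<N}"
      then have j: "j < N" by simp
      have sq: "(x powr z)\<^sup>2 = x powr (2 * z)" for x z :: real
        by (simp add: power2_eq_square powr_add[symmetric])
      have "sqrt (2 * pi / (c * d j powr (2 * H))) = sqrt (2 * pi / c) * d j powr (- H)"
      proof -
        have "sqrt (d j powr (2 * H)) = d j powr H"
          using d[OF j] by (simp add: powr_half_sqrt[symmetric] powr_powr)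
        then show ?thesis using c by (simp add: real_sqrt_divide real_sqrt_mult powr_minus field_simps)
      qed
      then show "M j * sqrt (2 * pi / (c * d j powr (2 * H))) =
          (sqrt K * N powr (m / 4) * \<rho> j powr (- (H * m / 2)) * d j powr (- (H / 2)))\<^sup>2"
        using K by (simp add: M[OF j] power_mult_distrib sq) (simp add: K_def mult_ac)
    qed
    finally show "(\<integral>\<^sup>+p. (\<Prod>j<N. ennreal (\<bar>p j\<bar> ^ m)) * ennreal (exp (- fbm_form H N s p)) \<partial>PiM {..<N} (\<lambda>_. lborel))
     \<le> ennreal ((\<Prod>j<N. sqrt K * N powr (m / 4) * pdist s {..<N} j powr (- (H * m / 2)) * pdist s {..<j} j powr (- (H / 2)))\<^sup>2)"
      by (simp add: prod_power_distrib \<rho>_def d_def mult_left_mono)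
  qed (use K in auto)
qed

lemma ennreal_power2_le_imp_le:
  fixes x y :: ennreal
  assumes "x\<^sup>2 \<le> y\<^sup>2"
  shows "x \<le> y"
  using assms by (cases x; cases y) (auto simp: ennreal_power top_unique dest: power2_le_imp_le)

text \<open>Cauchy-Schwarz separates \<open>s\<close> from \<open>r\<close> and halves the
  exponents; the product over the coordinates adds them up. This gives \<open>K / 4\<close> for
  \<open>N\<close>, \<open>H * K / 2\<close> for the distances to all times and
  \<open>CARD('d) * H / 2\<close> for those to the preceding times.\<close>

lemma prod_nn_integral_moment_fbm_form_le:
  fixes k :: "'d::finite \<Rightarrow> nat" and H :: real
  assumes H: "0 < H" "H < 1"
  defines "K \<equiv> (\<Sum>i\<in>UNIV. k i)"
  shows "\<exists>C>0. \<forall>N s r. N > 0 \<longrightarrow> (\<forall>j<N. s j \<ge> 0) \<longrightarrow> (\<forall>j<N. r j \<ge> 0) \<longrightarrow>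
    (\<Prod>i\<in>UNIV. \<integral>\<^sup>+p. (\<Prod>j<N. ennreal (\<bar>p j\<bar> ^ k i)) *
        ennreal (exp (- (fbm_form H N s p + fbm_form H N r p) / 2)) \<partial>PiM {..<N} (\<lambda>_. lborel))
     \<le> ennreal ((C * N powr ((K / 2 + H * K + CARD('d) * H) / 2)) ^ N) * (\<Prod>m<N. sing_sum (H * K + CARD('d) * H / 2) N s m) *
       (ennreal ((C * N powr ((K / 2 + H * K + CARD('d) * H) / 2)) ^ N) * (\<Prod>m<N. sing_sum (H * K + CARD('d) * H / 2) N r m))"
proof -
  \<comment> \<open>The constant depends on the order of the monomial. It is chosen for all orders
    at once, so that the product over the coordinates is a single constant \<open>D\<close>.\<close>
  have "\<exists>C>0. \<forall>N s. N > 0 \<longrightarrow> inj_on s {..<N} \<longrightarrow> (\<forall>j<N. s j > 0) \<longrightarrow>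
    (\<integral>\<^sup>+p. (\<Prod>j<N. ennreal (\<bar>p j\<bar> ^ m)) * ennreal (exp (- fbm_form H N s p)) \<partial>PiM {..<N} (\<lambda>_. lborel))
     \<le> ennreal ((\<Prod>j<N. C * N powr (m / 4) * pdist s {..<N} j powr (- (H * m / 2)) * pdist s {..<j} j powr (- (H / 2)))\<^sup>2)" for m
    by (rule nn_integral_moment_fbm_form_le[OF H, of m]) blast
  then have "\<exists>C. \<forall>m. C m > 0 \<and> (\<forall>N s. N > 0 \<longrightarrow> inj_on s {..<N} \<longrightarrow> (\<forall>j<N. s j > 0) \<longrightarrow>
    (\<integral>\<^sup>+p. (\<Prod>j<N. ennreal (\<bar>p j\<bar> ^ m)) * ennreal (exp (- fbm_form H N s p)) \<partial>PiM {..<N} (\<lambda>_. lborel))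
     \<le> ennreal ((\<Prod>j<N. C m * N powr (m / 4) * pdist s {..<N} j powr (- (H * m / 2)) * pdist s {..<j} j powr (- (H / 2)))\<^sup>2))"
    by (intro choice allI)
  then obtain C where C: "\<And>m. C m > 0" and Cb: "\<And>m N s. N > 0 \<Longrightarrow> inj_on s {..<N} \<Longrightarrow> (\<forall>j<N. s j > 0) \<Longrightarrow>
    (\<integral>\<^sup>+p. (\<Prod>j<N. ennreal (\<bar>p j\<bar> ^ m)) * ennreal (exp (- fbm_form H N s p)) \<partial>PiM {..<N} (\<lambda>_. lborel))
     \<le> ennreal ((\<Prod>j<N. C m * N powr (m / 4) * pdist s {..<N} j powr (- (H * m / 2)) * pdist s {..<j} j powr (- (H / 2)))\<^sup>2)"
    by blast
  define A where "A m N s = (\<Prod>j<N. C m * N powr (m / 4) * pdist s {..<N} j powr (- (H * m / 2)) * pdist s {..<j} j powr (- (H / 2)))"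
    for m N s
  have A0: "A m N s \<ge> 0" for m N s
    unfolding A_def using C by (intro prod_nonneg ballI mult_nonneg_nonneg) (auto intro: less_imp_le)
  define b where "b = H * K / 2"
  define a' where "a' = CARD('d) * H / 2"
  define D where "D = (\<Prod>i\<in>UNIV. C (k i))"
  have D: "D > 0" unfolding D_def using C by (intro prod_pos) auto
  have AA: "(\<Prod>i\<in>UNIV. A (k i) N s) = (\<Prod>j<N. D * N powr (K / 4)) *
     (\<Prod>j<N. pdist s {..<N} j powr (- b) * pdist s {..<j} j powr (- a'))"
    if N: "N > 0" and inj: "inj_on s {..<N}" and pos: "\<And>j. j < N \<Longrightarrow> s j > 0" for N s
  proof -
    have \<rho>: "pdist s {..<N} j > 0" if "j < N" for j
      using pos[OF that] inj that by (intro pdist_pos) (auto simp: insert_absorb)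
    have d: "pdist s {..<j} j > 0" if "j < N" for j
      using pos[OF that] inj that by (intro pdist_pos) (auto simp: inj_on_def)
    have pp: "(\<Prod>i\<in>UNIV. x powr (f i)) = x powr (\<Sum>i\<in>UNIV. f i)" if "x > 0" for x :: real and f :: "'d \<Rightarrow> real"
      using that by (simp add: powr_sum)
    have "(\<Prod>i\<in>UNIV. A (k i) N s) = (\<Prod>j<N. \<Prod>i\<in>UNIV. C (k i) * N powr (k i / 4) * pdist s {..<N} j powr (- (H * k i / 2)) * pdist s {..<j} j powr (- (H / 2)))"
      unfolding A_def by (rule prod.swap)
    also have "\<dots> = (\<Prod>j<N. (D * N powr (K / 4)) * (pdist s {..<N} j powr (- b) * pdist s {..<j} j powr (- a')))"
    proof (intro prod.cong refl)
      fix j assume "j \<in> {..<N}"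
      then have j: "j < N" by simp
      have e: "(\<Sum>i\<in>UNIV. real (k i) / 4) = K / 4" "(\<Sum>i\<in>UNIV. - (H * real (k i) / 2)) = - b"
        "(\<Sum>i\<in>(UNIV::'d set). - (H / 2)) = - a'"
        by (simp_all add: K_def b_def a'_def sum_divide_distrib sum_distrib_left sum_negf)
      have "(\<Prod>i\<in>UNIV. C (k i) * N powr (k i / 4) * pdist s {..<N} j powr (- (H * k i / 2)) * pdist s {..<j} j powr (- (H / 2)))
        = D * N powr (\<Sum>i\<in>UNIV. real (k i) / 4) * pdist s {..<N} j powr (\<Sum>i\<in>UNIV. - (H * real (k i) / 2)) *
          pdist s {..<j} j powr (\<Sum>i\<in>(UNIV::'d set). - (H / 2))"
        using N \<rho>[OF j] d[OF j] by (simp only: prod.distrib pp D_def of_nat_0_less_iff)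
      then show "(\<Prod>i\<in>UNIV. C (k i) * N powr (k i / 4) * pdist s {..<N} j powr (- (H * k i / 2)) * pdist s {..<j} j powr (- (H / 2)))
        = (D * N powr (K / 4)) * (pdist s {..<N} j powr (- b) * pdist s {..<j} j powr (- a'))"
        unfolding e by simp
    qed
    finally show ?thesis by (simp add: prod.distrib)
  qed
  \<comment> \<open>\<open>4 powr b\<close> is the square of the doubling constant
    \<open>2 powr b\<close> lost in comparing distances.\<close>
  define C' where "C' = D * 4 powr b"
  have C': "C' > 0" using D by (simp add: C'_def)
  define Z where "Z N s = ennreal ((C' * N powr ((K / 2 + H * K + CARD('d) * H) / 2)) ^ N) *
      (\<Prod>m<N. sing_sum (H * K + CARD('d) * H / 2) N s m)" for N s
  have b0: "b \<ge> 0" "a' \<ge> 0" using H by (auto simp: b_def a'_def)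
  have AZ: "ennreal (\<Prod>i\<in>UNIV. A (k i) N s) \<le> Z N s"
    if N: "N > 0" and inj: "inj_on s {..<N}" and pos: "\<And>j. j < N \<Longrightarrow> s j > 0" for N s
  proof -
    have "ennreal (\<Prod>i\<in>UNIV. A (k i) N s) = ennreal ((D * N powr (K / 4)) ^ N) * 
        ennreal (\<Prod>j<N. pdist s {..<N} j powr (- b) * pdist s {..<j} j powr (- a'))"
    proof -
      have "(\<Prod>i\<in>UNIV. A (k i) N s) = (D * N powr (K / 4)) ^ N * (\<Prod>j<N. pdist s {..<N} j powr (- b) * pdist s {..<j} j powr (- a'))"
        using AA[OF that] by simp
      then show ?thesis using D by (simp only:) (intro ennreal_mult prod_nonneg, auto)
    qed
    also have "\<dots> \<le> ennreal ((D * N powr (K / 4)) ^ N) * (ennreal ((4 powr b * N powr (b + a')) ^ N) * (\<Prod>m<N. sing_sum (2 * b + a') N s m))"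
      by (intro mult_left_mono prod_pdist_powr_le b0 that) auto
    also have "\<dots> = ennreal ((D * N powr (K / 4)) ^ N * (4 powr b * N powr (b + a')) ^ N) * (\<Prod>m<N. sing_sum (2 * b + a') N s m)"
      using D by (simp add: ennreal_mult mult.assoc)
    also have "(D * N powr (K / 4)) ^ N * (4 powr b * N powr (b + a')) ^ N = (C' * N powr (K / 4 + b + a')) ^ N"
      by (simp add: C'_def power_mult_distrib[symmetric] powr_add mult_ac)
    also have "K / 4 + b + a' = (K / 2 + H * K + CARD('d) * H) / 2"
      by (simp add: b_def a'_def field_simps)
    also have "2 * b + a' = H * K + CARD('d) * H / 2"
      by (simp add: b_def a'_def)
    finally show ?thesis unfolding Z_def .
  qed
  have pw: "(C' * N powr e) ^ N > 0" if "N > 0" for N :: nat and e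
    using C' that by simp
  have Z_nz: "Z N s \<noteq> 0" if "N > 0" for N s
  proof -
    have "sing_sum a N s m \<noteq> 0" for a m by (simp add: sing_sum_def)
    then show ?thesis unfolding Z_def using pw[OF that] by (simp add: ennreal_eq_0_iff not_le del: zero_less_power_eq)
  qed
  have Z_top: "Z N s = \<infinity>" if "N > 0" "\<And>j. j < N \<Longrightarrow> s j \<ge> 0"
     "\<not> (inj_on s {..<N} \<and> (\<forall>j<N. s j > 0))" for N s
    unfolding Z_def using pw[OF that(1)] prod_sing_sum_eq_top[OF that, of "H * K + CARD('d) * H / 2"]
    by (simp add: ennreal_mult_eq_top_iff ennreal_eq_0_iff not_le del: zero_less_power_eq)
  \<comment> \<open>Each of the two functions receives the square roots of the monomials, so that
    both squares are integrals of the kind bounded by \<open>Cb\<close>.\<close>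
  have CS: "(\<integral>\<^sup>+p. (\<Prod>j<N. ennreal (\<bar>p j\<bar> ^ m)) *
        ennreal (exp (- (fbm_form H N s p + fbm_form H N r p) / 2)) \<partial>PiM {..<N} (\<lambda>_. lborel))
      \<le> ennreal (A m N s) * ennreal (A m N r)" (is "?I \<le> _")
    if N: "N > 0" and s: "inj_on s {..<N}" "\<forall>j<N. s j > 0" and r: "inj_on r {..<N}" "\<forall>j<N. r j > 0" for N s r m
  proof -
    define f where "f s p = (\<Prod>j<N. ennreal (sqrt (\<bar>p j\<bar> ^ m))) * ennreal (exp (- fbm_form H N s p / 2))" for s p
    have f2: "(f s p)\<^sup>2 = (\<Prod>j<N. ennreal (\<bar>p j\<bar> ^ m)) * ennreal (exp (- fbm_form H N s p))" for s p
      unfolding f_def power_mult_distrib prod_power_distrib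
      by (simp add: ennreal_power exp_double[symmetric])
    have fm [measurable]: "f s \<in> borel_measurable (PiM {..<N} (\<lambda>_. lborel))" for s
      unfolding f_def[abs_def] by measurable
    have "?I = (\<integral>\<^sup>+p. f s p * f r p \<partial>PiM {..<N} (\<lambda>_. lborel))"
    proof (rule nn_integral_cong)
      fix p
      have "(\<Prod>j<N. ennreal (\<bar>p j\<bar> ^ m)) = (\<Prod>j<N. ennreal (sqrt (\<bar>p j\<bar> ^ m))) * (\<Prod>j<N. ennreal (sqrt (\<bar>p j\<bar> ^ m)))"
        unfolding prod.distrib[symmetric] by (simp add: ennreal_mult[symmetric])
      moreover have "ennreal (exp (- (fbm_form H N s p + fbm_form H N r p) / 2)) =
        ennreal (exp (- fbm_form H N s p / 2)) * ennreal (exp (- fbm_form H N r p / 2))"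
        by (simp add: ennreal_mult[symmetric] exp_add[symmetric] field_simps)
      ultimately show "(\<Prod>j<N. ennreal (\<bar>p j\<bar> ^ m)) *
        ennreal (exp (- (fbm_form H N s p + fbm_form H N r p) / 2)) = f s p * f r p"
        by (simp add: f_def mult_ac)
    qed
    also have "(\<dots>)\<^sup>2 \<le> (\<integral>\<^sup>+p. (f s p)\<^sup>2 \<partial>PiM {..<N} (\<lambda>_. lborel)) * (\<integral>\<^sup>+p. (f r p)\<^sup>2 \<partial>PiM {..<N} (\<lambda>_. lborel))"
      by (rule Cauchy_Schwarz_nn_integral) measurable
    also have "\<dots> \<le> ennreal ((A m N s)\<^sup>2) * ennreal ((A m N r)\<^sup>2)"
      unfolding f2 A_def by (intro mult_mono Cb N s r) auto
    also have "\<dots> = (ennreal (A m N s) * ennreal (A m N r))\<^sup>2"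
      by (simp add: power_mult_distrib ennreal_power A0)
    finally show ?thesis by (rule ennreal_power2_le_imp_le)
  qed
  show ?thesis
  proof (intro exI[of _ C'] conjI C' allI impI, fold Z_def)
    fix N :: nat and s r :: "nat \<Rightarrow> real"
    assume N: "N > 0" and s0: "\<forall>j<N. s j \<ge> 0" and r0: "\<forall>j<N. r j \<ge> 0"
    show "(\<Prod>i\<in>UNIV. \<integral>\<^sup>+p. (\<Prod>j<N. ennreal (\<bar>p j\<bar> ^ k i)) *
        ennreal (exp (- (fbm_form H N s p + fbm_form H N r p) / 2)) \<partial>PiM {..<N} (\<lambda>_. lborel))
     \<le> Z N s * Z N r"
    proof (cases "(inj_on s {..<N} \<and> (\<forall>j<N. s j > 0)) \<and> (inj_on r {..<N} \<and> (\<forall>j<N. r j > 0))")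
      case True
      have "(\<Prod>i\<in>UNIV. \<integral>\<^sup>+p. (\<Prod>j<N. ennreal (\<bar>p j\<bar> ^ k i)) *
        ennreal (exp (- (fbm_form H N s p + fbm_form H N r p) / 2)) \<partial>PiM {..<N} (\<lambda>_. lborel))
        \<le> (\<Prod>i\<in>UNIV. ennreal (A (k i) N s) * ennreal (A (k i) N r))"
        using True N by (intro prod_mono_ennreal CS) auto
      also have "\<dots> = ennreal (\<Prod>i\<in>UNIV. A (k i) N s) * ennreal (\<Prod>i\<in>UNIV. A (k i) N r)"
        by (simp add: prod.distrib prod_ennreal A0)
      also have "\<dots> \<le> Z N s * Z N r"
        using True N by (intro mult_mono AZ) auto
      finally show ?thesis .
    next
      case False
      \<comment> \<open>For degenerate times the right-hand side is infinite, since neither of its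
        factors is \<open>0\<close>.\<close>
      then have "Z N s = \<infinity> \<or> Z N r = \<infinity>" using Z_top[OF N, of s] Z_top[OF N, of r] s0 r0 by blast
      then have "Z N s * Z N r = \<infinity>" using Z_nz[OF N, of s] Z_nz[OF N, of r] 
        by (auto simp: ennreal_mult_eq_top_iff)
      then show ?thesis by simp
    qed
  qed
qed

section \<open>Fourier representation of the derivatives of the heat kernel\<close>

text \<open>\<open>gft \<epsilon> m\<close> is the \<open>m\<close>-th derivative of the one-dimensional heat kernel at time \<open>\<epsilon>\<close>, written as
  an inverse Fourier transform; it is real-valued.\<close>

definition gft_integrand :: "real \<Rightarrow> nat \<Rightarrow> real \<Rightarrow> complex" where
  "gft_integrand \<epsilon> m p = (\<i> * of_real p) ^ m * of_real (exp (- (\<epsilon> * p\<^sup>2 / 2)) / (2 * pi))"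

lemma gft_integrand_measurable [measurable]: "gft_integrand \<epsilon> m \<in> borel_measurable borel"
  unfolding gft_integrand_def[abs_def] by measurable

lemma norm_gft_integrand: "norm (gft_integrand \<epsilon> m p) = \<bar>p\<bar> ^ m * (exp (- (\<epsilon> * p\<^sup>2 / 2)) / (2 * pi))"
  by (simp add: gft_integrand_def norm_mult norm_power norm_divide)

lemma norm_gft_integrand_Suc: "norm (gft_integrand \<epsilon> (Suc m) p) = \<bar>p\<bar> * norm (gft_integrand \<epsilon> m p)"
  by (simp add: norm_gft_integrand)

lemma integrable_gft_integrand:
  assumes "\<epsilon> > 0"
  shows "integrable lborel (gft_integrand \<epsilon> m)"
proof (rule Bochner_Integration.integrable_bound)
  show "integrable lborel (\<lambda>p. ((1 + fact m) * (\<epsilon> / 4) powr (- real m / 2)) * exp (- (\<epsilon> / 2 * (p + 0)\<^sup>2) / 2))"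
    using nn_integral_gaussian[of "\<epsilon> / 2" 0] assms
    by (intro integrable_mult_right integrableI_bounded) auto
  show "AE p in lborel. norm (gft_integrand \<epsilon> m p) \<le> norm (((1 + fact m) * (\<epsilon> / 4) powr (- real m / 2)) * exp (- (\<epsilon> / 2 * (p + 0)\<^sup>2) / 2))"
  proof (rule AE_I2)
    fix p
    have "\<bar>p\<bar> ^ m * exp (- (\<epsilon> * p\<^sup>2 / 2)) = (\<bar>p\<bar> ^ m * exp (- (\<epsilon> / 4 * p\<^sup>2))) * exp (- (\<epsilon> / 4 * p\<^sup>2))"
      by (simp add: mult.assoc exp_add[symmetric])
    also have "\<dots> \<le> ((1 + fact m) * (\<epsilon> / 4) powr (- real m / 2)) * exp (- (\<epsilon> / 4 * p\<^sup>2))"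
      using assms by (intro mult_right_mono abs_power_mult_gaussian_le) auto
    finally have *: "\<bar>p\<bar> ^ m * exp (- (\<epsilon> * p\<^sup>2 / 2)) \<le> ((1 + fact m) * (\<epsilon> / 4) powr (- real m / 2)) * exp (- (\<epsilon> / 4 * p\<^sup>2))" .
    have "norm (gft_integrand \<epsilon> m p) \<le> \<bar>p\<bar> ^ m * exp (- (\<epsilon> * p\<^sup>2 / 2)) / 1"
      unfolding norm_gft_integrand times_divide_eq_right using pi_gt3 by (intro divide_left_mono) auto
    with * show "norm (gft_integrand \<epsilon> m p) \<le> norm (((1 + fact m) * (\<epsilon> / 4) powr (- real m / 2)) * exp (- (\<epsilon> / 2 * (p + 0)\<^sup>2) / 2))"
      by (simp add: abs_mult add_pos_pos)
  qed
qed simp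

definition gft :: "real \<Rightarrow> nat \<Rightarrow> real \<Rightarrow> complex" where
  "gft \<epsilon> m x = (\<integral>p. gft_integrand \<epsilon> m p * iexp (p * x) \<partial>lborel)"

lemma integrable_gft:
  assumes "\<epsilon> > 0"
  shows "integrable lborel (\<lambda>p. gft_integrand \<epsilon> m p * iexp (p * x))"
  by (rule Bochner_Integration.integrable_bound[OF integrable_gft_integrand[OF assms, of m]])
     (auto simp: norm_mult)

text \<open>Differentiation under the integral by dominated convergence along sequences:
  \<open>|exp (\<i> * p * h) - 1| <= |p * h|\<close> gives \<open>|p|\<close> times the modulus of
  the integrand as majorant, which the Gaussian keeps integrable. The values are complex and the
  variable is real, hence a difference quotient instead of a field derivative.\<close>

lemma gft_difference_quotient:
  assumes \<epsilon>: "\<epsilon> > 0"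
  shows "((\<lambda>h. (gft \<epsilon> m (x + h) - gft \<epsilon> m x) / of_real h) \<longlongrightarrow> gft \<epsilon> (Suc m) x) (at 0)"
  unfolding tendsto_at_iff_sequentially
proof (intro allI impI)
  fix h :: "nat \<Rightarrow> real" assume h: "\<forall>i. h i \<in> UNIV - {0}" "h \<longlonglongrightarrow> 0"
  have h0: "h n \<noteq> 0" for n using h(1) by auto
  define F where "F n p = gft_integrand \<epsilon> m p * iexp (p * x) * ((iexp (p * h n) - 1) / of_real (h n))" for n p
  have eq: "(gft \<epsilon> m (x + h n) - gft \<epsilon> m x) / of_real (h n) = (\<integral>p. F n p \<partial>lborel)" for n
  proof -
    have "(gft \<epsilon> m (x + h n) - gft \<epsilon> m x) / of_real (h n) =
      (\<integral>p. (gft_integrand \<epsilon> m p * iexp (p * (x + h n)) - gft_integrand \<epsilon> m p * iexp (p * x)) / of_real (h n) \<partial>lborel)"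
      unfolding gft_def
      by (subst Bochner_Integration.integral_diff[symmetric, OF integrable_gft[OF \<epsilon>] integrable_gft[OF \<epsilon>]])
        (simp only: integral_divide_zero)
    also have "\<dots> = (\<integral>p. F n p \<partial>lborel)"
      by (intro Bochner_Integration.integral_cong refl) (simp add: F_def algebra_simps exp_add)
    finally show ?thesis .
  qed
  have "(\<lambda>n. \<integral>p. F n p \<partial>lborel) \<longlonglongrightarrow> (\<integral>p. gft_integrand \<epsilon> (Suc m) p * iexp (p * x) \<partial>lborel)"
  proof (rule integral_dominated_convergence)
    show "integrable lborel (\<lambda>p. norm (gft_integrand \<epsilon> (Suc m) p))"
      using integrable_gft_integrand[OF \<epsilon>] by (rule integrable_norm)
    show "AE p in lborel. (\<lambda>n. F n p) \<longlonglongrightarrow> gft_integrand \<epsilon> (Suc m) p * iexp (p * x)"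
    proof (rule AE_I2)
      fix p
      have "(\<lambda>n. (iexp (p * h n) - 1) / of_real (h n) - \<i> * of_real p) \<longlonglongrightarrow> 0"
      proof (rule Lim_null_comparison)
        show "\<forall>\<^sub>F n in sequentially. norm ((iexp (p * h n) - 1) / of_real (h n) - \<i> * of_real p) \<le> p\<^sup>2 / 2 * \<bar>h n\<bar>"
        proof (rule always_eventually, rule allI)
          fix n
          have "norm ((iexp (p * h n) - 1) / of_real (h n) - \<i> * of_real p)
             = norm ((iexp (p * h n) - (1 + \<i> * of_real (p * h n))) / of_real (h n))"
            using h0[of n] by (intro arg_cong[where f = norm]) (simp add: field_simps)
          also have "\<dots> = norm (iexp (p * h n) - (1 + \<i> * of_real (p * h n))) / \<bar>h n\<bar>"
            by (simp add: norm_divide)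
          also have "\<dots> \<le> ((p * h n)\<^sup>2 / 2) / \<bar>h n\<bar>"
            using iexp_approx1[of "p * h n" 1] by (intro divide_right_mono) (auto simp: power2_eq_square algebra_simps)
          also have "\<dots> = p\<^sup>2 / 2 * \<bar>h n\<bar>"
            using h0[of n] by (simp add: power_mult_distrib power2_eq_square abs_if field_simps)
          finally show "norm ((iexp (p * h n) - 1) / of_real (h n) - \<i> * of_real p) \<le> p\<^sup>2 / 2 * \<bar>h n\<bar>" .
        qed
        show "(\<lambda>n. p\<^sup>2 / 2 * \<bar>h n\<bar>) \<longlonglongrightarrow> 0"
          using h(2) by (intro tendsto_mult_right_zero tendsto_rabs_zero)
      qed
      then have "(\<lambda>n. (iexp (p * h n) - 1) / of_real (h n)) \<longlonglongrightarrow> \<i> * of_real p"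
        by (simp add: LIM_zero_iff)
      then have "(\<lambda>n. F n p) \<longlonglongrightarrow> gft_integrand \<epsilon> m p * iexp (p * x) * (\<i> * of_real p)"
        unfolding F_def by (intro tendsto_mult_left)
      then show "(\<lambda>n. F n p) \<longlonglongrightarrow> gft_integrand \<epsilon> (Suc m) p * iexp (p * x)"
        by (simp add: gft_integrand_def mult_ac)
    qed
    show "AE p in lborel. norm (F n p) \<le> norm (gft_integrand \<epsilon> (Suc m) p)" for n
    proof (rule AE_I2)
      fix p
      have "norm ((iexp (p * h n) - 1) / of_real (h n)) \<le> \<bar>p * h n\<bar> / \<bar>h n\<bar>"
        unfolding norm_divide using iexp_approx1[of "p * h n" 0] by (auto intro!: divide_right_mono)
      also have "\<dots> = \<bar>p\<bar>" using h0[of n] by (simp add: abs_mult)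
      finally have *: "norm ((iexp (p * h n) - 1) / of_real (h n)) \<le> \<bar>p\<bar>" .
      show "norm (F n p) \<le> norm (gft_integrand \<epsilon> (Suc m) p)"
        unfolding F_def norm_mult norm_gft_integrand_Suc
        using mult_left_mono[OF *, of "norm (gft_integrand \<epsilon> m p)"] by (simp add: mult.commute)
    qed
  qed (simp_all add: F_def)
  then show "((\<lambda>h. (gft \<epsilon> m (x + h) - gft \<epsilon> m x) / of_real h) \<circ> h) \<longlonglongrightarrow> gft \<epsilon> (Suc m) x"
    unfolding comp_def eq unfolding gft_def .
qed

lemma
  assumes \<epsilon>: "\<epsilon> > 0"
  shows DERIV_Re_gft: "((\<lambda>x. Re (gft \<epsilon> m x)) has_field_derivative Re (gft \<epsilon> (Suc m) x)) (at x)"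
    and DERIV_Im_gft: "((\<lambda>x. Im (gft \<epsilon> m x)) has_field_derivative Im (gft \<epsilon> (Suc m) x)) (at x)"
  using tendsto_Re[OF gft_difference_quotient[OF \<epsilon>, of m x]]
    tendsto_Im[OF gft_difference_quotient[OF \<epsilon>, of m x]]
  by (simp_all add: DERIV_def Re_divide_of_real Im_divide_of_real)

text \<open>The Gaussian is its own Fourier transform: this is the characteristic function of the
  standard normal law at \<open>x / sqrt \<epsilon>\<close>, after the substitution
  \<open>y = sqrt \<epsilon> * p\<close>.\<close>

lemma gft_0:
  assumes \<epsilon>: "\<epsilon> > 0"
  shows "gft \<epsilon> 0 x = of_real ((2 * pi * \<epsilon>) powr (- 1 / 2) * exp (- x\<^sup>2 / (2 * \<epsilon>)))"
proof -
  have "of_real (exp (- (x / sqrt \<epsilon>)\<^sup>2 / 2)) = char std_normal_distribution (x / sqrt \<epsilon>)"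
    by (simp add: char_std_normal_distribution)
  also have "\<dots> = (\<integral>y. std_normal_density y *\<^sub>R iexp (x / sqrt \<epsilon> * y) \<partial>lborel)"
    unfolding char_def by (subst integral_density) auto
  also have "\<dots> = sqrt \<epsilon> *\<^sub>R (\<integral>p. std_normal_density (0 + sqrt \<epsilon> * p) *\<^sub>R iexp (x / sqrt \<epsilon> * (0 + sqrt \<epsilon> * p)) \<partial>lborel)"
    using \<epsilon> by (subst lborel_integral_real_affine[of "sqrt \<epsilon>" _ 0]) auto
  also have "(\<integral>p. std_normal_density (0 + sqrt \<epsilon> * p) *\<^sub>R iexp (x / sqrt \<epsilon> * (0 + sqrt \<epsilon> * p)) \<partial>lborel)
     = (\<integral>p. of_real (sqrt (2 * pi)) * (gft_integrand \<epsilon> 0 p * iexp (p * x)) \<partial>lborel)"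
  proof (intro Bochner_Integration.integral_cong refl)
    fix p
    have s: "1 / sqrt (2 * pi) = sqrt (2 * pi) / (2 * pi)" by (simp add: field_simps)
    have "std_normal_density (0 + sqrt \<epsilon> * p) = sqrt (2 * pi) * (exp (- (\<epsilon> * p\<^sup>2 / 2)) / (2 * pi))"
      unfolding normal_density_def using \<epsilon> s by (simp add: power_mult_distrib)
    then show "std_normal_density (0 + sqrt \<epsilon> * p) *\<^sub>R iexp (x / sqrt \<epsilon> * (0 + sqrt \<epsilon> * p)) =
       of_real (sqrt (2 * pi)) * (gft_integrand \<epsilon> 0 p * iexp (p * x))"
      using \<epsilon> by (simp add: gft_integrand_def scaleR_conv_of_real mult.commute[of x])
  qed
  also have "\<dots> = of_real (sqrt (2 * pi)) * gft \<epsilon> 0 x"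
    unfolding gft_def by (rule integral_mult_right_zero)
  finally have 1: "of_real (exp (- (x / sqrt \<epsilon>)\<^sup>2 / 2)) = of_real (sqrt \<epsilon> * sqrt (2 * pi)) * gft \<epsilon> 0 x"
    by (simp add: scaleR_conv_of_real mult.assoc)
  have 2: "(2 * pi * \<epsilon>) powr (- 1 / 2) = 1 / (sqrt \<epsilon> * sqrt (2 * pi))"
    using \<epsilon> by (simp add: powr_minus powr_half_sqrt real_sqrt_mult field_simps)
  have 3: "(x / sqrt \<epsilon>)\<^sup>2 / 2 = x\<^sup>2 / (2 * \<epsilon>)" using \<epsilon> by (simp add: power_divide)
  have 4: "sqrt \<epsilon> * sqrt (2 * pi) \<noteq> 0" using \<epsilon> by simp
  have "gft \<epsilon> 0 x = of_real (exp (- (x / sqrt \<epsilon>)\<^sup>2 / 2)) / of_real (sqrt \<epsilon> * sqrt (2 * pi))"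
    unfolding 1 using 4 by simp
  also have "\<dots> = of_real (1 / (sqrt \<epsilon> * sqrt (2 * pi)) * exp (- (x / sqrt \<epsilon>)\<^sup>2 / 2))"
    by simp
  finally show ?thesis unfolding 2 using 3 by simp
qed

text \<open>True for the heat kernel itself, and the derivative of a vanishing imaginary part
  vanishes.\<close>

lemma Im_gft:
  assumes \<epsilon>: "\<epsilon> > 0"
  shows "Im (gft \<epsilon> m x) = 0"
proof (induction m arbitrary: x)
  case 0
  then show ?case by (simp add: gft_0[OF \<epsilon>])
next
  case (Suc m)
  have "((\<lambda>x. 0) has_field_derivative Im (gft \<epsilon> (Suc m) x)) (at x)"
    using DERIV_Im_gft[OF \<epsilon>, of m x] Suc by simp
  then show ?case using DERIV_unique[OF _ DERIV_const] by blast
qed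

lemma of_real_Re_gft: "\<epsilon> > 0 \<Longrightarrow> of_real (Re (gft \<epsilon> m x)) = gft \<epsilon> m x"
  by (simp add: complex_eq_iff Im_gft)

lemma Re_gft_measurable [measurable]:
  assumes "\<epsilon> > 0"
  shows "(\<lambda>x. Re (gft \<epsilon> m x)) \<in> borel_measurable borel"
  using DERIV_Re_gft[OF assms] by (intro borel_measurable_continuous_onI DERIV_continuous_on[of UNIV]) blast

lemma abs_Re_gft_le:
  "\<bar>Re (gft \<epsilon> m x)\<bar> \<le> (\<integral>p. norm (gft_integrand \<epsilon> m p) \<partial>lborel)"
proof -
  have "\<bar>Re (gft \<epsilon> m x)\<bar> \<le> norm (gft \<epsilon> m x)" by (rule abs_Re_le_cmod)
  also have "\<dots> \<le> (\<integral>p. norm (gft_integrand \<epsilon> m p * iexp (p * x)) \<partial>lborel)"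
    unfolding gft_def by (rule integral_norm_bound)
  finally show ?thesis by (simp add: norm_mult)
qed

lemma partial_deriv_prod_gft:
  fixes n :: "'d::finite \<Rightarrow> nat"
  assumes \<epsilon>: "\<epsilon> > 0"
  shows "partial_deriv i (\<lambda>x. \<Prod>l\<in>UNIV. Re (gft \<epsilon> (n l) (x $ l))) =
    (\<lambda>x. \<Prod>l\<in>UNIV. Re (gft \<epsilon> ((n(i := Suc (n i))) l) (x $ l)))"
proof
  fix x :: "real ^ 'd"
  define c where "c = (\<Prod>l\<in>UNIV - {i}. Re (gft \<epsilon> (n l) (x $ l)))"
  have eq: "(\<Prod>l\<in>UNIV. Re (gft \<epsilon> (n l) ((x + h *\<^sub>R axis i 1) $ l))) = Re (gft \<epsilon> (n i) (h + x $ i)) * c" for h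
    by (subst prod.remove[of _ i]) (auto simp: axis_def c_def add.commute intro!: prod.cong)
  have "((\<lambda>h. Re (gft \<epsilon> (n i) (h + x $ i))) has_field_derivative Re (gft \<epsilon> (Suc (n i)) (x $ i))) (at 0)"
    using DERIV_Re_gft[OF \<epsilon>, of "n i" "x $ i"] by (subst DERIV_shift[symmetric]) simp
  then have "((\<lambda>h. Re (gft \<epsilon> (n i) (h + x $ i)) * c) has_field_derivative Re (gft \<epsilon> (Suc (n i)) (x $ i)) * c) (at 0)"
    by (rule DERIV_cmult_right)
  then show "partial_deriv i (\<lambda>x. \<Prod>l\<in>UNIV. Re (gft \<epsilon> (n l) (x $ l))) x =
    (\<Prod>l\<in>UNIV. Re (gft \<epsilon> ((n(i := Suc (n i))) l) (x $ l)))"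
    unfolding partial_deriv_def eq
    by (subst prod.remove[of _ i]) (auto simp: c_def DERIV_imp_deriv intro!: prod.cong)
qed

text \<open>The heat kernel is a product of one-dimensional kernels, and a derivative in one
  coordinate raises the order of that factor alone. Products of this shape are closed under every
  \<open>partial_deriv i\<close>, so the prescribed order of differentiation does no harm.\<close>

lemma multi_deriv_gauss_kernel:
  fixes k :: "nat ^ 'd::{finite,linorder}"
  assumes \<epsilon>: "\<epsilon> > 0"
  shows "multi_deriv k (gauss_kernel \<epsilon>) = (\<lambda>x. \<Prod>i\<in>UNIV. Re (gft \<epsilon> (k $ i) (x $ i)))"
proof -
  define P where "P n = (\<lambda>x::(real, 'd) vec. \<Prod>l\<in>UNIV. Re (gft \<epsilon> (n l) (x $ l)))" for n
  have pow: "(partial_deriv i ^^ c) (P n) = P (n(i := n i + c))" for i c n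
  proof (induction c)
    case (Suc c)
    have "partial_deriv i (P n) = P (n(i := Suc (n i)))" for n
      unfolding P_def by (rule partial_deriv_prod_gft[OF \<epsilon>])
    with Suc show ?case by (auto intro!: arg_cong[where f = P])
  qed simp
  \<comment> \<open>Without distinctness a coordinate listed twice would be differentiated twice as
    often.\<close>
  have fold: "foldr (\<lambda>i. partial_deriv i ^^ (k $ i)) xs (P (\<lambda>_. 0)) = P (\<lambda>i. if i \<in> set xs then k $ i else 0)"
    if "distinct xs" for xs
    using that by (induction xs) (auto simp: pow fun_upd_def intro!: arg_cong[where f = P])
  have "gauss_kernel \<epsilon> = P (\<lambda>_. 0)"
  proof
    fix x :: "(real, 'd) vec"
    have "gauss_kernel \<epsilon> x = (\<Prod>i\<in>(UNIV::'d set). (2 * pi * \<epsilon>) powr (- 1 / 2)) * (\<Prod>i\<in>UNIV. exp (- (x $ i)\<^sup>2 / (2 * \<epsilon>)))"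
    proof -
      have "(\<Prod>i\<in>(UNIV::'d set). (2 * pi * \<epsilon>) powr (- 1 / 2)) = (2 * pi * \<epsilon>) powr (- real CARD('d) / 2)"
        using \<epsilon> by (simp add: powr_power)
      moreover have "(norm x)\<^sup>2 = (\<Sum>i\<in>UNIV. (x $ i)\<^sup>2)"
        by (simp add: norm_vec_def L2_set_def sum_nonneg)
      then have "(\<Prod>i\<in>UNIV. exp (- (x $ i)\<^sup>2 / (2 * \<epsilon>))) = exp (- (norm x)\<^sup>2 / (2 * \<epsilon>))"
        by (simp add: exp_sum[symmetric] sum_divide_distrib sum_negf)
      ultimately show ?thesis by (simp add: gauss_kernel_def)
    qed
    then show "gauss_kernel \<epsilon> x = P (\<lambda>_. 0) x"
      by (simp only: P_def gft_0[OF \<epsilon>] Re_complex_of_real prod.distrib)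
  qed
  then show ?thesis
    unfolding multi_deriv_def by (simp add: fold) (simp add: P_def)
qed

section \<open>Characteristic functions of independent fractional Brownian motions\<close>

lemma iexp_mult: "iexp x * iexp y = iexp (x + y)"
  unfolding mult_exp_exp of_real_add distrib_left ..
lemma prod_iexp: "(\<Prod>j\<in>A. iexp (x j)) = iexp (\<Sum>j\<in>A. x j)"
proof (induction A rule: infinite_finite_induct)
  case (insert a A)
  then show ?case by (simp only: prod.insert sum.insert iexp_mult not_False_eq_True)
qed simp_all

context prob_space
begin

text \<open>The degenerate case is included: a centred constant is \<open>0\<close>, and the formula
  reads \<open>1 = 1\<close>.\<close>

lemma
  assumes X: "gaussian_rv M X" and mean: "expectation X = 0"
  shows gaussian_rv_square_integrable: "integrable M (\<lambda>\<omega>. (X \<omega>)\<^sup>2)" (is ?A)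
    and gaussian_rv_char: "(\<integral>\<omega>. iexp (X \<omega>) \<partial>M) = of_real (exp (- expectation (\<lambda>\<omega>. (X \<omega>)\<^sup>2) / 2))" (is ?B)
proof -
  have [measurable]: "X \<in> borel_measurable M" using X by (simp add: gaussian_rv_def)
  from X consider (dist) \<mu> \<sigma> where "\<sigma> > 0" "distributed M lborel X (normal_density \<mu> \<sigma>)"
    | (const) c where "AE \<omega> in M. X \<omega> = c" by (auto simp: gaussian_rv_def)
  then have "?A \<and> ?B"
  proof cases
    case dist
    define Y where "Y \<omega> = X \<omega> / \<sigma>" for \<omega>
    have "\<mu> = 0" using normal_distributed_expectation[OF dist] mean by simp
    then have Y: "distributed M lborel Y std_normal_density"
      using dist normal_standard_normal_convert[of \<sigma> X 0] by (simp add: Y_def[abs_def])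
    have X_eq: "X \<omega> = \<sigma> * Y \<omega>" for \<omega> using dist by (simp add: Y_def)
    have Y2: "integrable M (\<lambda>\<omega>. (Y \<omega>)\<^sup>2)" "expectation (\<lambda>\<omega>. (Y \<omega>)\<^sup>2) = 1"
      using distributed_integrable[OF Y, of "\<lambda>x. x\<^sup>2"] distributed_integral[OF Y, of "\<lambda>x. x\<^sup>2"]
        integrable_std_normal_moment[of 2] integral_std_normal_moment_even[of 1]
      by (auto simp: fact_numeral)
    have "char (distr M borel Y) \<sigma> = of_real (exp (- \<sigma>\<^sup>2 / 2))"
    proof -
      have "distr M borel Y = std_normal_distribution"
        using distributed_distr_eq_density[OF Y] by (simp cong: distr_cong)
      then show ?thesis by (simp add: char_std_normal_distribution)
    qed
    then have "(\<integral>\<omega>. iexp (X \<omega>) \<partial>M) = of_real (exp (- \<sigma>\<^sup>2 / 2))"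
      unfolding char_def X_eq using distributed_measurable[OF Y] by (subst (asm) integral_distr) auto
    then show ?thesis using Y2 by (simp add: X_eq power_mult_distrib)
  next
    case const
    have "c = 0" using const mean integral_cong_AE[of X M "\<lambda>_. c"] by (simp add: prob_space)
    with const have X0: "AE \<omega> in M. X \<omega> = 0" by simp
    have "?A" using X0 by (subst integrable_cong_AE[where g = "\<lambda>_. 0"]) auto
    moreover have "expectation (\<lambda>\<omega>. (X \<omega>)\<^sup>2) = (\<integral>\<omega>. 0 \<partial>M)" using X0 by (intro integral_cong_AE) auto
    moreover have "(\<integral>\<omega>. iexp (X \<omega>) \<partial>M) = (\<integral>\<omega>. 1 \<partial>M)" using X0 by (intro integral_cong_AE) auto
    ultimately show ?thesis by (simp add: prob_space)
  qed
  then show ?A ?B by auto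
qed

context
  fixes H :: real and W :: "real \<Rightarrow> 'a \<Rightarrow> real"
  assumes W: "fbm_1d M H W"
begin

lemma fbm_1d_gaussian: "finite F \<Longrightarrow> F \<subseteq> {0..} \<Longrightarrow> gaussian_rv M (\<lambda>\<omega>. \<Sum>t\<in>F. c t * W t \<omega>)"
  using W by (auto simp: fbm_1d_def centered_gaussian_process_def gaussian_process_def)

lemma fbm_1d_measurable: "t \<ge> 0 \<Longrightarrow> W t \<in> borel_measurable M"
  using fbm_1d_gaussian[of "{t}" "\<lambda>_. 1"] by (simp add: gaussian_rv_def)

lemma fbm_1d_square_integrable: "t \<ge> 0 \<Longrightarrow> integrable M (\<lambda>\<omega>. (W t \<omega>)\<^sup>2)"
  using fbm_1d_gaussian[of "{t}" "\<lambda>_. 1"] W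
  by (intro gaussian_rv_square_integrable) (auto simp: fbm_1d_def centered_gaussian_process_def)

lemma fbm_1d_integrable: "t \<ge> 0 \<Longrightarrow> integrable M (W t)"
  using square_integrable_imp_integrable[OF fbm_1d_measurable fbm_1d_square_integrable, of t] by simp

lemma fbm_1d_mult_integrable:
  assumes "s \<ge> 0" "t \<ge> 0"
  shows "integrable M (\<lambda>\<omega>. W s \<omega> * W t \<omega>)"
proof (rule Bochner_Integration.integrable_bound)
  show "integrable M (\<lambda>\<omega>. (W s \<omega>)\<^sup>2 + (W t \<omega>)\<^sup>2)"
    using fbm_1d_square_integrable assms by auto
  show "AE \<omega> in M. norm (W s \<omega> * W t \<omega>) \<le> norm ((W s \<omega>)\<^sup>2 + (W t \<omega>)\<^sup>2)"
  proof (rule AE_I2)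
    fix \<omega>
    show "norm (W s \<omega> * W t \<omega>) \<le> norm ((W s \<omega>)\<^sup>2 + (W t \<omega>)\<^sup>2)"
    proof -
      have "2 * \<bar>W s \<omega>\<bar> * \<bar>W t \<omega>\<bar> \<le> (W s \<omega>)\<^sup>2 + (W t \<omega>)\<^sup>2"
        using sum_squares_bound[of "\<bar>W s \<omega>\<bar>" "\<bar>W t \<omega>\<bar>"] by simp
      moreover have "0 \<le> \<bar>W s \<omega>\<bar> * \<bar>W t \<omega>\<bar>" by simp
      ultimately have "\<bar>W s \<omega>\<bar> * \<bar>W t \<omega>\<bar> \<le> (W s \<omega>)\<^sup>2 + (W t \<omega>)\<^sup>2" by linarith
      then show ?thesis by (simp add: abs_mult)
    qed
  qed
qed (use fbm_1d_measurable assms in auto)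

lemma fbm_1d_char:
  fixes s p :: "nat \<Rightarrow> real" and N :: nat
  assumes s: "\<And>j. j < N \<Longrightarrow> s j \<ge> 0"
  shows "(\<integral>\<omega>. iexp (\<Sum>j<N. p j * W (s j) \<omega>) \<partial>M) = of_real (exp (- fbm_form H N s p / 2))"
proof -
  define Y where "Y \<omega> = (\<Sum>j<N. p j * W (s j) \<omega>)" for \<omega>
  \<comment> \<open>Times may coincide, whereas \<open>gaussian_process\<close> speaks of finite
    sets of times. Equal times are merged by adding their coefficients.\<close>
  have Y_eq: "Y \<omega> = (\<Sum>t\<in>s ` {..<N}. (\<Sum>j\<in>{j\<in>{..<N}. s j = t}. p j) * W t \<omega>)" for \<omega>
    unfolding Y_def by (subst sum.image_gen[where g = s]) (auto simp: sum_distrib_right intro!: sum.cong)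
  have g: "gaussian_rv M Y"
    unfolding Y_eq[abs_def] using s by (intro fbm_1d_gaussian) auto
  have mean: "expectation Y = 0"
    unfolding Y_def using s fbm_1d_integrable W
    by (subst Bochner_Integration.integral_sum) (auto simp: fbm_1d_def centered_gaussian_process_def)
  have "expectation (\<lambda>\<omega>. (Y \<omega>)\<^sup>2) = fbm_form H N s p"
  proof -
    have "expectation (\<lambda>\<omega>. (Y \<omega>)\<^sup>2) = expectation (\<lambda>\<omega>. \<Sum>i<N. \<Sum>l<N. p i * p l * (W (s i) \<omega> * W (s l) \<omega>))"
      unfolding Y_def power2_eq_square sum_product by (simp add: mult_ac)
    also have "\<dots> = (\<Sum>i<N. \<Sum>l<N. p i * p l * expectation (\<lambda>\<omega>. W (s i) \<omega> * W (s l) \<omega>))"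
    proof -
      have int: "integrable M (\<lambda>\<omega>. p i * p l * (W (s i) \<omega> * W (s l) \<omega>))" if "i < N" "l < N" for i l
        using s that by (intro integrable_mult_right fbm_1d_mult_integrable) auto
      then have "expectation (\<lambda>\<omega>. \<Sum>i<N. \<Sum>l<N. p i * p l * (W (s i) \<omega> * W (s l) \<omega>)) =
          (\<Sum>i<N. expectation (\<lambda>\<omega>. \<Sum>l<N. p i * p l * (W (s i) \<omega> * W (s l) \<omega>)))"
        by (intro Bochner_Integration.integral_sum Bochner_Integration.integrable_sum) auto
      also have "\<dots> = (\<Sum>i<N. \<Sum>l<N. expectation (\<lambda>\<omega>. p i * p l * (W (s i) \<omega> * W (s l) \<omega>)))"
        using int by (intro sum.cong refl Bochner_Integration.integral_sum) auto
      finally show ?thesis by simp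
    qed
    also have "\<dots> = fbm_form H N s p"
      unfolding fbm_form_def using W s
      by (intro sum.cong refl) (auto simp: fbm_1d_def fbm_cov_def)
    finally show ?thesis .
  qed
  then show ?thesis using gaussian_rv_char[OF g mean] by (simp add: Y_def)
qed

end

text \<open>Independence acts on two levels: between the coordinates of one process, and between the
  two processes. The sign of \<open>B'\<close> is moved into \<open>p\<close>, in which
  \<open>fbm_form\<close> is even.\<close>

lemma indep_fbm_char:
  fixes B B' :: "real \<Rightarrow> 'a \<Rightarrow> real ^ 'd::finite" and p :: "'d \<Rightarrow> nat \<Rightarrow> real" and N :: nat
  assumes B: "fbm M H B" and B': "fbm M H B'"
    and indep: "indep_var (path_space {0..}) (path_on {0..} B) (path_space {0..}) (path_on {0..} B')"
    and s: "\<And>j. j < N \<Longrightarrow> s j \<ge> 0" and r: "\<And>j. j < N \<Longrightarrow> r j \<ge> 0"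
  shows "(\<integral>\<omega>. (\<Prod>i\<in>UNIV. \<Prod>j<N. iexp (p i j * (B (s j) \<omega> $ i - B' (r j) \<omega> $ i))) \<partial>M) =
    of_real (\<Prod>i\<in>UNIV. exp (- (fbm_form H N s (p i) + fbm_form H N r (p i)) / 2))"
proof -
  have single: "(\<integral>\<omega>. (\<Prod>i\<in>UNIV. iexp (\<Sum>j<N. q i j * (C (u j) \<omega> $ i))) \<partial>M) =
      of_real (\<Prod>i\<in>UNIV. exp (- fbm_form H N u (q i) / 2))"
    if C: "fbm M H C" and u: "\<And>j. j < N \<Longrightarrow> u j \<ge> 0" for C :: "real \<Rightarrow> 'a \<Rightarrow> real ^ 'd" and u and q :: "'d \<Rightarrow> nat \<Rightarrow> real"
  proof -
    define f where "f i w = iexp (\<Sum>j<N. q i j * w (u j))" for i and w :: "real \<Rightarrow> real"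
    have [measurable]: "(\<lambda>w. w (u j)) \<in> borel_measurable (path_space {0..})" if "j \<in> {..<N}" for j
      using u that by (intro measurable_component_singleton) auto
    have fm: "f i \<in> borel_measurable (path_space {0..})" for i
      unfolding f_def[abs_def] by measurable
    have "indep_vars (\<lambda>_. path_space {0..}) (\<lambda>i. path_on {0..} (\<lambda>t \<omega>. C t \<omega> $ i)) UNIV"
      using C unfolding fbm_def by blast
    then have iv: "indep_vars (\<lambda>_. borel) (\<lambda>i \<omega>. f i (path_on {0..} (\<lambda>t \<omega>. C t \<omega> $ i) \<omega>)) UNIV"
      by (rule indep_vars_compose2[where Y = f]) (rule fm)
    have f_eq: "f i (path_on {0..} (\<lambda>t \<omega>. C t \<omega> $ i) \<omega>) = iexp (\<Sum>j<N. q i j * (C (u j) \<omega> $ i))" for i \<omega>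
    proof -
      have "(\<Sum>j<N. q i j * (path_on {0..} (\<lambda>t \<omega>. C t \<omega> $ i) \<omega> (u j))) = (\<Sum>j<N. q i j * (C (u j) \<omega> $ i))"
        using u by (intro sum.cong refl) (simp add: path_on_def)
      then show ?thesis unfolding f_def by simp
    qed
    have rv: "random_variable borel (\<lambda>\<omega>. f i (path_on {0..} (\<lambda>t \<omega>. C t \<omega> $ i) \<omega>))" for i
      using iv unfolding indep_vars_def by auto
    have "integrable M (\<lambda>\<omega>. f i (path_on {0..} (\<lambda>t \<omega>. C t \<omega> $ i) \<omega>))" for i
      by (rule integrable_const_bound[where B = 1, OF AE_I2 rv]) (simp only: f_def norm_exp_i_times order_refl)
    from indep_vars_lebesgue_integral[OF _ iv this]
    have "(\<integral>\<omega>. (\<Prod>i\<in>UNIV. iexp (\<Sum>j<N. q i j * (C (u j) \<omega> $ i))) \<partial>M) =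
      (\<Prod>i\<in>UNIV. \<integral>\<omega>. iexp (\<Sum>j<N. q i j * (C (u j) \<omega> $ i)) \<partial>M)"
      by (simp only: f_eq finite_UNIV finite_code simp_thms)
    also have "\<dots> = (\<Prod>i\<in>UNIV. of_real (exp (- fbm_form H N u (q i) / 2)))"
      using C u by (intro prod.cong refl fbm_1d_char) (auto simp: fbm_def)
    finally show ?thesis by simp
  qed
  define F where "F v q w = (\<Prod>i\<in>UNIV. iexp (\<Sum>j<N. q i j * (w (v j) $ i)))" for v and q :: "'d \<Rightarrow> nat \<Rightarrow> real" and w :: "real \<Rightarrow> real ^ 'd"
  have Fm: "F v q \<in> borel_measurable (path_space {0..})" if v: "\<And>j. j < N \<Longrightarrow> v j \<ge> 0" for v q
  proof -
    have c: "(\<lambda>w::real \<Rightarrow> real ^ 'd. w (v j)) \<in> borel_measurable (path_space {0..})" if "j \<in> {..<N}" for j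
      using v that by (intro measurable_component_singleton) auto
    have nth: "(\<lambda>x::real ^ 'd. x $ i) \<in> borel_measurable borel" for i
      by (intro borel_measurable_continuous_onI continuous_intros)
    have [measurable]: "(\<lambda>w::real \<Rightarrow> real ^ 'd. w (v j) $ i) \<in> borel_measurable (path_space {0..})" if "j \<in> {..<N}" for j i
      using measurable_compose[OF c[OF that] nth] .
    show ?thesis unfolding F_def[abs_def] by measurable
  qed
  have iv: "indep_var borel (F s p \<circ> path_on {0..} B) borel (F r (\<lambda>i j. - p i j) \<circ> path_on {0..} B')"
    by (intro indep_var_compose[OF indep] Fm s r)
  have nF: "norm (F v q w) = 1" for v q w
    unfolding F_def prod_norm[symmetric] norm_exp_i_times by (rule prod.neutral_const)
  have F_eq: "F v q (path_on {0..} C \<omega>) = (\<Prod>i\<in>UNIV. iexp (\<Sum>j<N. q i j * (C (v j) \<omega> $ i)))"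
    if v: "\<And>j. j < N \<Longrightarrow> v j \<ge> 0" for v q C \<omega>
  proof -
    have "(\<Sum>j<N. q i j * (path_on {0..} C \<omega> (v j) $ i)) = (\<Sum>j<N. q i j * (C (v j) \<omega> $ i))" for i
      using v by (intro sum.cong refl) (simp add: path_on_def)
    then show ?thesis unfolding F_def by simp
  qed
  have F_s: "F s q (path_on {0..} C \<omega>) = (\<Prod>i\<in>UNIV. iexp (\<Sum>j<N. q i j * (C (s j) \<omega> $ i)))" for q C \<omega>
    by (rule F_eq) (rule s)
  have F_r: "F r q (path_on {0..} C \<omega>) = (\<Prod>i\<in>UNIV. iexp (\<Sum>j<N. q i j * (C (r j) \<omega> $ i)))" for q C \<omega>
    by (rule F_eq) (rule r)
  have "(\<integral>\<omega>. (\<Prod>i\<in>UNIV. \<Prod>j<N. iexp (p i j * (B (s j) \<omega> $ i - B' (r j) \<omega> $ i))) \<partial>M) =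
    (\<integral>\<omega>. (F s p \<circ> path_on {0..} B) \<omega> * (F r (\<lambda>i j. - p i j) \<circ> path_on {0..} B') \<omega> \<partial>M)"
    unfolding comp_def F_s F_r prod.distrib[symmetric]
    by (intro Bochner_Integration.integral_cong prod.cong refl)
      (simp only: prod_iexp iexp_mult sum.distrib[symmetric] right_diff_distrib minus_mult_left[symmetric] add_uminus_conv_diff)
  also have "\<dots> = (\<integral>\<omega>. (F s p \<circ> path_on {0..} B) \<omega> \<partial>M) * (\<integral>\<omega>. (F r (\<lambda>i j. - p i j) \<circ> path_on {0..} B') \<omega> \<partial>M)"
  proof (rule indep_var_lebesgue_integral[OF iv])
    show "integrable M (F s p \<circ> path_on {0..} B)"
      by (rule integrable_const_bound[where B = 1, OF AE_I2 indep_var_rv1[OF iv]]) (simp only: comp_def nF order_refl)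
    show "integrable M (F r (\<lambda>i j. - p i j) \<circ> path_on {0..} B')"
      by (rule integrable_const_bound[where B = 1, OF AE_I2 indep_var_rv2[OF iv]]) (simp only: comp_def nF order_refl)
  qed
  also have "\<dots> = of_real (\<Prod>i\<in>UNIV. exp (- fbm_form H N s (p i) / 2)) * of_real (\<Prod>i\<in>UNIV. exp (- fbm_form H N r (\<lambda>j. - p i j) / 2))"
  proof -
    have 1: "(\<integral>\<omega>. (\<Prod>i\<in>UNIV. iexp (\<Sum>j<N. p i j * (B (s j) \<omega> $ i))) \<partial>M) =
      of_real (\<Prod>i\<in>UNIV. exp (- fbm_form H N s (p i) / 2))"
      by (rule single[OF B]) (rule s)
    have 2: "(\<integral>\<omega>. (\<Prod>i\<in>UNIV. iexp (\<Sum>j<N. - p i j * (B' (r j) \<omega> $ i))) \<partial>M) =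
      of_real (\<Prod>i\<in>UNIV. exp (- fbm_form H N r (\<lambda>j. - p i j) / 2))"
      by (rule single[OF B']) (rule r)
    show ?thesis unfolding comp_def F_s F_r 1 2 ..
  qed
  also have "\<dots> = of_real (\<Prod>i\<in>UNIV. exp (- (fbm_form H N s (p i) + fbm_form H N r (p i)) / 2))"
  proof -
    have "fbm_form H N r (\<lambda>j. - q j) = fbm_form H N r q" for q
      by (simp add: fbm_form_def)
    moreover have "exp (- a / 2) * exp (- b / 2) = exp (- (a + b) / 2)" for a b :: real
      unfolding mult_exp_exp by (rule arg_cong[where f = exp]) (simp add: field_simps)
    ultimately show ?thesis
      by (simp only: of_real_mult[symmetric] prod.distrib[symmetric])
  qed
  finally show ?thesis .
qed

end

section \<open>Moments of the approximations\<close>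

text \<open>Rounding the time down to a grid leaves countably many random variables, each
  measurable; continuity of every path permits the refinement of the grid.\<close>

lemma borel_measurable_continuous_process:
  fixes X :: "real \<Rightarrow> 'w \<Rightarrow> 'b::metric_space"
  assumes X: "\<And>s. X s \<in> borel_measurable M"
    and cont: "\<And>\<omega>. \<omega> \<in> space M \<Longrightarrow> continuous_on UNIV (\<lambda>s. X s \<omega>)"
  shows "(\<lambda>z. X (snd z) (fst z)) \<in> borel_measurable (M \<Otimes>\<^sub>M borel)"
proof (rule borel_measurable_LIMSEQ_metric)
  define t where "t n s = of_int \<lfloor>real (Suc n) * s\<rfloor> / real (Suc n)" for n and s :: real
  show "(\<lambda>z. X (t n (snd z)) (fst z)) \<in> borel_measurable (M \<Otimes>\<^sub>M borel)" for n
  proof -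
    have 1: "(\<lambda>z. X (of_int i / real (Suc n)) (fst z)) \<in> borel_measurable (M \<Otimes>\<^sub>M borel)" for i
      using measurable_compose[OF measurable_fst X] .
    have 2: "(\<lambda>z. \<lfloor>real (Suc n) * snd z\<rfloor>) \<in> measurable (M \<Otimes>\<^sub>M borel) (count_space UNIV)"
      by measurable
    show ?thesis unfolding t_def by (rule measurable_compose_countable[OF 1 2])
  qed
  fix z assume "z \<in> space (M \<Otimes>\<^sub>M (borel :: real measure))"
  then have z: "fst z \<in> space M" by (auto simp: space_pair_measure)
  have "(\<lambda>n. t n (snd z)) \<longlonglongrightarrow> snd z"
  proof (rule Lim_transform_bound[where g = "\<lambda>n. 1 / real (Suc n)", THEN LIM_zero_cancel])
    show "\<forall>\<^sub>F n in sequentially. norm (t n (snd z) - snd z) \<le> norm (1 / real (Suc n))"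
    proof (intro always_eventually allI)
      fix n
      have "t n (snd z) - snd z = (of_int \<lfloor>real (Suc n) * snd z\<rfloor> - real (Suc n) * snd z) / real (Suc n)"
        by (simp add: t_def field_simps)
      moreover have "\<bar>of_int \<lfloor>real (Suc n) * snd z\<rfloor> - real (Suc n) * snd z\<bar> \<le> 1"
        by linarith
      ultimately show "norm (t n (snd z) - snd z) \<le> norm (1 / real (Suc n))"
        by (simp add: divide_right_mono)
    qed
    show "(\<lambda>n. 1 / real (Suc n)) \<longlonglongrightarrow> 0" by (rule LIMSEQ_Suc[OF lim_1_over_n])
  qed
  then show "(\<lambda>n. X (t n (snd z)) (fst z)) \<longlonglongrightarrow> X (snd z) (fst z)"
    using continuous_on_tendsto_compose[OF cont[OF z]] by auto
qed

lemma sigma_finite_measure_PiM_lborel: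
  fixes N :: nat shows "sigma_finite_measure (PiM {..<N} (\<lambda>_. lborel :: real measure))"
proof -
  interpret product_sigma_finite "\<lambda>_::nat. lborel :: real measure" by standard
  show ?thesis by (rule sigma_finite) simp
qed

text \<open>For fixed \<epsilon> the Gaussian factor of the Fourier integrands justifies Fubini.
  Afterwards it is bounded by \<open>1\<close>, so that the right-hand side is free of
  \<epsilon>.\<close>

lemma (in prob_space) expectation_prod_gft_le:
  fixes B B' :: "real \<Rightarrow> 'a \<Rightarrow> real ^ 'd::finite" and k :: "'d \<Rightarrow> nat" and N :: nat and s r :: "nat \<Rightarrow> real"
  assumes B: "fbm M H B" and B': "fbm M H B'"
    and indep: "indep_var (path_space {0..}) (path_on {0..} B) (path_space {0..}) (path_on {0..} B')"
    and s: "\<And>j. j < N \<Longrightarrow> s j \<ge> 0" and r: "\<And>j. j < N \<Longrightarrow> r j \<ge> 0" and \<epsilon>: "\<epsilon> > 0"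
  shows "ennreal \<bar>\<integral>\<omega>. (\<Prod>j<N. \<Prod>i\<in>UNIV. Re (gft \<epsilon> (k i) (B (s j) \<omega> $ i - B' (r j) \<omega> $ i))) \<partial>M\<bar> \<le>
    (\<Prod>i\<in>UNIV. \<integral>\<^sup>+p. (\<Prod>j<N. ennreal (\<bar>p j\<bar> ^ k i)) *
        ennreal (exp (- (fbm_form H N s p + fbm_form H N r p) / 2)) \<partial>PiM {..<N} (\<lambda>_. lborel))"
proof -
  define X where "X i j \<omega> = B (s j) \<omega> $ i - B' (r j) \<omega> $ i" for i j \<omega>
  define L where "L = PiM {..<N} (\<lambda>_. lborel :: real measure)"
  define LL where "LL = PiM (UNIV :: 'd set) (\<lambda>_. L)"
  interpret L: product_sigma_finite "\<lambda>_::nat. lborel :: real measure" by standard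
  interpret sL: sigma_finite_measure L unfolding L_def by (rule sigma_finite_measure_PiM_lborel)
  interpret LL: product_sigma_finite "\<lambda>_::'d. L" by standard
  interpret sLL: sigma_finite_measure LL unfolding LL_def by (rule LL.sigma_finite) simp
  interpret P: pair_sigma_finite M LL by standard
  have Xm: "X i j \<in> borel_measurable M" if "j \<in> {..<N}" for i j
    unfolding X_def[abs_def] using fbm_1d_measurable[of H "\<lambda>t \<omega>. B t \<omega> $ i" "s j"]
      fbm_1d_measurable[of H "\<lambda>t \<omega>. B' t \<omega> $ i" "r j"] s r that B B'
    by (auto simp: fbm_def)
  have qm: "(\<lambda>q. q i j) \<in> borel_measurable LL" if "j \<in> {..<N}" for i :: 'd and j
  proof -
    have "(\<lambda>q. q i) \<in> measurable LL L" unfolding LL_def by (rule measurable_component_singleton) simp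
    moreover have "(\<lambda>p. p j) \<in> measurable L lborel" unfolding L_def by (rule measurable_component_singleton) fact
    ultimately show ?thesis using measurable_compose by fastforce
  qed
  define T where "T \<omega> q = (\<Prod>i\<in>UNIV. \<Prod>j<N. gft_integrand \<epsilon> (k i) (q i j) * iexp (q i j * X i j \<omega>))"
    for \<omega> and q :: "'d \<Rightarrow> nat \<Rightarrow> real"
  define g where "g q = (\<Prod>i\<in>UNIV. \<Prod>j<N. gft_integrand \<epsilon> (k i) (q i j))" for q :: "'d \<Rightarrow> nat \<Rightarrow> real"
  have T_eq: "T \<omega> q = g q * (\<Prod>i\<in>UNIV. \<Prod>j<N. iexp (q i j * X i j \<omega>))" for \<omega> q
    unfolding T_def g_def prod.distrib ..
  \<comment> \<open>The phases have modulus \<open>1\<close>, so the integral of the modulus over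
    \<open>q\<close> is the same for all \<omega>, which yields integrability on the product
    space.\<close>
  have norm_T: "norm (T \<omega> q) = norm (g q)" for \<omega> q
    unfolding T_eq norm_mult prod_norm[symmetric] norm_exp_i_times by simp
  have Ti_aux: "integrable L (\<lambda>p. \<Prod>j<N. gft_integrand \<epsilon> (k i) (p j) * iexp (p j * X i j \<omega>))" for i \<omega>
    unfolding L_def by (intro L.product_integrable_prod integrable_gft \<epsilon>) simp
  have Ti: "integrable LL (T \<omega>)" for \<omega>
    unfolding T_def LL_def
    by (rule LL.product_integrable_prod[where f = "\<lambda>i p. \<Prod>j<N. gft_integrand \<epsilon> (k i) (p j) * iexp (p j * X i j \<omega>)"])
      (rule finite, rule Ti_aux)
  have step1: "of_real (\<Prod>j<N. \<Prod>i\<in>UNIV. Re (gft \<epsilon> (k i) (X i j \<omega>))) = (\<integral>q. T \<omega> q \<partial>LL)" for \<omega>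
  proof -
    have "of_real (\<Prod>j<N. \<Prod>i\<in>UNIV. Re (gft \<epsilon> (k i) (X i j \<omega>))) = (\<Prod>j<N. \<Prod>i\<in>UNIV. gft \<epsilon> (k i) (X i j \<omega>))"
      by (simp only: of_real_prod of_real_Re_gft[OF \<epsilon>])
    also have "\<dots> = (\<Prod>i\<in>UNIV. \<Prod>j<N. gft \<epsilon> (k i) (X i j \<omega>))"
      by (rule prod.swap)
    also have "\<dots> = (\<Prod>i\<in>UNIV. \<integral>p. (\<Prod>j<N. gft_integrand \<epsilon> (k i) (p j) * iexp (p j * X i j \<omega>)) \<partial>L)"
      unfolding L_def gft_def
      by (intro prod.cong refl L.product_integral_prod[symmetric, where f = "\<lambda>j p. gft_integrand \<epsilon> (k _) p * iexp (p * X _ j \<omega>)"] integrable_gft \<epsilon>) simp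
    also have "\<dots> = (\<integral>q. T \<omega> q \<partial>LL)"
      unfolding LL_def T_def
      by (rule LL.product_integral_prod[symmetric, where f = "\<lambda>i p. \<Prod>j<N. gft_integrand \<epsilon> (k i) (p j) * iexp (p j * X i j \<omega>)"])
        (rule finite, rule Ti_aux)
    finally show ?thesis .
  qed
  have Tm: "case_prod T \<in> borel_measurable (M \<Otimes>\<^sub>M LL)"
  proof -
    have [measurable]: "(\<lambda>z. X i j (fst z)) \<in> borel_measurable (M \<Otimes>\<^sub>M LL)"
      "(\<lambda>z. snd z i j) \<in> borel_measurable (M \<Otimes>\<^sub>M LL)" if "j \<in> {..<N}" for i j
      using measurable_compose[OF measurable_fst Xm[OF that]] measurable_compose[OF measurable_snd qm[OF that]] by auto
    show ?thesis unfolding T_def[abs_def] split_beta by measurable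
  qed
  have Tint: "integrable (M \<Otimes>\<^sub>M LL) (case_prod T)"
    using Ti by (intro P.Fubini_integrable Tm) (auto simp: norm_T)
  have step3: "(\<integral>\<omega>. T \<omega> q \<partial>M) = g q * of_real (\<Prod>i\<in>UNIV. exp (- (fbm_form H N s (q i) + fbm_form H N r (q i)) / 2))" for q
    unfolding T_eq X_def
    by (subst indep_fbm_char[OF B B' indep s r, symmetric]) (simp_all only: integral_mult_right_zero)
  have "of_real (\<integral>\<omega>. (\<Prod>j<N. \<Prod>i\<in>UNIV. Re (gft \<epsilon> (k i) (X i j \<omega>))) \<partial>M) = (\<integral>\<omega>. \<integral>q. T \<omega> q \<partial>LL \<partial>M)"
    unfolding step1[symmetric] by (rule integral_complex_of_real[symmetric])
  also have "\<dots> = (\<integral>q. \<integral>\<omega>. T \<omega> q \<partial>M \<partial>LL)"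
    by (rule P.Fubini_integral[symmetric]) (use Tint in simp)
  finally have eq: "of_real (\<integral>\<omega>. (\<Prod>j<N. \<Prod>i\<in>UNIV. Re (gft \<epsilon> (k i) (X i j \<omega>))) \<partial>M) =
     (\<integral>q. \<integral>\<omega>. T \<omega> q \<partial>M \<partial>LL)" .
  have "integrable LL (\<lambda>q. \<integral>\<omega>. T \<omega> q \<partial>M)"
    using P.integrable_snd[OF Tint] .
  then have "ennreal (norm (\<integral>q. \<integral>\<omega>. T \<omega> q \<partial>M \<partial>LL)) \<le> (\<integral>\<^sup>+q. norm (\<integral>\<omega>. T \<omega> q \<partial>M) \<partial>LL)"
    by (rule integral_norm_bound_ennreal)
  also have "\<dots> \<le> (\<integral>\<^sup>+q. (\<Prod>i\<in>UNIV. (\<Prod>j<N. ennreal (\<bar>q i j\<bar> ^ k i)) *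
      ennreal (exp (- (fbm_form H N s (q i) + fbm_form H N r (q i)) / 2))) \<partial>LL)"
  proof (rule nn_integral_mono)
    fix q :: "'d \<Rightarrow> nat \<Rightarrow> real"
    have gl: "norm (gft_integrand \<epsilon> m p) \<le> \<bar>p\<bar> ^ m" for m p
    proof -
      have "exp (- (\<epsilon> * p\<^sup>2 / 2)) / (2 * pi) \<le> 1 / 1"
        using \<epsilon> pi_gt3 by (intro frac_le) auto
      then have "\<bar>p\<bar> ^ m * (exp (- (\<epsilon> * p\<^sup>2 / 2)) / (2 * pi)) \<le> \<bar>p\<bar> ^ m * 1"
        by (intro mult_left_mono) auto
      then show ?thesis unfolding norm_gft_integrand by (simp only: mult_1_right)
    qed
    have "norm (\<integral>\<omega>. T \<omega> q \<partial>M) = (\<Prod>i\<in>UNIV. (\<Prod>j<N. norm (gft_integrand \<epsilon> (k i) (q i j))) *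
       exp (- (fbm_form H N s (q i) + fbm_form H N r (q i)) / 2))"
      unfolding step3 norm_mult g_def prod_norm[symmetric] prod.distrib norm_of_real
      by (simp add: abs_prod)
    also have "\<dots> \<le> (\<Prod>i\<in>UNIV. (\<Prod>j<N. \<bar>q i j\<bar> ^ k i) * exp (- (fbm_form H N s (q i) + fbm_form H N r (q i)) / 2))"
      by (intro prod_mono conjI mult_right_mono mult_nonneg_nonneg prod_nonneg gl) auto
    finally show "ennreal (norm (\<integral>\<omega>. T \<omega> q \<partial>M)) \<le> (\<Prod>i\<in>UNIV. (\<Prod>j<N. ennreal (\<bar>q i j\<bar> ^ k i)) *
      ennreal (exp (- (fbm_form H N s (q i) + fbm_form H N r (q i)) / 2)))"
      by (simp add: prod_ennreal ennreal_mult[symmetric] prod_nonneg ennreal_leI)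
  qed
  also have "\<dots> = (\<Prod>i\<in>UNIV. \<integral>\<^sup>+p. (\<Prod>j<N. ennreal (\<bar>p j\<bar> ^ k i)) *
        ennreal (exp (- (fbm_form H N s p + fbm_form H N r p) / 2)) \<partial>L)"
    unfolding LL_def
    by (rule LL.product_nn_integral_prod[where f = "\<lambda>i p. (\<Prod>j<N. ennreal (\<bar>p j\<bar> ^ k i)) *
        ennreal (exp (- (fbm_form H N s p + fbm_form H N r p) / 2))"]) (simp_all add: L_def)
  finally show ?thesis
    unfolding eq[symmetric] norm_of_real L_def X_def .
qed

section \<open>Powers of a double time integral\<close>

declare unit_meas_measurable_id [measurable]

lemma prob_space_PiM_unit_meas: "prob_space (PiM I (\<lambda>_. unit_meas))"
  by (intro prob_space_PiM prob_space_unit_meas)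

text \<open>The double integral of \<open>approx_ilt_deriv\<close>, over a probability space and for
  arbitrary processes. This allows \<open>B\<close> and \<open>B'\<close> to be replaced by versions
  all of whose paths are continuous.\<close>

definition double_int ::
    "(real \<Rightarrow> 'a \<Rightarrow> 'b::minus) \<Rightarrow> (real \<Rightarrow> 'a \<Rightarrow> 'b) \<Rightarrow> ('b \<Rightarrow> real) \<Rightarrow> 'a \<Rightarrow> real" where
  "double_int Z Z' \<phi> \<omega> = (\<integral>s. \<integral>r. \<phi> (Z s \<omega> - Z' r \<omega>) \<partial>unit_meas \<partial>unit_meas)"

context prob_space
begin

context
  fixes Z Z' :: "real \<Rightarrow> 'a \<Rightarrow> 'b::euclidean_space" and \<phi> :: "'b \<Rightarrow> real" and C :: real
  assumes Z: "\<And>s. Z s \<in> borel_measurable M" "\<And>\<omega>. \<omega> \<in> space M \<Longrightarrow> continuous_on UNIV (\<lambda>s. Z s \<omega>)"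
    and Z': "\<And>s. Z' s \<in> borel_measurable M" "\<And>\<omega>. \<omega> \<in> space M \<Longrightarrow> continuous_on UNIV (\<lambda>s. Z' s \<omega>)"
    and \<phi> [measurable]: "\<phi> \<in> borel_measurable borel" and bound: "\<And>x. \<bar>\<phi> x\<bar> \<le> C"
begin

lemma borel_measurable_process_compose:
  assumes f: "f \<in> measurable N M" and g: "g \<in> borel_measurable N"
  shows "(\<lambda>z. Z (g z) (f z)) \<in> borel_measurable N" "(\<lambda>z. Z' (g z) (f z)) \<in> borel_measurable N"
  using measurable_compose[OF measurable_Pair[OF f g] borel_measurable_continuous_process[OF Z]]
    measurable_compose[OF measurable_Pair[OF f g] borel_measurable_continuous_process[OF Z']]
  by (simp_all)

lemma double_int_measurable: "double_int Z Z' \<phi> \<in> borel_measurable M"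
proof -
  interpret U: prob_space unit_meas by (rule prob_space_unit_meas)
  have *: "(\<lambda>z. Z (snd (fst z)) (fst (fst z))) \<in> borel_measurable ((M \<Otimes>\<^sub>M unit_meas) \<Otimes>\<^sub>M unit_meas)"
    "(\<lambda>z. Z' (snd z) (fst (fst z))) \<in> borel_measurable ((M \<Otimes>\<^sub>M unit_meas) \<Otimes>\<^sub>M unit_meas)"
    by (intro borel_measurable_process_compose; measurable)+
  have "(\<lambda>z. \<phi> (Z (snd (fst z)) (fst (fst z)) - Z' (snd z) (fst (fst z)))) \<in>
      borel_measurable ((M \<Otimes>\<^sub>M unit_meas) \<Otimes>\<^sub>M unit_meas)"
    using * by measurable
  then have "(\<lambda>y. \<integral>r. \<phi> (Z (snd y) (fst y) - Z' r (fst y)) \<partial>unit_meas) \<in> borel_measurable (M \<Otimes>\<^sub>M unit_meas)"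
    by (intro U.borel_measurable_lebesgue_integral) (simp add: split_beta)
  then have "(\<lambda>\<omega>. \<integral>s. \<integral>r. \<phi> (Z s \<omega> - Z' r \<omega>) \<partial>unit_meas \<partial>unit_meas) \<in> borel_measurable M"
    by (intro U.borel_measurable_lebesgue_integral) (simp add: split_beta)
  then show ?thesis unfolding double_int_def[abs_def] .
qed

text \<open>A power of a double integral is an integral over \<open>N\<close> copies of each time
  variable, and boundedness of \<phi> justifies the exchange with the expectation. As
  \<open>C\<close> is absent from the estimate, it may depend on \<epsilon>.\<close>

lemma expectation_double_int_power_le:
  fixes N :: nat
  defines "U \<equiv> PiM {..<N} (\<lambda>_. unit_meas)"
  shows "integrable M (\<lambda>\<omega>. double_int Z Z' \<phi> \<omega> ^ N)"
    and "ennreal \<bar>\<integral>\<omega>. double_int Z Z' \<phi> \<omega> ^ N \<partial>M\<bar> \<le>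
      (\<integral>\<^sup>+s. \<integral>\<^sup>+r. ennreal \<bar>\<integral>\<omega>. (\<Prod>j<N. \<phi> (Z (s j) \<omega> - Z' (r j) \<omega>)) \<partial>M\<bar> \<partial>U \<partial>U)"
proof -
  interpret V: prob_space unit_meas by (rule prob_space_unit_meas)
  interpret PV: product_prob_space "\<lambda>_::nat. unit_meas" by standard
  interpret U: prob_space U unfolding U_def by (rule prob_space_PiM_unit_meas)
  interpret UU: pair_prob_space U U by standard
  interpret MR: pair_prob_space M "U \<Otimes>\<^sub>M U" by standard
  interpret VV: pair_prob_space unit_meas unit_meas by standard
  have C0: "C \<ge> 0" using bound[of 0] by linarith
  define F where "F \<omega> z = (\<Prod>j<N. \<phi> (Z (fst z j) \<omega> - Z' (snd z j) \<omega>))" for \<omega> and z :: "(nat \<Rightarrow> real) \<times> (nat \<Rightarrow> real)"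
  have Fb: "\<bar>F \<omega> z\<bar> \<le> C ^ N" for \<omega> z
  proof -
    have "\<bar>F \<omega> z\<bar> \<le> (\<Prod>j<N. C)"
      unfolding F_def abs_prod using bound by (intro prod_mono) auto
    then show ?thesis by simp
  qed
  have comp: "(\<lambda>s. s j) \<in> borel_measurable U" if "j \<in> {..<N}" for j
    unfolding U_def by (rule PiM_unit_meas_component[OF that])
  have Fm: "case_prod F \<in> borel_measurable (M \<Otimes>\<^sub>M (U \<Otimes>\<^sub>M U))"
  proof -
    have 1: "(\<lambda>z. fst (snd z) j) \<in> borel_measurable (M \<Otimes>\<^sub>M (U \<Otimes>\<^sub>M U))"
      "(\<lambda>z. snd (snd z) j) \<in> borel_measurable (M \<Otimes>\<^sub>M (U \<Otimes>\<^sub>M U))" if "j \<in> {..<N}" for j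
      using measurable_compose[OF measurable_compose[OF measurable_snd measurable_fst] comp[OF that]]
        measurable_compose[OF measurable_compose[OF measurable_snd measurable_snd] comp[OF that]] by auto
    have [measurable]: "(\<lambda>z. Z (fst (snd z) j) (fst z)) \<in> borel_measurable (M \<Otimes>\<^sub>M (U \<Otimes>\<^sub>M U))"
      "(\<lambda>z. Z' (snd (snd z) j) (fst z)) \<in> borel_measurable (M \<Otimes>\<^sub>M (U \<Otimes>\<^sub>M U))" if "j \<in> {..<N}" for j
      by (intro borel_measurable_process_compose measurable_fst 1 that)+
    show ?thesis unfolding F_def split_beta by measurable
  qed
  have Fint: "integrable (M \<Otimes>\<^sub>M (U \<Otimes>\<^sub>M U)) (case_prod F)"
    by (rule MR.P.integrable_const_bound[where B = "C ^ N", OF _ Fm]) (simp add: split_beta Fb)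
  have pow: "double_int Z Z' \<phi> \<omega> ^ N = (\<integral>z. F \<omega> z \<partial>(U \<Otimes>\<^sub>M U))" if \<omega>: "\<omega> \<in> space M" for \<omega>
  proof -
    have Fw: "F \<omega> \<in> borel_measurable (U \<Otimes>\<^sub>M U)"
      using measurable_compose[OF measurable_Pair1'[OF \<omega>] Fm] by simp
    have Fi: "integrable (U \<Otimes>\<^sub>M U) (F \<omega>)"
      by (rule UU.P.integrable_const_bound[where B = "C ^ N", OF _ Fw]) (simp add: Fb)
    define h where "h s r = \<phi> (Z s \<omega> - Z' r \<omega>)" for s r
    have "(\<lambda>z. Z (fst z) \<omega>) \<in> borel_measurable (unit_meas \<Otimes>\<^sub>M unit_meas)"
      "(\<lambda>z. Z' (snd z) \<omega>) \<in> borel_measurable (unit_meas \<Otimes>\<^sub>M unit_meas)"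
      using \<omega> by (intro borel_measurable_process_compose; measurable)+
    then have hm: "(\<lambda>z. h (fst z) (snd z)) \<in> borel_measurable (unit_meas \<Otimes>\<^sub>M unit_meas)"
      unfolding h_def by measurable
    have hb: "\<bar>h s r\<bar> \<le> C" for s r by (simp add: h_def bound)
    have hi: "integrable (unit_meas \<Otimes>\<^sub>M unit_meas) (\<lambda>z. h (fst z) (snd z))"
      by (rule VV.P.integrable_const_bound[where B = C, OF _ hm]) (simp add: hb)
    have h1: "integrable unit_meas (h s)" for s
    proof (rule V.integrable_const_bound[where B = C])
      have "(\<lambda>r. Z' r \<omega>) \<in> borel_measurable unit_meas"
        using \<omega> by (intro borel_measurable_process_compose) auto
      then show "h s \<in> borel_measurable unit_meas" unfolding h_def[abs_def] by measurable
    qed (simp add: hb)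
    have h2: "integrable unit_meas (\<lambda>s. \<integral>r. h s r \<partial>unit_meas)"
      using VV.integrable_fst'[OF hi] by simp
    have "double_int Z Z' \<phi> \<omega> ^ N = (\<Prod>j<N. \<integral>s. \<integral>r. h s r \<partial>unit_meas \<partial>unit_meas)"
      by (simp add: double_int_def h_def)
    also have "\<dots> = (\<integral>s. (\<Prod>j<N. \<integral>r. h (s j) r \<partial>unit_meas) \<partial>U)"
      unfolding U_def by (rule PV.product_integral_prod[symmetric]) (simp, rule h2)
    also have "\<dots> = (\<integral>s. \<integral>r. (\<Prod>j<N. h (s j) (r j)) \<partial>U \<partial>U)"
      unfolding U_def
      by (intro Bochner_Integration.integral_cong refl PV.product_integral_prod[symmetric, where f = "\<lambda>j. h (_ j)"]) (simp, rule h1)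
    also have "\<dots> = (\<integral>s. \<integral>r. F \<omega> (s, r) \<partial>U \<partial>U)"
      by (simp add: F_def h_def)
    also have "\<dots> = (\<integral>z. F \<omega> z \<partial>(U \<Otimes>\<^sub>M U))"
      by (rule UU.integral_fst'[OF Fi])
    finally show ?thesis .
  qed
  have dib: "\<bar>double_int Z Z' \<phi> \<omega>\<bar> \<le> C" for \<omega>
  proof -
    have 1: "\<bar>\<integral>x. f x \<partial>unit_meas\<bar> \<le> C" if "\<And>x. \<bar>f x\<bar> \<le> C" for f :: "real \<Rightarrow> real"
    proof -
      have "\<bar>\<integral>x. f x \<partial>unit_meas\<bar> \<le> (\<integral>x. \<bar>f x\<bar> \<partial>unit_meas)" by (rule integral_abs_bound)
      also have "\<dots> \<le> (\<integral>x. C \<partial>unit_meas)"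
        using that C0 by (intro integral_mono') auto
      also have "\<dots> = C" using V.prob_space by simp
      finally show ?thesis .
    qed
    show ?thesis unfolding double_int_def by (intro 1 bound)
  qed
  show "integrable M (\<lambda>\<omega>. double_int Z Z' \<phi> \<omega> ^ N)"
  proof (rule integrable_const_bound[where B = "C ^ N"])
    show "AE \<omega> in M. norm (double_int Z Z' \<phi> \<omega> ^ N) \<le> C ^ N"
      using dib by (simp add: power_abs power_mono)
    show "(\<lambda>\<omega>. double_int Z Z' \<phi> \<omega> ^ N) \<in> borel_measurable M"
      using double_int_measurable by measurable
  qed
  have "(\<integral>\<omega>. double_int Z Z' \<phi> \<omega> ^ N \<partial>M) = (\<integral>\<omega>. \<integral>z. F \<omega> z \<partial>(U \<Otimes>\<^sub>M U) \<partial>M)"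
    by (intro Bochner_Integration.integral_cong refl pow)
  also have "\<dots> = (\<integral>z. \<integral>\<omega>. F \<omega> z \<partial>M \<partial>(U \<Otimes>\<^sub>M U))"
    by (rule MR.Fubini_integral[symmetric]) (use Fint in simp)
  also have "ennreal \<bar>\<dots>\<bar> \<le> (\<integral>\<^sup>+z. ennreal \<bar>\<integral>\<omega>. F \<omega> z \<partial>M\<bar> \<partial>(U \<Otimes>\<^sub>M U))"
    using integral_norm_bound_ennreal[OF MR.integrable_snd[OF Fint]] by simp
  also have "\<dots> = (\<integral>\<^sup>+s. \<integral>\<^sup>+r. ennreal \<bar>\<integral>\<omega>. F \<omega> (s, r) \<partial>M\<bar> \<partial>U \<partial>U)"
  proof (rule U.nn_integral_fst[symmetric])
    have "(\<lambda>z. \<integral>\<omega>. F \<omega> z \<partial>M) \<in> borel_measurable (U \<Otimes>\<^sub>M U)"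
      using MR.integrable_snd[OF Fint] by simp
    then show "(\<lambda>z. ennreal \<bar>\<integral>\<omega>. F \<omega> z \<partial>M\<bar>) \<in> borel_measurable (U \<Otimes>\<^sub>M U)" by measurable
  qed
  finally show "ennreal \<bar>\<integral>\<omega>. double_int Z Z' \<phi> \<omega> ^ N \<partial>M\<bar> \<le>
      (\<integral>\<^sup>+s. \<integral>\<^sup>+r. ennreal \<bar>\<integral>\<omega>. (\<Prod>j<N. \<phi> (Z (s j) \<omega> - Z' (r j) \<omega>)) \<partial>M\<bar> \<partial>U \<partial>U)"
    by (simp add: F_def)
qed

end

end

section \<open>Exponential integrability from moments\<close>

text \<open>By \<open>n! >= (n / e) ^ n\<close> the logarithm of the term is at most
  \<open>- (1 - \<beta> * \<gamma>) * n * ln n\<close> plus \<open>O(n)\<close>, so a geometric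
  series dominates eventually. The \<open>3\<close> leaves room for replacing
  \<open>\<beta> * n\<close> by an even integer.\<close>

lemma summable_power_over_fact:
  fixes \<beta> \<gamma> D :: real
  assumes \<beta>: "\<beta> \<ge> 0" and \<gamma>: "\<gamma> > 0" and \<beta>\<gamma>: "\<beta> * \<gamma> < 1" and D: "D \<ge> 1"
  shows "summable (\<lambda>n. (D * (\<beta> * real n + 3) powr \<gamma>) powr (\<beta> * real n + 3) / fact n)"
proof -
  define \<theta> where "\<theta> = 1 - \<beta> * \<gamma>"
  have \<theta>: "\<theta> > 0" using \<beta>\<gamma> by (simp add: \<theta>_def)
  \<comment> \<open>From \<open>\<beta> * n + 3 <= (\<beta> + 3) * n\<close>. In the exponent
    divided by \<open>n\<close>, \<open>c1\<close> and \<open>c2 / n\<close> collect the terms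
    without \<open>ln n\<close>.\<close>
  define c where "c = ln D + \<gamma> * ln (\<beta> + 3)"
  define c1 where "c1 = \<beta> * c + 1"
  define c2 where "c2 = 3 * c"
  have "filterlim (\<lambda>x::real. - \<theta> * ln x + 3 * \<gamma> * ln x / x + c1 + c2 / x) at_bot at_top"
    using \<theta> by real_asymp
  then have "eventually (\<lambda>x::real. - \<theta> * ln x + 3 * \<gamma> * ln x / x + c1 + c2 / x \<le> -1) at_top"
    by (simp add: filterlim_at_bot)
  then have ev: "eventually (\<lambda>n::nat. - \<theta> * ln n + 3 * \<gamma> * ln n / n + c1 + c2 / n \<le> -1) sequentially"
    using eventually_compose_filterlim[OF _ filterlim_real_sequentially] by blast
  show ?thesis
  proof (rule summable_comparison_test_ev)
    show "summable (\<lambda>n. exp (-1 :: real) ^ n)" by (intro summable_geometric) simp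
    show "eventually (\<lambda>n. norm ((D * (\<beta> * real n + 3) powr \<gamma>) powr (\<beta> * real n + 3) / fact n) \<le> exp (-1 :: real) ^ n) sequentially"
      using ev eventually_gt_at_top[of 0]
    proof eventually_elim
      case (elim n)
      define y where "y = \<beta> * real n + 3"
      have y: "y \<ge> 3" using \<beta> by (simp add: y_def)
      have n1: "real n \<ge> 1" using elim by simp
      have "y \<le> (\<beta> + 3) * n" using n1 by (simp add: y_def algebra_simps)
      then have "ln y \<le> ln ((\<beta> + 3) * n)" using y \<beta> n1 by (subst ln_le_cancel_iff) auto
      also have "\<dots> = ln (\<beta> + 3) + ln n" using \<beta> n1 by (subst ln_mult) auto
      finally have lny: "ln y \<le> ln (\<beta> + 3) + ln n" .
      have "real n ^ n / fact n \<le> exp n"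
      proof -
        have "inverse (fact n) * real n ^ n \<le> (\<Sum>k. inverse (fact k) * real n ^ k)"
          using sum_le_suminf[OF summable_exp[of "real n"], of "{n}"] by auto
        then show ?thesis by (simp add: exp_def field_simps)
      qed
      then have "1 / fact n \<le> exp n / real n ^ n" using n1 by (simp add: field_simps)
      also have "real n ^ n = exp (n * ln n)"
        using n1 by (simp add: exp_of_nat_mult)
      finally have f: "1 / fact n \<le> exp (n - n * ln n)" by (simp add: exp_diff)
      have "(D * y powr \<gamma>) powr y = exp (y * (ln D + \<gamma> * ln y))"
        using D y by (simp add: powr_def ln_mult exp_add[symmetric])
      also have "\<dots> \<le> exp (y * (c + \<gamma> * ln n))"
      proof -
        have "\<gamma> * ln y \<le> \<gamma> * (ln (\<beta> + 3) + ln n)" using lny \<gamma> by (intro mult_left_mono) auto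
        then have "ln D + \<gamma> * ln y \<le> c + \<gamma> * ln n" by (simp add: c_def algebra_simps)
        then show ?thesis using y by (intro exp_le_cancel_iff[THEN iffD2] mult_left_mono) auto
      qed
      finally have g: "(D * y powr \<gamma>) powr y \<le> exp (y * (c + \<gamma> * ln n))" .
      have "(D * y powr \<gamma>) powr y * (1 / fact n) \<le> exp (y * (c + \<gamma> * ln n)) * exp (n - n * ln n)"
        by (intro mult_mono f g) auto
      also have "\<dots> = exp (y * (c + \<gamma> * ln n) + (n - n * ln n))" by (rule exp_add[symmetric])
      also have "y * (c + \<gamma> * ln n) + (n - n * ln n) = n * (- \<theta> * ln n + 3 * \<gamma> * ln n / n + c1 + c2 / n)"
        using n1 by (simp add: y_def \<theta>_def c1_def c2_def field_simps)
      also have "exp \<dots> \<le> exp (real n * (-1))"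
        using mult_left_mono[OF elim(1), of "real n"] by simp
      also have "\<dots> = exp (-1) ^ n" by (rule exp_of_nat_mult)
      finally show ?case by (simp add: y_def)
    qed
  qed
qed

text \<open>In the exponential series, \<open>|\<alpha>| powr (\<beta> * n)\<close> is dominated by
  \<open>1 + |\<alpha>| ^ N\<close> with an even \<open>N\<close> slightly above
  \<open>\<beta> * n\<close>, since only even moments are controlled.\<close>

lemma integrable_exp_powr_of_moments:
  fixes \<alpha> :: "'w \<Rightarrow> real"
  assumes "prob_space M" and [measurable]: "\<alpha> \<in> borel_measurable M"
    and \<beta>: "\<beta> \<ge> 0" and \<gamma>: "\<gamma> > 0" and \<beta>\<gamma>: "\<beta> * \<gamma> < 1" and D: "D > 0"
    and mom: "\<And>N. even N \<Longrightarrow> N > 0 \<Longrightarrow> (\<integral>\<^sup>+\<omega>. ennreal (\<bar>\<alpha> \<omega>\<bar> ^ N) \<partial>M) \<le> ennreal ((D * real N powr \<gamma>) ^ N)"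
  shows "integrable M (\<lambda>\<omega>. exp (\<bar>\<alpha> \<omega>\<bar> powr \<beta>))"
proof -
  interpret prob_space M by fact
  \<comment> \<open>At least \<open>1\<close>, so that raising the exponent from \<open>N\<close> to
    \<open>\<beta> * n + 3\<close> does not decrease the power.\<close>
  define D' where "D' = max D 1"
  define u where "u n = (D' * (\<beta> * real n + 3) powr \<gamma>) powr (\<beta> * real n + 3) / fact n" for n
  have u0: "u n \<ge> 0" for n by (simp add: u_def)
  have su: "summable u" unfolding u_def using assms by (intro summable_power_over_fact) (auto simp: D'_def)
  have se: "summable (\<lambda>n. 1 / fact n :: real)"
    using summable_exp[of "1::real"] by (simp add: inverse_eq_divide)
  have term_le: "(\<integral>\<^sup>+\<omega>. ennreal ((\<bar>\<alpha> \<omega>\<bar> powr \<beta>) ^ n / fact n) \<partial>M) \<le> ennreal (1 / fact n + u n)" for n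
  proof -
    define m where "m = nat \<lceil>\<beta> * real n\<rceil>"
    \<comment> \<open>The least even number strictly above \<open>m\<close>: positive also for
      \<open>m = 0\<close>, and at most \<open>m + 2 <= \<beta> * n + 3\<close>.\<close>
    define N where "N = 2 * (m div 2 + 1)"
    have N: "even N" "N > 0" by (auto simp: N_def)
    have m: "\<beta> * n \<le> m" "m \<le> \<beta> * n + 1" unfolding m_def using \<beta> by (auto simp: of_nat_nat)
    have "m \<le> N" "N \<le> m + 2" by (auto simp: N_def)
    with m have Nb: "\<beta> * n \<le> N" "N \<le> \<beta> * n + 3" by linarith+
    have pt: "(x powr \<beta>) ^ n \<le> 1 + x ^ N" if "x \<ge> 0" for x :: real
    proof (cases "x \<le> 1")
      case True
      then have "x powr \<beta> \<le> 1" using \<beta> that True by (intro powr_le1) auto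
      then have "(x powr \<beta>) ^ n \<le> 1" by (intro power_le_one) auto
      then show ?thesis using that by (simp add: add_increasing2)
    next
      case False
      then have "(x powr \<beta>) ^ n = x powr (\<beta> * n)" by (simp add: powr_powr flip: powr_realpow)
      also have "\<dots> \<le> x powr N" using False Nb by (intro powr_mono) auto
      also have "\<dots> = x ^ N" using False by (simp add: powr_realpow)
      finally show ?thesis by simp
    qed
    have "(D * real N powr \<gamma>) ^ N \<le> (D' * (\<beta> * n + 3) powr \<gamma>) ^ N"
      using D \<gamma> Nb by (intro power_mono mult_mono powr_mono2) (auto simp: D'_def)
    also have "\<dots> = (D' * (\<beta> * n + 3) powr \<gamma>) powr N"
    proof -
      have "D' * (\<beta> * n + 3) powr \<gamma> > 0" 
      proof (rule mult_pos_pos)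
        have "\<beta> * n + 3 > 0" using \<beta> by (intro add_nonneg_pos) auto
        then show "(\<beta> * n + 3) powr \<gamma> > 0" by simp
      qed (simp add: D'_def less_max_iff_disj)
      then show ?thesis by (simp add: powr_realpow)
    qed
    also have "\<dots> \<le> (D' * (\<beta> * n + 3) powr \<gamma>) powr (\<beta> * n + 3)"
    proof (intro powr_mono Nb)
      have "1 * 1 \<le> D' * (\<beta> * n + 3) powr \<gamma>"
        using \<beta> \<gamma> by (intro mult_mono ge_one_powr_ge_zero) (auto simp: D'_def add_increasing)
      then show "1 \<le> D' * (\<beta> * n + 3) powr \<gamma>" by simp
    qed
    finally have Db: "(D * real N powr \<gamma>) ^ N \<le> (D' * (\<beta> * n + 3) powr \<gamma>) powr (\<beta> * n + 3)" .
    have "(\<integral>\<^sup>+\<omega>. ennreal ((\<bar>\<alpha> \<omega>\<bar> powr \<beta>) ^ n / fact n) \<partial>M) \<le> (\<integral>\<^sup>+\<omega>. ennreal (1 / fact n) * (1 + ennreal (\<bar>\<alpha> \<omega>\<bar> ^ N)) \<partial>M)"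
    proof (rule nn_integral_mono)
      fix \<omega>
      have "(\<bar>\<alpha> \<omega>\<bar> powr \<beta>) ^ n / fact n \<le> 1 / fact n * (1 + \<bar>\<alpha> \<omega>\<bar> ^ N)"
        using pt[of "\<bar>\<alpha> \<omega>\<bar>"] by (simp add: divide_right_mono)
      then have "ennreal ((\<bar>\<alpha> \<omega>\<bar> powr \<beta>) ^ n / fact n) \<le> ennreal (1 / fact n * (1 + \<bar>\<alpha> \<omega>\<bar> ^ N))"
        by (rule ennreal_leI)
      also have "\<dots> = ennreal (1 / fact n) * (1 + ennreal (\<bar>\<alpha> \<omega>\<bar> ^ N))"
        by (subst ennreal_mult) (auto simp: ennreal_plus)
      finally show "ennreal ((\<bar>\<alpha> \<omega>\<bar> powr \<beta>) ^ n / fact n) \<le> ennreal (1 / fact n) * (1 + ennreal (\<bar>\<alpha> \<omega>\<bar> ^ N))" .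
    qed
    also have "\<dots> = ennreal (1 / fact n) * (1 + (\<integral>\<^sup>+\<omega>. ennreal (\<bar>\<alpha> \<omega>\<bar> ^ N) \<partial>M))"
      by (subst nn_integral_cmult, measurable, subst nn_integral_add) (auto simp: emeasure_space_1)
    also have "\<dots> \<le> ennreal (1 / fact n) * (1 + ennreal ((D' * (\<beta> * n + 3) powr \<gamma>) powr (\<beta> * n + 3)))"
      using order_trans[OF mom[OF N] ennreal_leI[OF Db]] by (intro mult_left_mono add_left_mono) auto
    also have "\<dots> = ennreal (1 / fact n * (1 + (D' * (\<beta> * n + 3) powr \<gamma>) powr (\<beta> * n + 3)))"
      by (subst ennreal_mult) (auto simp: ennreal_plus)
    also have "1 / fact n * (1 + (D' * (\<beta> * n + 3) powr \<gamma>) powr (\<beta> * n + 3)) = 1 / fact n + u n"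
      by (simp add: u_def add_divide_distrib)
    finally show ?thesis .
  qed
  have "(\<integral>\<^sup>+\<omega>. ennreal (exp (\<bar>\<alpha> \<omega>\<bar> powr \<beta>)) \<partial>M) = (\<integral>\<^sup>+\<omega>. (\<Sum>n. ennreal ((\<bar>\<alpha> \<omega>\<bar> powr \<beta>) ^ n / fact n)) \<partial>M)"
  proof (intro nn_integral_cong suminf_ennreal_eq[symmetric])
    fix \<omega>
    show "(\<lambda>n. (\<bar>\<alpha> \<omega>\<bar> powr \<beta>) ^ n / fact n) sums exp (\<bar>\<alpha> \<omega>\<bar> powr \<beta>)"
      using exp_converges[of "\<bar>\<alpha> \<omega>\<bar> powr \<beta>"] by (simp add: divide_inverse mult.commute)
  qed simp
  also have "\<dots> = (\<Sum>n. \<integral>\<^sup>+\<omega>. ennreal ((\<bar>\<alpha> \<omega>\<bar> powr \<beta>) ^ n / fact n) \<partial>M)"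
    by (intro nn_integral_suminf) measurable
  also have "\<dots> \<le> (\<Sum>n. ennreal (1 / fact n + u n))"
    by (intro suminf_le term_le) auto
  also have "\<dots> = ennreal (\<Sum>n. 1 / fact n + u n)"
    using summable_add[OF se su] u0 by (intro suminf_ennreal2) auto
  also have "\<dots> < \<infinity>" by simp
  finally show ?thesis by (intro integrableI_bounded) auto
qed

section \<open>From the approximations to their limit\<close>

text \<open>Rests on \<open>|\<alpha>| <= 2 * max |Y| |Y - \<alpha>|\<close>. The loss
  \<open>2 ^ N\<close> merges into the constant under the \<open>N\<close>-th power.\<close>

lemma nn_integral_power_le_of_limit:
  fixes \<alpha> :: "'w \<Rightarrow> real" and Y :: "real \<Rightarrow> 'w \<Rightarrow> real"
  assumes [measurable]: "\<alpha> \<in> borel_measurable M" and Y: "\<And>\<epsilon>. \<epsilon> > 0 \<Longrightarrow> Y \<epsilon> \<in> borel_measurable M"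
    and lim: "((\<lambda>\<epsilon>. \<integral>\<^sup>+\<omega>. ennreal (\<bar>Y \<epsilon> \<omega> - \<alpha> \<omega>\<bar> ^ N) \<partial>M) \<longlongrightarrow> 0) (at_right 0)"
    and le: "\<And>\<epsilon>. \<epsilon> > 0 \<Longrightarrow> (\<integral>\<^sup>+\<omega>. ennreal (\<bar>Y \<epsilon> \<omega>\<bar> ^ N) \<partial>M) \<le> ennreal K" and K: "K \<ge> 0"
  shows "(\<integral>\<^sup>+\<omega>. ennreal (\<bar>\<alpha> \<omega>\<bar> ^ N) \<partial>M) \<le> ennreal (2 ^ N * K)"
proof -
  have "((\<lambda>\<epsilon>. ennreal (2 ^ N) * (ennreal K + (\<integral>\<^sup>+\<omega>. ennreal (\<bar>Y \<epsilon> \<omega> - \<alpha> \<omega>\<bar> ^ N) \<partial>M))) \<longlongrightarrow> ennreal (2 ^ N) * (ennreal K + 0)) (at_right 0)"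
    by (intro ennreal_tendsto_cmult tendsto_add tendsto_const lim) simp
  then have "(\<integral>\<^sup>+\<omega>. ennreal (\<bar>\<alpha> \<omega>\<bar> ^ N) \<partial>M) \<le> ennreal (2 ^ N) * (ennreal K + 0)"
  proof (rule tendsto_lowerbound)
    show "eventually (\<lambda>\<epsilon>. (\<integral>\<^sup>+\<omega>. ennreal (\<bar>\<alpha> \<omega>\<bar> ^ N) \<partial>M) \<le> ennreal (2 ^ N) * (ennreal K + (\<integral>\<^sup>+\<omega>. ennreal (\<bar>Y \<epsilon> \<omega> - \<alpha> \<omega>\<bar> ^ N) \<partial>M))) (at_right 0)"
      using eventually_at_right_less[of "0::real"]
    proof eventually_elim
      case (elim \<epsilon>)
      note [measurable] = Y[OF elim]
      have "(\<integral>\<^sup>+\<omega>. ennreal (\<bar>\<alpha> \<omega>\<bar> ^ N) \<partial>M) \<le> (\<integral>\<^sup>+\<omega>. ennreal (2 ^ N) * (ennreal (\<bar>Y \<epsilon> \<omega>\<bar> ^ N) + ennreal (\<bar>Y \<epsilon> \<omega> - \<alpha> \<omega>\<bar> ^ N)) \<partial>M)"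
      proof (rule nn_integral_mono)
        fix \<omega>
        define a where "a = \<bar>Y \<epsilon> \<omega>\<bar>"
        define b where "b = \<bar>Y \<epsilon> \<omega> - \<alpha> \<omega>\<bar>"
        have ab: "a \<ge> 0" "b \<ge> 0" by (auto simp: a_def b_def)
        have "\<bar>\<alpha> \<omega>\<bar> \<le> 2 * max a b" proof -
          have "\<bar>\<alpha> \<omega>\<bar> \<le> a + b" unfolding a_def b_def by linarith
          moreover have "a \<le> max a b" "b \<le> max a b" by simp_all
          ultimately show ?thesis by linarith
        qed
        then have "\<bar>\<alpha> \<omega>\<bar> ^ N \<le> (2 * max a b) ^ N" by (intro power_mono) auto
        also have "\<dots> = 2 ^ N * max a b ^ N" by (rule power_mult_distrib)
        also have "\<dots> \<le> 2 ^ N * (a ^ N + b ^ N)"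
          using ab by (intro mult_left_mono) (auto simp: max_def)
        finally have "ennreal (\<bar>\<alpha> \<omega>\<bar> ^ N) \<le> ennreal (2 ^ N * (a ^ N + b ^ N))" by (rule ennreal_leI)
        also have "\<dots> = ennreal (2 ^ N) * (ennreal (a ^ N) + ennreal (b ^ N))"
          using ab by (subst ennreal_mult) (auto simp: ennreal_plus)
        finally show "ennreal (\<bar>\<alpha> \<omega>\<bar> ^ N) \<le> ennreal (2 ^ N) * (ennreal (\<bar>Y \<epsilon> \<omega>\<bar> ^ N) + ennreal (\<bar>Y \<epsilon> \<omega> - \<alpha> \<omega>\<bar> ^ N))"
          by (simp add: a_def b_def)
      qed
      also have "\<dots> = ennreal (2 ^ N) * ((\<integral>\<^sup>+\<omega>. ennreal (\<bar>Y \<epsilon> \<omega>\<bar> ^ N) \<partial>M) + (\<integral>\<^sup>+\<omega>. ennreal (\<bar>Y \<epsilon> \<omega> - \<alpha> \<omega>\<bar> ^ N) \<partial>M))"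
        by (subst nn_integral_cmult, measurable, subst nn_integral_add) auto
      also have "\<dots> \<le> ennreal (2 ^ N) * (ennreal K + (\<integral>\<^sup>+\<omega>. ennreal (\<bar>Y \<epsilon> \<omega> - \<alpha> \<omega>\<bar> ^ N) \<partial>M))"
        by (intro mult_left_mono add_right_mono le elim) auto
      finally show ?case .
    qed
  qed simp
  then show ?thesis using K by (simp add: ennreal_mult)
qed

text \<open>\<open>D\<close> is fixed before \<epsilon>, which is what the passage to the limit
  requires. \<open>Y\<close> is a measurable version of an approximation that itself need not be
  measurable.\<close>

lemma (in prob_space) approx_ilt_deriv_moments:
  fixes B B' :: "real \<Rightarrow> 'a \<Rightarrow> real ^ 'd::{finite,linorder}" and k :: "nat ^ 'd::{finite,linorder}" and H :: real
  assumes H: "0 < H" "H < 1" and B: "fbm M H B" and B': "fbm M H B'"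
    and indep: "indep_var (path_space {0..}) (path_on {0..} B) (path_space {0..}) (path_on {0..} B')"
    and small: "2 * real (multi_order k) * H + H * real CARD('d) < 2"
  obtains D where "D > 0" "\<And>\<epsilon>. \<epsilon> > 0 \<Longrightarrow> \<exists>Y\<in>borel_measurable M. (AE \<omega> in M. approx_ilt_deriv k B B' \<epsilon> \<omega> = Y \<omega>) \<and>
     (\<forall>N. even N \<longrightarrow> N > 0 \<longrightarrow> (\<integral>\<^sup>+\<omega>. ennreal (\<bar>Y \<omega>\<bar> ^ N) \<partial>M) \<le>
       ennreal ((D * real N powr (real (multi_order k) / 2 + H * real (multi_order k) + real CARD('d) * H)) ^ N))"
proof -
  define K where "K = multi_order k"
  define \<gamma> where "\<gamma> = real K / 2 + H * real K + real CARD('d) * H"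
  define a where "a = H * real K + real CARD('d) * H / 2"
  \<comment> \<open>The hypothesis \<open>small\<close> divided by \<open>2\<close>: the
    singularities met by each time are integrable.\<close>
  have a: "0 \<le> a" "a < 1" using H small by (auto simp: a_def K_def field_simps)
  from prod_nn_integral_moment_fbm_form_le[OF H, of "\<lambda>i. k $ i", folded multi_order_def, folded K_def]
  obtain C where C: "C > 0" and Cb: "\<forall>N s r. N > 0 \<longrightarrow> (\<forall>j<N. s j \<ge> 0) \<longrightarrow> (\<forall>j<N. r j \<ge> 0) \<longrightarrow>
    (\<Prod>i\<in>UNIV. \<integral>\<^sup>+p. (\<Prod>j<N. ennreal (\<bar>p j\<bar> ^ (k $ i))) *
        ennreal (exp (- (fbm_form H N s p + fbm_form H N r p) / 2)) \<partial>PiM {..<N} (\<lambda>_. lborel))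
     \<le> ennreal ((C * N powr (\<gamma> / 2)) ^ N) * (\<Prod>m<N. sing_sum a N s m) *
       (ennreal ((C * N powr (\<gamma> / 2)) ^ N) * (\<Prod>m<N. sing_sum a N r m))"
    unfolding \<gamma>_def[symmetric] a_def[symmetric] by (elim exE conjE)
  define E where "E = 1 + 2 / (1 - a)"
  have E: "E > 0" using a by (auto simp: E_def intro!: add_pos_nonneg)
  \<comment> \<open>One factor \<open>C * E\<close> for the times of \<open>B\<close>, one for the
    times of \<open>B'\<close>.\<close>
  define D where "D = (C * E)\<^sup>2"
  have D: "D > 0" using C E by (simp add: D_def)
  have Bm: "B t \<in> borel_measurable M" "B' t \<in> borel_measurable M" if "t \<ge> 0" for t
  proof -
    have c: "(\<lambda>w. w t) \<in> borel_measurable (path_space {0..} :: (real \<Rightarrow> real ^ 'd::{finite,linorder}) measure)"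
      using that by (intro measurable_component_singleton) auto
    show "B t \<in> borel_measurable M"
      using measurable_compose[OF indep_var_rv1[OF indep] c] that by (simp add: path_on_def)
    show "B' t \<in> borel_measurable M"
      using measurable_compose[OF indep_var_rv2[OF indep] c] that by (simp add: path_on_def)
  qed
  have "AE \<omega> in M. continuous_on {0..} (\<lambda>t. B t \<omega>) \<and> continuous_on {0..} (\<lambda>t. B' t \<omega>)"
    using B B' by (auto simp: fbm_def)
  then obtain A where A: "{\<omega> \<in> space M. \<not> (continuous_on {0..} (\<lambda>t. B t \<omega>) \<and> continuous_on {0..} (\<lambda>t. B' t \<omega>))} \<subseteq> A"
    "emeasure M A = 0" "A \<in> sets M"
    by (rule AE_E)
  have AE_A: "AE \<omega> in M. \<omega> \<notin> A" using A by (intro AE_not_in) (auto simp: null_sets_def)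
  \<comment> \<open>The paths are set to \<open>0\<close> on the null set \<open>A\<close> and
    frozen before time \<open>0\<close>, so that each of them is continuous on the whole
    line.\<close>
  define Z where "Z X s \<omega> = (if \<omega> \<in> A then 0 else X (max 0 s) \<omega>)"
    for X :: "real \<Rightarrow> 'a \<Rightarrow> (real, 'd) vec" and s \<omega>
  have Zm: "Z X s \<in> borel_measurable M" if "\<And>t. t \<ge> 0 \<Longrightarrow> X t \<in> borel_measurable M" for X s
    unfolding Z_def[abs_def] using that[of "max 0 s"] A(3) by (intro measurable_If_set) auto
  have Zc: "continuous_on UNIV (\<lambda>s. Z X s \<omega>)" if "\<omega> \<notin> A \<Longrightarrow> continuous_on {0..} (\<lambda>t. X t \<omega>)" for X \<omega>
  proof (cases "\<omega> \<in> A")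
    case False
    have "continuous_on UNIV (\<lambda>s. X (max 0 s) \<omega>)"
      by (rule continuous_on_compose2[OF that[OF False], of UNIV "\<lambda>s. max 0 s"]) (auto intro!: continuous_intros)
    then show ?thesis using False by (simp add: Z_def)
  qed (simp add: Z_def)
  have cont: "continuous_on UNIV (\<lambda>s. Z B s \<omega>)" "continuous_on UNIV (\<lambda>s. Z B' s \<omega>)" if "\<omega> \<in> space M" for \<omega>
    using A(1) that by (auto intro!: Zc)
  note Z = Zm[of B, OF Bm(1)] cont(1) Zm[of B', OF Bm(2)] cont(2)
  show ?thesis
  proof (rule that[OF D])
    fix \<epsilon> :: real assume \<epsilon>: "\<epsilon> > 0"
    define \<phi> where "\<phi> = multi_deriv k (gauss_kernel \<epsilon>)"
    have \<phi>_eq: "\<phi> = (\<lambda>x. \<Prod>i\<in>UNIV. Re (gft \<epsilon> (k $ i) (x $ i)))"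
      unfolding \<phi>_def by (rule multi_deriv_gauss_kernel[OF \<epsilon>])
    have \<phi>m: "\<phi> \<in> borel_measurable borel"
    proof -
      have "(\<lambda>x. x $ i) \<in> borel_measurable (borel :: (real, 'd) vec measure)" for i
        by (intro borel_measurable_continuous_onI continuous_intros)
      then have "(\<lambda>x. Re (gft \<epsilon> (k $ i) (x $ i))) \<in> borel_measurable (borel :: (real, 'd) vec measure)" for i
        using measurable_compose[OF _ Re_gft_measurable[OF \<epsilon>]] by blast
      then show ?thesis unfolding \<phi>_eq by (intro borel_measurable_prod)
    qed
    have \<phi>b: "\<bar>\<phi> x\<bar> \<le> (\<Prod>i\<in>UNIV. \<integral>p. norm (gft_integrand \<epsilon> (k $ i) p) \<partial>lborel)" for x
      unfolding \<phi>_eq abs_prod by (intro prod_mono conjI abs_Re_gft_le) auto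
    note di = Z \<phi>m \<phi>b
    define Y where "Y = double_int (Z B) (Z B') \<phi>"
    have Ym: "Y \<in> borel_measurable M"
      unfolding Y_def by (rule double_int_measurable[OF di])
    have "AE \<omega> in M. approx_ilt_deriv k B B' \<epsilon> \<omega> = Y \<omega>"
      using AE_A
    proof eventually_elim
      case (elim \<omega>)
      have ind: "(\<integral>x. f x \<partial>unit_meas) = set_lebesgue_integral lborel {0..1} f" for f :: "real \<Rightarrow> real"
        unfolding set_lebesgue_integral_def by (rule integral_restrict_space) simp
      show ?case
        unfolding Y_def double_int_def approx_ilt_deriv_def ind \<phi>_def[symmetric] using elim
        by (intro set_lebesgue_integral_cong) (auto intro!: set_lebesgue_integral_cong simp: Z_def)
    qed
    moreover have "(\<integral>\<^sup>+\<omega>. ennreal (\<bar>Y \<omega>\<bar> ^ N) \<partial>M) \<le> ennreal ((D * real N powr \<gamma>) ^ N)" if N: "even N" "N > 0" for N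
    proof -
      define U where "U = PiM {..<N} (\<lambda>_. unit_meas)"
      define c where "c = (C * N powr (\<gamma> / 2)) ^ N"
      define S where "S s = (\<Prod>m<N. sing_sum a N s m)" for s
      have Sm: "S \<in> borel_measurable U"
        unfolding S_def[abs_def] U_def by (intro borel_measurable_prod_ennreal sing_sum_measurable) auto
      have SU: "(\<integral>\<^sup>+s. S s \<partial>U) \<le> ennreal (E ^ N)"
        unfolding S_def U_def E_def by (intro nn_integral_prod_sing_sum_le a) simp
      have "(\<integral>\<^sup>+\<omega>. ennreal (\<bar>Y \<omega>\<bar> ^ N) \<partial>M) = (\<integral>\<^sup>+\<omega>. ennreal (Y \<omega> ^ N) \<partial>M)"
        using N by (simp add: power_even_abs)
      also have "\<dots> = ennreal (\<integral>\<omega>. Y \<omega> ^ N \<partial>M)"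
        unfolding Y_def using N by (intro nn_integral_eq_integral expectation_double_int_power_le[OF di]) (auto simp only: zero_le_even_power)
      also have "\<dots> \<le> ennreal \<bar>\<integral>\<omega>. Y \<omega> ^ N \<partial>M\<bar>" by (intro ennreal_leI) simp
      also have "\<dots> \<le> (\<integral>\<^sup>+s. \<integral>\<^sup>+r. ennreal \<bar>\<integral>\<omega>. (\<Prod>j<N. \<phi> (Z B (s j) \<omega> - Z B' (r j) \<omega>)) \<partial>M\<bar> \<partial>U \<partial>U)"
        unfolding Y_def U_def by (rule expectation_double_int_power_le[OF di])
      also have "\<dots> \<le> (\<integral>\<^sup>+s. \<integral>\<^sup>+r. (ennreal c * S s) * (ennreal c * S r) \<partial>U \<partial>U)"
      proof (intro nn_integral_mono)
        fix s r assume sr: "s \<in> space U" "r \<in> space U"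
        then have s: "s j \<ge> 0" and r: "r j \<ge> 0" if "j < N" for j
          using that by (auto simp: U_def space_PiM PiE_def Pi_def space_restrict_space)
        have m1: "(\<lambda>\<omega>. \<Prod>j<N. \<phi> (Z B (s j) \<omega> - Z B' (r j) \<omega>)) \<in> borel_measurable M"
          using measurable_compose[OF borel_measurable_diff[OF Z(1,3)] \<phi>m]
          by (intro borel_measurable_prod) auto
        have m2: "(\<lambda>\<omega>. \<Prod>j<N. \<phi> (B (s j) \<omega> - B' (r j) \<omega>)) \<in> borel_measurable M"
          using measurable_compose[OF borel_measurable_diff[OF Bm] \<phi>m] s r
          by (intro borel_measurable_prod) auto
        have "AE \<omega> in M. (\<Prod>j<N. \<phi> (Z B (s j) \<omega> - Z B' (r j) \<omega>)) = (\<Prod>j<N. \<phi> (B (s j) \<omega> - B' (r j) \<omega>))"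
          using AE_A by eventually_elim (auto simp: Z_def max_absorb2 s r intro!: prod.cong)
        then have "(\<integral>\<omega>. (\<Prod>j<N. \<phi> (Z B (s j) \<omega> - Z B' (r j) \<omega>)) \<partial>M) = (\<integral>\<omega>. (\<Prod>j<N. \<phi> (B (s j) \<omega> - B' (r j) \<omega>)) \<partial>M)"
          by (rule integral_cong_AE[OF m1 m2])
        also have "\<dots> = (\<integral>\<omega>. (\<Prod>j<N. \<Prod>i\<in>UNIV. Re (gft \<epsilon> (k $ i) (B (s j) \<omega> $ i - B' (r j) \<omega> $ i))) \<partial>M)"
          unfolding \<phi>_eq by simp
        finally have "ennreal \<bar>\<integral>\<omega>. (\<Prod>j<N. \<phi> (Z B (s j) \<omega> - Z B' (r j) \<omega>)) \<partial>M\<bar> \<le>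
          (\<Prod>i\<in>UNIV. \<integral>\<^sup>+p. (\<Prod>j<N. ennreal (\<bar>p j\<bar> ^ (k $ i))) *
            ennreal (exp (- (fbm_form H N s p + fbm_form H N r p) / 2)) \<partial>PiM {..<N} (\<lambda>_. lborel))"
          using expectation_prod_gft_le[OF B B' indep, where N = N and s = s and r = r and k = "\<lambda>i. k $ i", OF s r \<epsilon>] by simp
        also have "\<dots> \<le> (ennreal c * S s) * (ennreal c * S r)"
          unfolding c_def S_def using Cb N(2) s r by blast
        finally show "ennreal \<bar>\<integral>\<omega>. (\<Prod>j<N. \<phi> (Z B (s j) \<omega> - Z B' (r j) \<omega>)) \<partial>M\<bar> \<le> (ennreal c * S s) * (ennreal c * S r)" .
      qed
      also have "\<dots> = (ennreal c * (\<integral>\<^sup>+s. S s \<partial>U)) * (ennreal c * (\<integral>\<^sup>+r. S r \<partial>U))"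
        using Sm by (simp add: nn_integral_cmult nn_integral_multc)
      also have "\<dots> \<le> (ennreal c * ennreal (E ^ N)) * (ennreal c * ennreal (E ^ N))"
        using SU by (intro mult_mono mult_left_mono) auto
      also have "\<dots> = ennreal ((c * E ^ N) * (c * E ^ N))"
        using C E by (simp add: ennreal_mult c_def)
      also have "(c * E ^ N) * (c * E ^ N) = ((C * N powr (\<gamma> / 2) * E) * (C * N powr (\<gamma> / 2) * E)) ^ N"
        by (simp add: c_def power_mult_distrib)
      also have "(C * N powr (\<gamma> / 2) * E) * (C * N powr (\<gamma> / 2) * E) = D * (N powr (\<gamma> / 2) * N powr (\<gamma> / 2))"
        by (simp add: D_def power2_eq_square)
      also have "N powr (\<gamma> / 2) * N powr (\<gamma> / 2) = N powr \<gamma>" by (simp add: powr_add[symmetric])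
      finally show ?thesis .
    qed
    ultimately show "\<exists>Y\<in>borel_measurable M. (AE \<omega> in M. approx_ilt_deriv k B B' \<epsilon> \<omega> = Y \<omega>) \<and>
     (\<forall>N. even N \<longrightarrow> N > 0 \<longrightarrow> (\<integral>\<^sup>+\<omega>. ennreal (\<bar>Y \<omega>\<bar> ^ N) \<partial>M) \<le>
       ennreal ((D * real N powr (real (multi_order k) / 2 + H * real (multi_order k) + real CARD('d) * H)) ^ N))"
      unfolding \<gamma>_def K_def using Ym by blast
  qed
qed

theorem theorem1p3:
  fixes \<Omega> :: "'w measure"
    and B B' :: "real \<Rightarrow> 'w \<Rightarrow> real ^ 'd::{finite,linorder}"
    and k :: "nat ^ 'd::{finite,linorder}"
    and H \<beta> :: real
    and \<alpha> :: "'w \<Rightarrow> real"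
  assumes "prob_space \<Omega>"
    and "0 < H" and "H < 1"
    and "fbm \<Omega> H B" and "fbm \<Omega> H B'"
    and "prob_space.indep_var \<Omega> (path_space {0..}) (path_on {0..} B)
           (path_space {0..}) (path_on {0..} B')"
    and "2 * real (multi_order k) * H + H * real CARD('d) < 2"
    and "0 \<le> \<beta>"
    and "\<beta> < 1 / (real (multi_order k) + real (multi_order k) * H + real CARD('d) * H)"
    and "is_ilt_deriv \<Omega> k B B' \<alpha>"
  shows "\<exists>M>0. integrable \<Omega> (\<lambda>\<omega>. exp (M * \<bar>\<alpha> \<omega>\<bar> powr \<beta>))"
proof -
  interpret prob_space \<Omega> by fact
  define \<gamma> where "\<gamma> = real (multi_order k) / 2 + H * real (multi_order k) + real CARD('d) * H"
  define \<gamma>' where "\<gamma>' = real (multi_order k) + real (multi_order k) * H + real CARD('d) * H"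
  have \<gamma>: "\<gamma> > 0" using \<open>0 < H\<close> by (auto simp: \<gamma>_def intro!: add_nonneg_pos)
  have le: "\<gamma> \<le> \<gamma>'" by (simp add: \<gamma>_def \<gamma>'_def)
  have \<beta>: "\<beta> * \<gamma> < 1"
  proof -
    have "\<beta> * \<gamma> \<le> \<beta> * \<gamma>'" using le \<open>0 \<le> \<beta>\<close> by (rule mult_left_mono)
    also have "\<dots> < 1 / \<gamma>' * \<gamma>'"
      using \<open>\<beta> < _\<close> \<gamma> le unfolding \<gamma>'_def[symmetric] by (intro mult_strict_right_mono) auto
    finally show ?thesis using \<gamma> le by simp
  qed
  obtain D where D: "D > 0" and ex: "\<And>\<epsilon>. \<epsilon> > 0 \<Longrightarrow> \<exists>Y\<in>borel_measurable \<Omega>. (AE \<omega> in \<Omega>. approx_ilt_deriv k B B' \<epsilon> \<omega> = Y \<omega>) \<and>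
     (\<forall>N. even N \<longrightarrow> N > 0 \<longrightarrow> (\<integral>\<^sup>+\<omega>. ennreal (\<bar>Y \<omega>\<bar> ^ N) \<partial>\<Omega>) \<le> ennreal ((D * real N powr \<gamma>) ^ N))"
    using approx_ilt_deriv_moments[OF \<open>0 < H\<close> \<open>H < 1\<close> \<open>fbm \<Omega> H B\<close> \<open>fbm \<Omega> H B'\<close> assms(6,7)]
    unfolding \<gamma>_def by blast
  have "\<forall>\<epsilon>\<in>{0<..}. \<exists>Y. Y \<in> borel_measurable \<Omega> \<and> (AE \<omega> in \<Omega>. approx_ilt_deriv k B B' \<epsilon> \<omega> = Y \<omega>) \<and>
     (\<forall>N. even N \<longrightarrow> N > 0 \<longrightarrow> (\<integral>\<^sup>+\<omega>. ennreal (\<bar>Y \<omega>\<bar> ^ N) \<partial>\<Omega>) \<le> ennreal ((D * real N powr \<gamma>) ^ N))"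
    using ex by blast
  then obtain Y where Y: "\<forall>\<epsilon>\<in>{0<..}. Y \<epsilon> \<in> borel_measurable \<Omega> \<and> (AE \<omega> in \<Omega>. approx_ilt_deriv k B B' \<epsilon> \<omega> = Y \<epsilon> \<omega>) \<and>
     (\<forall>N. even N \<longrightarrow> N > 0 \<longrightarrow> (\<integral>\<^sup>+\<omega>. ennreal (\<bar>Y \<epsilon> \<omega>\<bar> ^ N) \<partial>\<Omega>) \<le> ennreal ((D * real N powr \<gamma>) ^ N))"
    by (rule bchoice[THEN exE])
  have \<alpha>: "\<alpha> \<in> borel_measurable \<Omega>" using \<open>is_ilt_deriv \<Omega> k B B' \<alpha>\<close> by (simp add: is_ilt_deriv_def)
  \<comment> \<open>The factor \<open>2\<close> in front of \<open>D\<close> is the loss in the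
    passage to the limit.\<close>
  have mom: "(\<integral>\<^sup>+\<omega>. ennreal (\<bar>\<alpha> \<omega>\<bar> ^ N) \<partial>\<Omega>) \<le> ennreal ((2 * D * real N powr \<gamma>) ^ N)" if N: "even N" "N > 0" for N
  proof -
    have "((\<lambda>\<epsilon>. \<integral>\<^sup>+\<omega>. ennreal (\<bar>approx_ilt_deriv k B B' \<epsilon> \<omega> - \<alpha> \<omega>\<bar> ^ N) \<partial>\<Omega>) \<longlongrightarrow> 0) (at_right 0)"
      using \<open>is_ilt_deriv \<Omega> k B B' \<alpha>\<close> N by (auto simp: is_ilt_deriv_def)
    moreover have "eventually (\<lambda>\<epsilon>. (\<integral>\<^sup>+\<omega>. ennreal (\<bar>approx_ilt_deriv k B B' \<epsilon> \<omega> - \<alpha> \<omega>\<bar> ^ N) \<partial>\<Omega>) =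
        (\<integral>\<^sup>+\<omega>. ennreal (\<bar>Y \<epsilon> \<omega> - \<alpha> \<omega>\<bar> ^ N) \<partial>\<Omega>)) (at_right 0)"
      using eventually_at_right_less[of "0::real"]
    proof eventually_elim
      case (elim \<epsilon>)
      then have "AE \<omega> in \<Omega>. approx_ilt_deriv k B B' \<epsilon> \<omega> = Y \<epsilon> \<omega>" using Y by auto
      then show ?case by (intro nn_integral_cong_AE) auto
    qed
    ultimately have "((\<lambda>\<epsilon>. \<integral>\<^sup>+\<omega>. ennreal (\<bar>Y \<epsilon> \<omega> - \<alpha> \<omega>\<bar> ^ N) \<partial>\<Omega>) \<longlongrightarrow> 0) (at_right 0)"
      by (rule Lim_transform_eventually)
    then have "(\<integral>\<^sup>+\<omega>. ennreal (\<bar>\<alpha> \<omega>\<bar> ^ N) \<partial>\<Omega>) \<le> ennreal (2 ^ N * (D * real N powr \<gamma>) ^ N)"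
      using Y N D by (intro nn_integral_power_le_of_limit[OF \<alpha>, of Y]) auto
    then show ?thesis by (simp add: power_mult_distrib mult.assoc)
  qed
  have "integrable \<Omega> (\<lambda>\<omega>. exp (\<bar>\<alpha> \<omega>\<bar> powr \<beta>))"
    using D by (intro integrable_exp_powr_of_moments[OF prob_space_axioms \<alpha> \<open>0 \<le> \<beta>\<close> \<gamma> \<beta>, of "2 * D"] mom) auto
  \<comment> \<open>As \<open>\<beta> * \<gamma> < 1\<close> is strict, the series converges without
    a small factor in the exponent, and \<open>1\<close> serves as \<open>M\<close>.\<close>
  then show ?thesis by (intro exI[of _ 1]) simp
qed

end
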